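(* Let $0<2\alpha<1$, let $D,X,\Gamma$ be as in the context, and let $\mu_1$ be a continuous function on $\overline\Gamma$, written $\mu_1(s,t)$ in terms of the parameters. Then the double-layer potential $$w^{(1)}(x,y,z)=\iint_\Gamma\mu_1(\theta,\vartheta)\,B_\nu^\alpha\left[q_1(\xi,\eta,\zeta;x,y,z)\right]d\Gamma$$ has limits as $(x,y,z)$ tends to a point $(x_0,y_0,z_0)=(x(s,t),y(s,t),z(s,t))$ of $\Gamma$ from outside or from inside $D$. Denoting the limit from inside by $w_i^{(1)}(s,t)$ and the limit from outside by $w_e^{(1)}(s,t)$, one has $$w_i^{(1)}(s,t)=-\frac12\mu_1(s,t)+\iint_\Gamma\mu_1(\theta,\vartheta)K_1(s,t;\theta,\vartheta)\,d\Gamma,$$ $$w_e^{(1)}(s,t)=\frac12\mu_1(s,t)+\iint_\Gamma\mu_1(\theta,\vartheta)K_1(s,t;\theta,\vartheta)\,d\Gamma,$$ where $$K_1(s,t;\theta,\vartheta)=B_\nu^\alpha\left[q_1\left(\xi(\theta,\vartheta),\eta(\theta,\vartheta),\zeta(\theta,\vartheta);x(s,t),y(s,t),z(s,t)\right)\right].$$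
   Context: Domain. $X$ is a simply connected open region of the plane $x=0$ (the $yOz$-plane), $\Gamma$ is a Lyapunov surface lying in $x>0$ (it has a normal at every point; there is $d>0$ such that lines parallel to the normal at $N\in\Gamma$ meet the part of $\Gamma$ inside the ball of radius $d$ about $N$ at most once; the angle between the normals at two points at distance $\rho$ is at most $A\rho^{\lambda}$ with constants $A>0$, $0<\lambda\le1$), and $D$ is the domain bounded by $X$ and $\Gamma$; $\gamma$ is the common boundary curve of $X$ and $\Gamma$. $\Gamma$ is parametrized by $x=x(s,t)$, $y=y(s,t)$, $z=z(s,t)$, $(s,t)\in\overline\Phi$, $\Phi=(s_1,s_2)\times(t_1,t_2)$, and $\gamma$ by $y=y(s,t_0)$, $z=z(s,t_0)$, where $t_0\in[t_1,t_2]$ is fixed with $x(s,t_0)=0$ for all $s\in[s_1,s_2]$. It is assumed that: 1) $x(s,t),y(s,t),z(s,t)$ have continuous first partial derivatives on $\overline\Phi$ with $x_s^2+y_s^2+z_s^2\ne0$ and $x_t^2+y_t^2+z_t^2\ne0$; 2) as points of $\Gamma$ approach $\gamma$, $\Gamma$ forms a right angle with the plane $x=0$. The variable (integration) point of $\Gamma$ is $(\xi,\eta,\zeta)=(\xi(\theta,\vartheta),\eta(\theta,\vartheta),\zeta(\theta,\vartheta))$ in the same parametrization, $(\theta,\vartheta)\in\overline\Phi$; $d\Gamma$ is the surface area element at this point; $\nu$ is the outer (with respect to $D$) unit normal to $\Gamma$ there. Fundamental solution of $u_{xx}+u_{yy}+u_{zz}+\frac{2\alpha}{x}u_x=0$: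 with $F$ the (analytically continued) Gauss hypergeometric function, $$q_1(x,y,z;\xi,\eta,\zeta)=\frac1{2\pi}r^{-2\alpha-1}F\left(\alpha+\tfrac12,\alpha;2\alpha;1-\tfrac{r_1^2}{r^2}\right),$$ $r^2=(x-\xi)^2+(y-\eta)^2+(z-\zeta)^2$, $r_1^2=(x+\xi)^2+(y-\eta)^2+(z-\zeta)^2$ (symmetric in the two points). Conormal derivative (acting in the integration point): $B_\nu^\alpha=\xi^{2\alpha}\left(\cos(\nu,\xi)\partial_\xi+\cos(\nu,\eta)\partial_\eta+\cos(\nu,\zeta)\partial_\zeta\right)$. *)

theory Defs
  imports "HOL-Complex_Analysis.Complex_Analysis"
begin

text \<open>
  The Gauss hypergeometric function: the holomorphic continuation of the hypergeometric series
  from the unit disc to the plane cut along \<open>[1, \<infinity>)\<close>. On the cut plane the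
  continuation is unique by the identity theorem, so there the choice operator only names it; the
  values on the cut are irrelevant.
\<close>

definition hyp2F1 :: "complex \<Rightarrow> complex \<Rightarrow> complex \<Rightarrow> complex \<Rightarrow> complex" where
  "hyp2F1 a b c =
    (SOME f. f holomorphic_on (- {of_real x |x::real. x \<ge> 1}) \<and>
       (\<forall>z. norm z < 1 \<longrightarrow>
          (\<lambda>n. pochhammer a n * pochhammer b n / (pochhammer c n * fact n) * z ^ n) sums f z))"

text \<open>
  Points of space are vectors \<open>(x, y, z)\<close> in \<open>real^3\<close>; the coordinate \<open>x\<close> is \<open>p $ 1\<close>.
  For \<open>p $ 1 * q $ 1 \<ge> 0\<close> and \<open>p \<noteq> q\<close> the argument of the hypergeometric function is a
  nonpositive real number, where the function is real valued.
\<close>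

definition dist_r :: "real^3 \<Rightarrow> real^3 \<Rightarrow> real" where
  "dist_r p q = sqrt ((p$1 - q$1)\<^sup>2 + (p$2 - q$2)\<^sup>2 + (p$3 - q$3)\<^sup>2)"

definition dist_r1 :: "real^3 \<Rightarrow> real^3 \<Rightarrow> real" where
  "dist_r1 p q = sqrt ((p$1 + q$1)\<^sup>2 + (p$2 - q$2)\<^sup>2 + (p$3 - q$3)\<^sup>2)"

definition q1 :: "real \<Rightarrow> real^3 \<Rightarrow> real^3 \<Rightarrow> real" where
  "q1 \<alpha> p q =
     1 / (2 * pi) * dist_r p q powr (- 2 * \<alpha> - 1) *
     Re (hyp2F1 (of_real (\<alpha> + 1/2)) (of_real \<alpha>) (of_real (2 * \<alpha>))
           (of_real (1 - (dist_r1 p q)\<^sup>2 / (dist_r p q)\<^sup>2)))"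

text \<open>
  For a unit vector \<open>n\<close> the direction cosines are its components.
\<close>

definition conormal_deriv :: "real \<Rightarrow> real^3 \<Rightarrow> (real^3 \<Rightarrow> real) \<Rightarrow> real^3 \<Rightarrow> real" where
  "conormal_deriv \<alpha> n f p =
     (p$1) powr (2 * \<alpha>) * (\<Sum>i\<in>UNIV. n$i * deriv (\<lambda>h. f (p + h *\<^sub>R axis i 1)) 0)"

text \<open>
  Partial derivatives on a closed parameter rectangle, one-sided on its boundary.
\<close>

definition partial_s ::
  "(real \<times> real \<Rightarrow> real^3) \<Rightarrow> real \<Rightarrow> real \<Rightarrow> real \<times> real \<Rightarrow> real^3" where
  "partial_s P s1 s2 u = vector_derivative (\<lambda>\<sigma>. P (\<sigma>, snd u)) (at (fst u) within {s1..s2})"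

definition partial_t ::
  "(real \<times> real \<Rightarrow> real^3) \<Rightarrow> real \<Rightarrow> real \<Rightarrow> real \<times> real \<Rightarrow> real^3" where
  "partial_t P t1 t2 u = vector_derivative (\<lambda>\<tau>. P (fst u, \<tau>)) (at (snd u) within {t1..t2})"

definition C1_parametrization ::
  "(real \<times> real \<Rightarrow> real^3) \<Rightarrow> real \<Rightarrow> real \<Rightarrow> real \<Rightarrow> real \<Rightarrow> bool" where
  "C1_parametrization P s1 s2 t1 t2 \<longleftrightarrow>
     (\<forall>s\<in>{s1..s2}. \<forall>t\<in>{t1..t2}.
        (\<lambda>\<sigma>. P (\<sigma>, t)) differentiable (at s within {s1..s2}) \<and>
        (\<lambda>\<tau>. P (s, \<tau>)) differentiable (at t within {t1..t2}) \<and>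
        partial_s P s1 s2 (s, t) \<noteq> 0 \<and> partial_t P t1 t2 (s, t) \<noteq> 0) \<and>
     continuous_on ({s1..s2} \<times> {t1..t2}) (partial_s P s1 s2) \<and>
     continuous_on ({s1..s2} \<times> {t1..t2}) (partial_t P t1 t2)"

text \<open>
  Integration of \<open>g(\<theta>, \<vartheta>)\<close> over the surface covered by \<open>P\<close>, with the area element
  \<open>|P\<^sub>\<theta> \<times> P\<^sub>\<vartheta>| d\<theta> d\<vartheta>\<close>. A parametrization is not assumed to be injective: the parameter
  rectangle of a cap bounded by a closed curve cannot in general be mapped injectively with
  nowhere vanishing partial derivatives. In order that every point of the surface is counted
  exactly once, the area element is divided by the number of parameters of the point. This number
  is 1 almost everywhere for a parametrization in the strict sense. By the area formula, the
  result is the integral with respect to surface area whenever \<open>g\<close> is a function of the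
  surface point; points with infinitely many parameters form a set of zero area, and get weight
  0 since the cardinality of an infinite set is 0 here.
\<close>

definition area_weight ::
  "(real \<times> real \<Rightarrow> real^3) \<Rightarrow> real \<Rightarrow> real \<Rightarrow> real \<Rightarrow> real \<Rightarrow> real \<times> real \<Rightarrow> real" where
  "area_weight P s1 s2 t1 t2 u =
     norm (cross3 (partial_s P s1 s2 u) (partial_t P t1 t2 u)) /
     real (card {v \<in> {s1..s2} \<times> {t1..t2}. P v = P u})"

definition surface_integrable ::
  "(real \<times> real \<Rightarrow> real^3) \<Rightarrow> real \<Rightarrow> real \<Rightarrow> real \<Rightarrow> real \<Rightarrow> (real \<times> real \<Rightarrow> real) \<Rightarrow> bool" where
  "surface_integrable P s1 s2 t1 t2 g \<longleftrightarrow>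
     set_integrable lebesgue ({s1..s2} \<times> {t1..t2}) (\<lambda>u. g u * area_weight P s1 s2 t1 t2 u)"

definition surface_integral ::
  "(real \<times> real \<Rightarrow> real^3) \<Rightarrow> real \<Rightarrow> real \<Rightarrow> real \<Rightarrow> real \<Rightarrow> (real \<times> real \<Rightarrow> real) \<Rightarrow> real" where
  "surface_integral P s1 s2 t1 t2 g =
     (LINT u:{s1..s2} \<times> {t1..t2}|lebesgue. g u * area_weight P s1 s2 t1 t2 u)"

text \<open>
  \<open>n\<close> is orthogonal to the tangent plane of \<open>S\<close> at \<open>N\<close>: the directions of the chords
  from \<open>N\<close> become orthogonal to \<open>n\<close>.
\<close>

definition unit_normal_at :: "(real^3) set \<Rightarrow> real^3 \<Rightarrow> real^3 \<Rightarrow> bool" where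
  "unit_normal_at S N n \<longleftrightarrow>
     norm n = 1 \<and> ((\<lambda>M. (n \<bullet> (M - N)) / norm (M - N)) \<longlongrightarrow> 0) (at N within S)"

definition lyapunov_surface :: "(real^3) set \<Rightarrow> (real^3 \<Rightarrow> real^3) \<Rightarrow> bool" where
  "lyapunov_surface S \<nu> \<longleftrightarrow>
     (\<forall>N\<in>S. unit_normal_at S N (\<nu> N)) \<and>
     (\<exists>d>0. \<forall>N\<in>S. \<forall>p\<in>S \<inter> ball N d. \<forall>q\<in>S \<inter> ball N d.
        (\<exists>c. q = p + c *\<^sub>R \<nu> N) \<longrightarrow> q = p) \<and>
     (\<exists>A>0. \<exists>l. 0 < l \<and> l \<le> 1 \<and>
        (\<forall>M\<in>S. \<forall>N\<in>S. arccos (\<nu> M \<bullet> \<nu> N) \<le> A * dist M N powr l))"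

definition outward_at :: "(real^3) set \<Rightarrow> real^3 \<Rightarrow> real^3 \<Rightarrow> bool" where
  "outward_at D N n \<longleftrightarrow>
     (\<forall>\<^sub>F \<epsilon> in at_right 0. N - \<epsilon> *\<^sub>R n \<in> D \<and> N + \<epsilon> *\<^sub>R n \<notin> closure D)"

text \<open>
  The geometric setting. Since \<open>\<Gamma>\<close> lies in \<open>x > 0\<close>, the boundary curve
  \<open>\<gamma> = closure \<Gamma> - \<Gamma>\<close> does not belong to it, and \<open>P\<close> on the closed rectangle
  parametrizes \<open>closure \<Gamma>\<close>. The region \<open>X\<close> is open in the plane \<open>x = 0\<close>, so
  \<open>closure X - X\<close> is its boundary in that plane. The last condition is the right angle
  between \<open>\<Gamma>\<close> and the plane along \<open>\<gamma>\<close>: the cosine of the angle between the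
  normals tends to 0.
\<close>

definition admissible_domain ::
  "(real^3) set \<Rightarrow> (real^3) set \<Rightarrow> (real^3) set \<Rightarrow> (real^3 \<Rightarrow> real^3) \<Rightarrow>
   (real \<times> real \<Rightarrow> real^3) \<Rightarrow> real \<Rightarrow> real \<Rightarrow> real \<Rightarrow> real \<Rightarrow> real \<Rightarrow> bool" where
  "admissible_domain D X \<Gamma> \<nu> P s1 s2 t1 t2 t0 \<longleftrightarrow>
     X \<noteq> {} \<and> openin (top_of_set {p. p$1 = 0}) X \<and> simply_connected X \<and>
     \<Gamma> \<subseteq> {p. p$1 > 0} \<and> lyapunov_surface \<Gamma> \<nu> \<and>
     D \<noteq> {} \<and> open D \<and> connected D \<and> bounded D \<and> frontier D = closure X \<union> closure \<Gamma> \<and>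
     (\<forall>N\<in>\<Gamma>. outward_at D N (\<nu> N)) \<and>
     s1 < s2 \<and> t1 < t2 \<and> t0 \<in> {t1..t2} \<and>
     P ` ({s1..s2} \<times> {t1..t2}) = closure \<Gamma> \<and>
     (\<forall>s\<in>{s1..s2}. P (s, t0) $ 1 = 0) \<and>
     closure \<Gamma> - \<Gamma> = (\<lambda>s. P (s, t0)) ` {s1..s2} \<and>
     closure X - X = (\<lambda>s. P (s, t0)) ` {s1..s2} \<and>
     C1_parametrization P s1 s2 t1 t2 \<and>
     (\<forall>N \<in> closure \<Gamma> - \<Gamma>. ((\<lambda>M. \<nu> M $ 1) \<longlongrightarrow> 0) (at N within \<Gamma>))"

definition kernel_K1 ::
  "real \<Rightarrow> (real^3 \<Rightarrow> real^3) \<Rightarrow> (real \<times> real \<Rightarrow> real^3) \<Rightarrow> real \<times> real \<Rightarrow> real \<times> real \<Rightarrow> real" where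
  "kernel_K1 \<alpha> \<nu> P v u = conormal_deriv \<alpha> (\<nu> (P u)) (\<lambda>q. q1 \<alpha> q (P v)) (P u)"

definition double_layer ::
  "real \<Rightarrow> (real^3 \<Rightarrow> real^3) \<Rightarrow> (real \<times> real \<Rightarrow> real^3) \<Rightarrow> real \<Rightarrow> real \<Rightarrow> real \<Rightarrow> real \<Rightarrow>
   (real^3 \<Rightarrow> real) \<Rightarrow> real^3 \<Rightarrow> real" where
  "double_layer \<alpha> \<nu> P s1 s2 t1 t2 \<mu> p =
     surface_integral P s1 s2 t1 t2
       (\<lambda>u. \<mu> (P u) * conormal_deriv \<alpha> (\<nu> (P u)) (\<lambda>q. q1 \<alpha> q p) (P u))"

end

(*
  For these parameters F(a, a + 1/2; 2a; z) = (1-z)^(-1/2) ((1 + sqrt(1-z))/2)^(1-2a), hence, with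
  r, r1 the distances of the two points from each other and from the mirror image,
    q1 = 2^(2 alpha - 2)/pi * (r + r1)^(1 - 2 alpha) / (r r1),
  and near a point N of the surface the conormal derivative is -G (nu . (q-p)) / r^3 + O(1/r) with
  G -> 1/(4 pi).
  Near N the surface is the graph of a function f with small gradient over its tangent plane, and
  by the area formula the parametrized surface integral becomes an integral over that plane.
  With a, b the projections of q, p and h the height of the surface above p, Lyapunov's condition
  gives nu . (q-p) = h (nu . n) + O(|a-b|^(1+l)). So up to an integrable singularity |a-b|^(l-2)
  the kernel is the Poisson kernel -(1/4 pi) h / (|a-b|^2 + h^2)^(3/2), whose integral over the
  plane is -1/2 for h > 0 (inside) and 1/2 for h < 0 (outside), and which vanishes for p = N.
  The contribution of the rest of the surface is continuous at N by dominated convergence.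
*)
theory Submission
  imports Defs
begin

text \<open>The parametrization may be many-to-one and degenerate, and its rectangle has edges, so
  it cannot simply be inverted. The division by the number of parameters in
  \<open>area_weight\<close> has to cancel the preimage count of the area formula. This requires
  that number to be a Borel function of the point and finite over almost every point of the tangent
  plane; the exceptions, critical values and the image of the edges, are null.

  Instead the tolerance is fixed first; it determines the slope of the graph and then the size
  \<delta> of the chart. Relative errors in the Poisson kernel cost a multiple of its mass, which is
  the same for all h, the weak singularity costs a multiple of \<open>\<delta> powr l\<close>, and
  only the Poisson mass outside the chart, of order h/\<delta>, needs p close to N. No restriction
  on the direction of approach arises. The point N itself goes through the same estimate with h = 0;
  its local part is therefore small, and the far part at N may be replaced by the whole integral of
  K1.\<close>

no_notation fps_nth (infixl \<open>$\<close> 75)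

section \<open>The fundamental solution in closed form\<close>

definition cut_plane :: "complex set" where
  "cut_plane = - {complex_of_real x |x. x \<ge> 1}"

lemma one_minus_notin_nonpos: "z \<in> cut_plane \<Longrightarrow> 1 - z \<notin> \<real>\<^sub>\<le>\<^sub>0"
proof
  assume z: "z \<in> cut_plane" and "1 - z \<in> \<real>\<^sub>\<le>\<^sub>0"
  then obtain x where "1 - z = of_real x" "x \<le> 0" by (auto elim!: nonpos_Reals_cases)
  then have "z = of_real (1 - x)" "1 - x \<ge> 1" by (auto simp: algebra_simps)
  then show False using z unfolding cut_plane_def by blast
qed

lemma open_cut_plane: "open cut_plane"
proof -
  have "cut_plane = - (complex_of_real ` {1..})"
    by (auto simp: cut_plane_def)
  moreover have "closed (complex_of_real ` {1..})"
    by (intro closed_injective_linear_image) 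
       (auto simp: inj_on_def bounded_linear.linear[OF bounded_linear_of_real])
  ultimately show ?thesis using open_Compl by metis
qed

lemma connected_cut_plane: "connected cut_plane"
proof -
  have "starlike cut_plane"
    unfolding starlike_def
  proof (intro bexI ballI subsetI)
    fix z w assume z: "z \<in> cut_plane" and "w \<in> closed_segment 0 z"
    then obtain u where u: "0 \<le> u" "u \<le> 1" "w = of_real u * z"
      by (auto simp: in_segment scaleR_conv_of_real)
    show "w \<in> cut_plane"
    proof (rule ccontr)
      assume "w \<notin> cut_plane"
      then obtain x where x: "w = of_real x" "x \<ge> 1" by (auto simp: cut_plane_def)
      then have "u \<noteq> 0" using u by auto
      then have "z = of_real (x / u)" using u x by (simp add: field_simps)
      moreover have "x / u \<ge> 1" using u x \<open>u \<noteq> 0\<close> by (simp add: field_simps)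
      ultimately show False using z unfolding cut_plane_def by blast
    qed
  qed (auto simp: cut_plane_def)
  then show ?thesis by (rule starlike_imp_connected)
qed

lemma unit_ball_subset_cut_plane: "norm z < 1 \<Longrightarrow> z \<in> cut_plane"
  by (auto simp: cut_plane_def)

text \<open>The principal root never has negative real part, and a purely imaginary root would
  square to a nonpositive real. Positivity keeps both the root and the base
  \<open>(1 + csqrt (1 - z)) / 2\<close> away from the branch cut.\<close>

lemma Re_csqrt_pos: "w \<notin> \<real>\<^sub>\<le>\<^sub>0 \<Longrightarrow> Re (csqrt w) > 0"
proof -
  assume w: "w \<notin> \<real>\<^sub>\<le>\<^sub>0"
  have "Re (csqrt w) \<noteq> 0"
  proof
    assume "Re (csqrt w) = 0"
    then have "csqrt w = \<i> * of_real (Im (csqrt w))" by (auto simp: complex_eq_iff simp del: csqrt.simps)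
    then have "(csqrt w)^2 = - of_real ((Im (csqrt w))^2)"
      by (metis mult_minus_left i_squared mult_minus1 power2_eq_square power_mult_distrib of_real_power)
    then have "w = of_real (- ((Im (csqrt w))^2))" by simp
    then show False using w
      by (metis nonpos_Reals_of_real_iff neg_le_0_iff_le zero_le_power2)
  qed
  then show ?thesis using Re_csqrt[of w] by linarith
qed

section \<open>The candidate for the continuation and its differential equations\<close>

definition hyp_closed :: "real \<Rightarrow> complex \<Rightarrow> complex" where
  "hyp_closed \<beta> z = ((1 + csqrt (1 - z)) / 2) powr of_real \<beta> / csqrt (1 - z)"

text \<open>The numerator of \<open>hyp_closed\<close>. The pair satisfies a closed linear system of
  first order, which replaces the hypergeometric equation of second order.\<close>

definition hyp_aux :: "real \<Rightarrow> complex \<Rightarrow> complex" where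
  "hyp_aux \<beta> z = ((1 + csqrt (1 - z)) / 2) powr of_real \<beta>"

lemma hyp_aux_arg_notin: "z \<in> cut_plane \<Longrightarrow> (1 + csqrt (1 - z)) / 2 \<notin> \<real>\<^sub>\<le>\<^sub>0"
  using Re_csqrt_pos[OF one_minus_notin_nonpos, of z]
  by (auto simp: complex_nonpos_Reals_iff simp del: csqrt.simps)

lemma csqrt_cut_nonzero: "z \<in> cut_plane \<Longrightarrow> csqrt (1 - z) \<noteq> 0"
  using Re_csqrt_pos[OF one_minus_notin_nonpos, of z] by auto

lemma hyp_aux_holomorphic: "hyp_aux \<beta> holomorphic_on cut_plane"
  unfolding hyp_aux_def
  by (intro holomorphic_intros) (use one_minus_notin_nonpos hyp_aux_arg_notin in auto)

lemma hyp_closed_holomorphic: "hyp_closed \<beta> holomorphic_on cut_plane"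
  unfolding hyp_closed_def
  by (intro holomorphic_intros)
     (use one_minus_notin_nonpos hyp_aux_arg_notin csqrt_cut_nonzero in auto)

lemma hyp_aux_has_derivative:
  assumes z: "z \<in> cut_plane"
  defines "w \<equiv> csqrt (1 - z)"
  shows "(hyp_aux \<beta> has_field_derivative - (of_real \<beta> * hyp_aux \<beta> z / (2 * w * (1 + w)))) (at z)"
    and "((\<lambda>z. csqrt (1 - z)) has_field_derivative - 1 / (2 * w)) (at z)"
proof -
  show W: "((\<lambda>z. csqrt (1 - z)) has_field_derivative - 1 / (2 * w)) (at z)"
    unfolding w_def using has_field_derivative_csqrt'[of "\<lambda>z. 1 - z" "-1" z UNIV] one_minus_notin_nonpos[OF z]
    by (auto intro!: derivative_eq_intros)
  have a: "(1 + w) / 2 \<notin> \<real>\<^sub>\<le>\<^sub>0" using hyp_aux_arg_notin[OF z] by (simp add: w_def)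
  have w1: "1 + w \<noteq> 0" using a by auto
  have V: "((\<lambda>z. (1 + csqrt (1 - z)) / 2) has_field_derivative (0 + - 1 / (2 * w)) / 2) (at z)"
    by (intro DERIV_add DERIV_const DERIV_cdivide W)
  have "(hyp_aux \<beta> has_field_derivative
     of_real \<beta> * ((1 + w) / 2) powr (of_real \<beta> - 1) * ((0 + - 1 / (2 * w)) / 2)) (at z)"
    unfolding hyp_aux_def
    by (rule DERIV_chain2[where f = "\<lambda>z. z powr of_real \<beta>", OF has_field_derivative_powr V, folded w_def, OF a])
  also have "((1 + w) / 2) powr (of_real \<beta> - 1) = hyp_aux \<beta> z / ((1 + w) / 2)"
    using w1 by (simp add: powr_diff hyp_aux_def w_def)
  also have "of_real \<beta> * (hyp_aux \<beta> z / ((1 + w) / 2)) * ((0 + - 1 / (2 * w)) / 2) =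
      - (of_real \<beta> * hyp_aux \<beta> z / (2 * w * (1 + w)))"
    by simp
  finally show "(hyp_aux \<beta> has_field_derivative - (of_real \<beta> * hyp_aux \<beta> z / (2 * w * (1 + w)))) (at z)" .
qed

text \<open>With \<open>w = csqrt (1 - z)\<close> one has z = (1 - w)(1 + w), so the factor z
  cancels the 1 + w in the derivative of the numerator, and \<open>e / w\<close> is
  \<open>hyp_closed\<close> again.\<close>

lemma hyp_aux_deriv:
  assumes z: "z \<in> cut_plane"
  shows "2 * z * deriv (hyp_aux \<beta>) z = of_real \<beta> * (hyp_aux \<beta> z - hyp_closed \<beta> z)"
proof -
  define w where "w = csqrt (1 - z)"
  define e where "e = hyp_aux \<beta> z"
  have w0: "w \<noteq> 0" using csqrt_cut_nonzero[OF z] by (simp add: w_def)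
  have w1: "1 + w \<noteq> 0" using hyp_aux_arg_notin[OF z] by (auto simp: w_def)
  have z': "z = (1 - w) * (1 + w)"
    by (simp add: w_def algebra_simps flip: power2_eq_square)
  have "2 * z * deriv (hyp_aux \<beta>) z = 2 * z * (- (of_real \<beta> * e / (2 * w * (1 + w))))"
    using DERIV_imp_deriv[OF hyp_aux_has_derivative(1)[OF z]] by (simp add: e_def w_def)
  also have "\<dots> = (1 - w) * (- (of_real \<beta> * e / w))"
    unfolding z' using w1 by simp
  also have "\<dots> = of_real \<beta> * (e - e / w)"
    using w0 by (simp add: field_simps)
  finally show ?thesis by (simp add: e_def w_def hyp_closed_def hyp_aux_def)
qed

lemma hyp_closed_deriv:
  assumes z: "z \<in> cut_plane"
  shows "2 * z * (1 - z) * deriv (hyp_closed \<beta>) z =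
    z * hyp_closed \<beta> z - of_real \<beta> * hyp_aux \<beta> z + of_real \<beta> * (1 - z) * hyp_closed \<beta> z"
proof -
  define w where "w = csqrt (1 - z)"
  define e where "e = hyp_aux \<beta> z"
  define b where "b = complex_of_real \<beta>"
  have w0: "w \<noteq> 0" using csqrt_cut_nonzero[OF z] by (simp add: w_def)
  have w1: "1 + w \<noteq> 0" using hyp_aux_arg_notin[OF z] by (auto simp: w_def)
  have z': "z = (1 - w) * (1 + w)"
    by (simp add: w_def algebra_simps flip: power2_eq_square)
  have z2: "1 - z = w * w" by (simp add: w_def flip: power2_eq_square)
  have eq: "hyp_closed \<beta> = (\<lambda>z. hyp_aux \<beta> z / csqrt (1 - z))"
    by (simp add: hyp_closed_def hyp_aux_def fun_eq_iff)
  have "(hyp_closed \<beta> has_field_derivative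
      (- (b * e / (2 * w * (1 + w))) * w - e * (- 1 / (2 * w))) / (w * w)) (at z)"
    unfolding eq w_def e_def b_def
    by (intro DERIV_divide hyp_aux_has_derivative[OF z] csqrt_cut_nonzero[OF z])
  then have "2 * z * (1 - z) * deriv (hyp_closed \<beta>) z =
      2 * z * (w * w) * ((- (b * e / (2 * w * (1 + w))) * w - e * (- 1 / (2 * w))) / (w * w))"
    using DERIV_imp_deriv z2 by metis
  also have "\<dots> = 2 * z * (- (b * e / (2 * w * (1 + w))) * w + e / (2 * w))"
    using w0 by simp
  also have "\<dots> = - (2 * z * (b * e / (2 * w * (1 + w))) * w) + z * (e / w)"
  proof -
    have "2 * z * (- X * w + e / (2 * w)) = - (2 * z * X * w) + z * (e / w)" for X
      by (simp add: right_diff_distrib)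
    then show ?thesis by blast
  qed
  also have "2 * z * (b * e / (2 * w * (1 + w))) * w = (1 - w) * (b * e)"
    unfolding z' using w0 w1 by simp
  also have "- ((1 - w) * (b * e)) + z * (e / w) = z * (e / w) - b * e + b * (1 - z) * (e / w)"
    unfolding z2 using w0 by (simp add: algebra_simps)
  finally show ?thesis by (simp add: e_def w_def eq b_def)
qed

text \<open>Comparing Taylor coefficients in the two differential equations gives two linear
  relations between the coefficients of the numerator and of \<open>hyp_closed\<close>; eliminating
  the former leaves a ratio of consecutive coefficients. For
  \<open>\<beta> = 1 - 2 * \<alpha>\<close> it is the ratio in the hypergeometric series.\<close>

lemma hyp_closed_coeff_recurrence:
  fixes \<beta> :: real
  assumes "0 < \<beta>" "\<beta> < 1"
  defines "F \<equiv> fps_expansion (hyp_closed \<beta>) 0"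
  shows "fps_nth F 0 = 1"
    and "4 * of_nat (Suc n) * (of_nat (Suc n) - of_real \<beta>) * fps_nth F (Suc n) =
         (2 * of_nat n + 1 - of_real \<beta>) * (2 * of_nat n + 2 - of_real \<beta>) * fps_nth F n"
proof -
  define G where "G = fps_expansion (hyp_aux \<beta>) 0"
  define b where "b = complex_of_real \<beta>"
  have 0: "0 \<in> cut_plane" by (auto simp: cut_plane_def)
  have F: "hyp_closed \<beta> has_fps_expansion F"
    unfolding F_def by (rule has_fps_expansion_fps_expansion[OF open_cut_plane 0 hyp_closed_holomorphic])
  have G: "hyp_aux \<beta> has_fps_expansion G"
    unfolding G_def by (rule has_fps_expansion_fps_expansion[OF open_cut_plane 0 hyp_aux_holomorphic])
  show "fps_nth F 0 = 1" 
    by (simp add: F_def fps_expansion_def hyp_closed_def)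
  have ev: "eventually (\<lambda>z. z \<in> cut_plane) (nhds 0)"
    by (rule eventually_nhds_in_open[OF open_cut_plane 0])
  have l1: "(\<lambda>z. 2 * z * deriv (hyp_aux \<beta>) z) has_fps_expansion (2 * fps_X * fps_deriv G)"
    by (intro fps_expansion_intros G)
  have r1: "(\<lambda>z. b * (hyp_aux \<beta> z - hyp_closed \<beta> z)) has_fps_expansion (fps_const b * (G - F))"
    by (intro fps_expansion_intros G F)
  have e1: "2 * fps_X * fps_deriv G = fps_const b * (G - F)"
  proof -
    have "eventually (\<lambda>z. 2 * z * deriv (hyp_aux \<beta>) z = b * (hyp_aux \<beta> z - hyp_closed \<beta> z)) (nhds 0)"
      using ev by eventually_elim (simp add: hyp_aux_deriv b_def)
    from has_fps_expansion_cong[OF this refl] l1 r1 show ?thesis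
      using fps_expansion_unique_complex by blast
  qed
  have l2: "(\<lambda>z. 2 * z * (1 - z) * deriv (hyp_closed \<beta>) z) has_fps_expansion
      (2 * fps_X * (1 - fps_X) * fps_deriv F)"
    by (intro fps_expansion_intros F)
  have r2: "(\<lambda>z. z * hyp_closed \<beta> z - b * hyp_aux \<beta> z + b * (1 - z) * hyp_closed \<beta> z) has_fps_expansion
      (fps_X * F - fps_const b * G + fps_const b * (1 - fps_X) * F)"
    by (intro fps_expansion_intros F G)
  have e2: "2 * fps_X * (1 - fps_X) * fps_deriv F =
      fps_X * F - fps_const b * G + fps_const b * (1 - fps_X) * F"
  proof -
    have "eventually (\<lambda>z. 2 * z * (1 - z) * deriv (hyp_closed \<beta>) z =
        z * hyp_closed \<beta> z - b * hyp_aux \<beta> z + b * (1 - z) * hyp_closed \<beta> z) (nhds 0)"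
      using ev by eventually_elim (simp add: hyp_closed_deriv b_def)
    from has_fps_expansion_cong[OF this refl] l2 r2 show ?thesis
      using fps_expansion_unique_complex by blast
  qed
  have c1: "2 * of_nat k * fps_nth G k = b * (fps_nth G k - fps_nth F k)" for k
  proof -
    have "fps_nth (2 * fps_X * fps_deriv G) k = 2 * of_nat k * fps_nth G k"
      by (cases k) (simp_all add: mult.assoc numeral_fps_const)
    then show ?thesis by (simp add: e1)
  qed
  have c2: "2 * of_nat (Suc n) * fps_nth F (Suc n) - 2 * of_nat n * fps_nth F n =
     fps_nth F n - b * fps_nth G (Suc n) + b * (fps_nth F (Suc n) - fps_nth F n)"
  proof -
    have "2 * fps_X * (1 - fps_X) * fps_deriv F =
        fps_const 2 * (fps_X * fps_deriv F) - fps_const 2 * (fps_X * (fps_X * fps_deriv F))"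
      by (simp add: algebra_simps numeral_fps_const)
    then have A: "fps_nth (2 * fps_X * (1 - fps_X) * fps_deriv F) (Suc n) =
        2 * of_nat (Suc n) * fps_nth F (Suc n) - 2 * of_nat n * fps_nth F n"
      by (cases n) (simp_all add: distrib_right)
    have "fps_X * F - fps_const b * G + fps_const b * (1 - fps_X) * F =
        fps_X * F - fps_const b * G + fps_const b * F - fps_const b * (fps_X * F)"
      by (simp add: algebra_simps)
    then have "fps_nth (fps_X * F - fps_const b * G + fps_const b * (1 - fps_X) * F) (Suc n) =
        fps_nth F n - b * fps_nth G (Suc n) + b * fps_nth F (Suc n) - b * fps_nth F n"
      by simp
    with A show ?thesis unfolding e2 by (simp only: right_diff_distrib add_diff_eq)
  qed
  define N where "N = complex_of_nat (Suc n)"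
  define g where "g = fps_nth G (Suc n)"
  define f where "f = fps_nth F (Suc n)"
  define f0 where "f0 = fps_nth F n"
  have n: "of_nat n = N - 1" by (simp add: N_def)
  have a1: "2 * N * g = b * (g - f)" using c1[of "Suc n"] by (simp only: N_def g_def f_def)
  have a2: "2 * N * f - 2 * (N - 1) * f0 = f0 - b * g + b * (f - f0)"
    using c2 by (simp only: n N_def[symmetric] g_def f_def f0_def)
  have "4 * N * (N - b) * f = (2 * (N - 1) + 1 - b) * (2 * (N - 1) + 2 - b) * f0"
  proof -
    have g: "(2 * N - b) * g = - b * f" using a1 by (simp add: algebra_simps)
    have f: "(2 * N - b) * f + b * g = (2 * (N - 1) + 1 - b) * f0" using a2 by (simp add: algebra_simps)
    \<comment> \<open>Multiplying the second relation by 2N - b lets the first one eliminate g, and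
      (2N - b)^2 - b^2 = 4N(N - b).\<close>
    have "4 * N * (N - b) * f = (2 * N - b) * (2 * N - b) * f + b * (- b * f)"
      by (simp add: algebra_simps)
    also have "\<dots> = (2 * N - b) * ((2 * N - b) * f + b * g)"
      unfolding g[symmetric] by (simp add: algebra_simps)
    finally show ?thesis unfolding f by (simp add: algebra_simps)
  qed
  then show "4 * of_nat (Suc n) * (of_nat (Suc n) - of_real \<beta>) * fps_nth F (Suc n) =
         (2 * of_nat n + 1 - of_real \<beta>) * (2 * of_nat n + 2 - of_real \<beta>) * fps_nth F n"
    unfolding n N_def[symmetric] b_def[symmetric] f_def f0_def .
qed

lemma hyp_closed_sums:
  assumes "0 < 2 * \<alpha>" "2 * \<alpha> < 1" "norm z < 1"
  shows "(\<lambda>n. pochhammer (of_real (\<alpha> + 1/2)) n * pochhammer (of_real \<alpha>) n /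
     (pochhammer (of_real (2 * \<alpha>)) n * fact n) * z ^ n) sums hyp_closed (1 - 2 * \<alpha>) z"
proof -
  define F where "F = fps_expansion (hyp_closed (1 - 2 * \<alpha>)) 0"
  have 0: "0 \<in> cut_plane" by (auto simp: cut_plane_def)
  have F: "hyp_closed (1 - 2 * \<alpha>) has_fps_expansion F"
    unfolding F_def by (rule has_fps_expansion_fps_expansion[OF open_cut_plane 0 hyp_closed_holomorphic])
  have nz: "pochhammer (complex_of_real (2 * \<alpha>)) n \<noteq> 0" for n
    using assms by (simp add: pochhammer_of_real pochhammer_eq_0_iff del: of_real_mult)
  have "fps_nth F n = pochhammer (of_real (\<alpha> + 1/2)) n * pochhammer (of_real \<alpha>) n /
     (pochhammer (of_real (2 * \<alpha>)) n * fact n)" for n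
  proof (induction n)
    case 0
    then show ?case using hyp_closed_coeff_recurrence(1)[of "1 - 2 * \<alpha>"] assms by (simp add: F_def)
  next
    case (Suc n)
    define a where "a = complex_of_real \<alpha>"
    have a: "of_real (\<alpha> + 1/2) = a + 1/2" "of_real (2 * \<alpha>) = 2 * a" "of_real \<alpha> = a"
      "of_real (1 - 2 * \<alpha>) = 1 - 2 * a"
      by (simp_all add: a_def)
    have r: "4 * of_nat (Suc n) * (of_nat (Suc n) - (1 - 2 * a)) * fps_nth F (Suc n) =
         (2 * of_nat n + 1 - (1 - 2 * a)) * (2 * of_nat n + 2 - (1 - 2 * a)) * fps_nth F n"
      using hyp_closed_coeff_recurrence(2)[of "1 - 2 * \<alpha>" n] assms
      unfolding a F_def by simp
    have n1: "complex_of_nat (Suc n) \<noteq> 0" by (metis of_nat_neq_0)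
    have "of_nat n + 2 * a = complex_of_real (real n + 2 * \<alpha>)" by (simp add: a_def)
    also have "\<dots> \<noteq> 0" using assms by (subst of_real_eq_0_iff) simp
    finally have n2: "of_nat n + 2 * a \<noteq> 0" .
    have "4 * (complex_of_nat (Suc n) * (of_nat n + 2 * a) * fps_nth F (Suc n)) =
         4 * ((a + 1/2 + of_nat n) * (a + of_nat n) * fps_nth F n)"
      using r by (simp add: algebra_simps)
    then have "complex_of_nat (Suc n) * (of_nat n + 2 * a) * fps_nth F (Suc n) =
         (a + 1/2 + of_nat n) * (a + of_nat n) * fps_nth F n"
      by (rule mult_left_cancel[THEN iffD1, rotated]) simp
    then have "fps_nth F (Suc n) = (a + 1/2 + of_nat n) * (a + of_nat n) * fps_nth F n /
        (of_nat (Suc n) * (of_nat n + 2 * a))"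
      using n1 n2 by (simp only: eq_divide_eq mult.commute mult_eq_0_iff) simp
    also have "\<dots> = pochhammer (of_real (\<alpha> + 1/2)) (Suc n) * pochhammer (of_real \<alpha>) (Suc n) /
     (pochhammer (of_real (2 * \<alpha>)) (Suc n) * fact (Suc n))"
      unfolding Suc.IH a pochhammer_rec' fact_Suc
      using n1 n2 nz[of n] by (simp add: divide_simps a add_ac del: of_nat_Suc)
    finally show ?case .
  qed
  \<comment> \<open>The Taylor series converges on the whole unit disc because
    \<open>hyp_closed\<close> is holomorphic there.\<close>
  moreover have "(\<lambda>n. fps_nth F n * z ^ n) sums hyp_closed (1 - 2 * \<alpha>) z"
    by (rule has_fps_expansion_imp_sums_complex[OF F, of 1])
       (use assms(3) in \<open>auto intro!: holomorphic_on_subset[OF hyp_closed_holomorphic] unit_ball_subset_cut_plane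
         simp: one_ereal_def\<close>)
  ultimately show ?thesis by simp
qed

text \<open>\<open>hyp_closed\<close> satisfies the description from which \<open>hyp2F1\<close> is
  chosen, so the chosen function satisfies it as well. On the unit disc both are the sum of the same
  series, and the identity theorem carries the equality to the connected slit plane.\<close>

lemma hyp2F1_eq:
  assumes "0 < 2 * \<alpha>" "2 * \<alpha> < 1" "z \<in> cut_plane"
  shows "hyp2F1 (of_real (\<alpha> + 1/2)) (of_real \<alpha>) (of_real (2 * \<alpha>)) z = hyp_closed (1 - 2 * \<alpha>) z"
proof -
  let ?Q = "\<lambda>f. f holomorphic_on (- {of_real x |x::real. x \<ge> 1}) \<and>
       (\<forall>z. norm z < 1 \<longrightarrow>
          (\<lambda>n. pochhammer (complex_of_real (\<alpha> + 1/2)) n * pochhammer (of_real \<alpha>) n /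
             (pochhammer (of_real (2 * \<alpha>)) n * fact n) * z ^ n) sums f z)"
  define f where "f = hyp2F1 (of_real (\<alpha> + 1/2)) (of_real \<alpha>) (of_real (2 * \<alpha>))"
  have "?Q (hyp_closed (1 - 2 * \<alpha>))"
    using hyp_closed_sums[OF assms(1,2)] hyp_closed_holomorphic unfolding cut_plane_def by blast
  then have Q: "?Q f" unfolding f_def hyp2F1_def by (rule someI[where P = ?Q])
  have "f z = hyp_closed (1 - 2 * \<alpha>) z"
  proof (rule analytic_continuation_open[where s = "ball 0 1" and s' = cut_plane and f = f and z = z])
    show "f x = hyp_closed (1 - 2 * \<alpha>) x" if "x \<in> ball 0 1" for x
      using Q hyp_closed_sums[OF assms(1,2), of x] that sums_unique2 by auto
    show "f holomorphic_on cut_plane" using Q by (simp add: cut_plane_def)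
  qed (use assms hyp_closed_holomorphic open_cut_plane connected_cut_plane
      unit_ball_subset_cut_plane in auto)
  then show ?thesis by (simp add: f_def)
qed

lemma hyp2F1_real:
  assumes "0 < 2 * \<alpha>" "2 * \<alpha> < 1" "x > 0"
  shows "Re (hyp2F1 (of_real (\<alpha> + 1/2)) (of_real \<alpha>) (of_real (2 * \<alpha>)) (of_real (1 - x))) =
    ((1 + sqrt x) / 2) powr (1 - 2 * \<alpha>) / sqrt x"
proof -
  have "complex_of_real (1 - x) \<in> cut_plane"
    using assms by (auto simp: cut_plane_def simp del: of_real_diff)
  moreover have "csqrt (1 - complex_of_real (1 - x)) = of_real (sqrt x)"
    using assms by simp
  ultimately have "hyp2F1 (of_real (\<alpha> + 1/2)) (of_real \<alpha>) (of_real (2 * \<alpha>)) (of_real (1 - x)) =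
    ((1 + of_real (sqrt x)) / 2) powr of_real (1 - 2 * \<alpha>) / of_real (sqrt x)"
    using hyp2F1_eq[OF assms(1,2)] by (simp add: hyp_closed_def)
  also have "(1 + complex_of_real (sqrt x)) / 2 = of_real ((1 + sqrt x) / 2)" by simp
  also have "\<dots> powr of_real (1 - 2 * \<alpha>) / of_real (sqrt x) =
      of_real (((1 + sqrt x) / 2) powr (1 - 2 * \<alpha>) / sqrt x)"
    using assms by (subst powr_of_real) auto
  finally show ?thesis by (simp only: Re_complex_of_real)
qed

text \<open>The hypergeometric argument is 1 - x with x = (r1/r)^2, so the root is the ratio r1/r.
  The \<alpha>-dependent powers of r then cancel except inside r + r1, and the singularity on the
  diagonal is exactly 1/r.\<close>

lemma q1_closed_form:
  assumes "0 < 2 * \<alpha>" "2 * \<alpha> < 1" "dist_r p q > 0" "dist_r1 p q > 0"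
  shows "q1 \<alpha> p q = 2 powr (2 * \<alpha> - 2) / pi *
     (dist_r p q + dist_r1 p q) powr (1 - 2 * \<alpha>) / (dist_r p q * dist_r1 p q)"
proof -
  define r where "r = dist_r p q"
  define s where "s = dist_r1 p q"
  have rs: "r > 0" "s > 0" using assms by (auto simp: r_def s_def)
  have "q1 \<alpha> p q = 1 / (2 * pi) * r powr (- 2 * \<alpha> - 1) *
     (((1 + s / r) / 2) powr (1 - 2 * \<alpha>) / (s / r))"
    unfolding q1_def r_def[symmetric] s_def[symmetric]
    using rs hyp2F1_real[OF assms(1,2), of "s\<^sup>2 / r\<^sup>2"] by (simp add: real_sqrt_divide)
  also have "(1 + s / r) / 2 = (r + s) * (1 / (2 * r))" using rs by (simp add: field_simps)
  also have "\<dots> powr (1 - 2 * \<alpha>) = (r + s) powr (1 - 2 * \<alpha>) * (2 * r) powr (2 * \<alpha> - 1)"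
    using rs by (subst powr_mult) (auto simp: powr_divide powr_minus_divide[symmetric])
  also have "(2 * r) powr (2 * \<alpha> - 1) = 2 powr (2 * \<alpha> - 1) * r powr (2 * \<alpha> - 1)"
    using rs by (simp add: powr_mult)
  also have "1 / (2 * pi) * r powr (- 2 * \<alpha> - 1) *
      ((r + s) powr (1 - 2 * \<alpha>) * (2 powr (2 * \<alpha> - 1) * r powr (2 * \<alpha> - 1)) / (s / r)) =
      (2 powr (2 * \<alpha> - 1) / 2) / pi * (r + s) powr (1 - 2 * \<alpha>) / s *
      ((r powr (- 2 * \<alpha> - 1) * r powr (2 * \<alpha> - 1)) * r)"
    by simp
  also have "r powr (- 2 * \<alpha> - 1) * r powr (2 * \<alpha> - 1) = r powr (- 2)"
    by (simp add: powr_add[symmetric])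
  also have "r powr (-2) * r = 1 / r"
  proof -
    have "r powr (-2) * r = r powr (-2) * r powr 1" using rs by simp
    also have "\<dots> = r powr (-1)" by (simp only: powr_add[symmetric]) simp
    also have "\<dots> = 1 / r" using rs by (simp add: powr_minus_divide)
    finally show ?thesis .
  qed
  also have "2 powr (2 * \<alpha> - 1) / 2 = 2 powr (2 * \<alpha> - 2)"
    by (simp add: powr_diff)
  finally show ?thesis unfolding r_def[symmetric] s_def[symmetric] by simp
qed

section \<open>Integrals over the tangent plane\<close>

lemma nn_integral_even:
  fixes f :: "real \<Rightarrow> ennreal"
  assumes [measurable]: "f \<in> borel_measurable borel" and even: "\<And>x. f (- x) = f x" and "a \<ge> 0"
  shows "(\<integral>\<^sup>+x. f x * indicator {x. a \<le> \<bar>x\<bar>} x \<partial>lborel) = 2 * (\<integral>\<^sup>+x. f x * indicator {a..} x \<partial>lborel)"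
proof -
  have "(\<integral>\<^sup>+x. f x * indicator {x. a \<le> \<bar>x\<bar>} x \<partial>lborel) =
      (\<integral>\<^sup>+x. f x * indicator {a..} x + f x * indicator {..-a} x \<partial>lborel)"
    \<comment> \<open>For a = 0 the two half-lines overlap in the origin, a null set.\<close>
    using AE_lborel_singleton[of "0::real"] \<open>a \<ge> 0\<close>
    by (intro nn_integral_cong_AE) (auto elim!: eventually_mono simp: indicator_def)
  also have "\<dots> = (\<integral>\<^sup>+x. f x * indicator {a..} x \<partial>lborel) + (\<integral>\<^sup>+x. f x * indicator {..-a} x \<partial>lborel)"
    by (rule nn_integral_add) auto
  also have "(\<integral>\<^sup>+x. f x * indicator {..-a} x \<partial>lborel) = (\<integral>\<^sup>+x. f x * indicator {a..} x \<partial>lborel)"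
    by (subst nn_integral_real_affine[where c = "-1" and t = 0])
       (auto simp: even indicator_def intro!: nn_integral_cong)
  finally show ?thesis by (simp add: mult_2)
qed

lemma nn_integral_even_UNIV:
  fixes f :: "real \<Rightarrow> ennreal"
  assumes "f \<in> borel_measurable borel" "\<And>x. f (- x) = f x"
  shows "(\<integral>\<^sup>+x. f x \<partial>lborel) = 2 * (\<integral>\<^sup>+x. f x * indicator {0..} x \<partial>lborel)"
  using nn_integral_even[OF assms, of 0] by simp

lemma nn_integral_inverse_cube:
  assumes k: "k > 0"
  shows "(\<integral>\<^sup>+x. ennreal (1 / (sqrt (x\<^sup>2 + k)) ^ 3) \<partial>lborel) = ennreal (2 / k)"
proof -
  have pos: "x\<^sup>2 + k > 0" for x :: real using k by (simp add: add_nonneg_pos)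
  have "(\<integral>\<^sup>+x. ennreal (1 / (sqrt (x\<^sup>2 + k)) ^ 3) * indicator {0..} x \<partial>lborel) =
      ennreal (1 / k - 0 / (k * sqrt (0\<^sup>2 + k)))"
  proof (rule nn_integral_FTC_atLeast[where F = "\<lambda>x. x / (k * sqrt (x\<^sup>2 + k))"])
    fix x :: real
    define q where "q = sqrt (x\<^sup>2 + k)"
    have q: "q > 0" "q * q = x\<^sup>2 + k" using pos[of x] by (auto simp: q_def)
    have "((\<lambda>x. x / (k * sqrt (x\<^sup>2 + k))) has_real_derivative
        (1 * (k * q) - x * (k * (2 * x * inverse q / 2))) / (k * q * (k * q))) (at x)"
      unfolding q_def using pos[of x] k
      by (auto intro!: derivative_eq_intros simp: field_simps)
    also have "(1 * (k * q) - x * (k * (2 * x * inverse q / 2))) / (k * q * (k * q)) =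
        (k * (q * q) - k * x\<^sup>2) / (k * k * q ^ 3)"
      using q(1) k by (simp add: divide_simps power3_eq_cube power2_eq_square)
    also have "\<dots> = 1 / q ^ 3" unfolding q(2) using k q(1) by (simp add: field_simps)
    finally show "((\<lambda>x. x / (k * sqrt (x\<^sup>2 + k))) has_real_derivative 1 / (sqrt (x\<^sup>2 + k)) ^ 3) (at x)"
      by (simp add: q_def)
  next
    have "((\<lambda>x::real. k / x\<^sup>2) \<longlongrightarrow> 0) at_top"
      by (rule tendsto_divide_0[OF tendsto_const filterlim_at_top_imp_at_infinity])
         (auto intro!: filterlim_pow_at_top filterlim_ident)
    then have "((\<lambda>x. 1 / (k * sqrt (1 + k / x\<^sup>2))) \<longlongrightarrow> 1 / (k * sqrt (1 + 0))) at_top"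
      using k by (intro tendsto_intros) auto
    moreover have "\<forall>\<^sub>F x in at_top. 1 / (k * sqrt (1 + k / x\<^sup>2)) = x / (k * sqrt (x\<^sup>2 + k))"
      using eventually_gt_at_top[of "0::real"]
    proof eventually_elim
      case (elim x)
      have "x\<^sup>2 + k = x\<^sup>2 * (1 + k / x\<^sup>2)" using elim by (simp add: field_simps)
      then have "sqrt (x\<^sup>2 + k) = x * sqrt (1 + k / x\<^sup>2)" using elim by (simp add: real_sqrt_mult)
      then show ?case using elim by simp
    qed
    ultimately show "((\<lambda>x. x / (k * sqrt (x\<^sup>2 + k))) \<longlongrightarrow> 1 / k) at_top"
      by (simp add: filterlim_cong)
  qed (use pos less_imp_le in auto)
  then show ?thesis
    by (subst nn_integral_even_UNIV) (auto simp: ennreal_mult[symmetric] k less_imp_le simp flip: ennreal_numeral)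
qed

lemma nn_integral_Cauchy_density:
  assumes h: "h > 0"
  shows "(\<integral>\<^sup>+x. ennreal (2 * h / (x\<^sup>2 + h\<^sup>2)) \<partial>lborel) = ennreal (2 * pi)"
proof -
  have pos: "x\<^sup>2 + h\<^sup>2 > 0" for x :: real using h by (simp add: add_nonneg_pos)
  have "(\<integral>\<^sup>+x. ennreal (2 * h / (x\<^sup>2 + h\<^sup>2)) * indicator {0..} x \<partial>lborel) =
      ennreal (2 * (pi / 2) - 2 * arctan (0 / h))"
  proof (rule nn_integral_FTC_atLeast[where F = "\<lambda>x. 2 * arctan (x / h)"])
    fix x :: real
    have "((\<lambda>x. 2 * arctan (x / h)) has_real_derivative 2 * (1 / h * inverse (1 + (x / h)\<^sup>2))) (at x)"
      by (auto intro!: derivative_eq_intros simp: divide_inverse)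
    also have "2 * (1 / h * inverse (1 + (x / h)\<^sup>2)) = 2 * h / (x\<^sup>2 + h\<^sup>2)"
      using h pos[of x] by (simp add: field_simps power2_eq_square)
    finally show "((\<lambda>x. 2 * arctan (x / h)) has_real_derivative 2 * h / (x\<^sup>2 + h\<^sup>2)) (at x)" .
  next
    have "filterlim (\<lambda>x. x / h) at_top at_top"
      using h by (intro filterlim_at_top_mult_tendsto_pos[where c = "1/h" and f = "\<lambda>_. 1 / h", simplified]) 
         (auto intro!: filterlim_ident)
    then show "((\<lambda>x. 2 * arctan (x / h)) \<longlongrightarrow> 2 * (pi / 2)) at_top"
      by (intro tendsto_intros filterlim_compose[OF tendsto_arctan_at_top])
  qed (use pos h in \<open>auto simp: less_imp_le\<close>)
  then show ?thesis
    by (subst nn_integral_even_UNIV) (auto simp: ennreal_mult[symmetric] simp flip: ennreal_numeral)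
qed

text \<open>Dropping h^2 in the denominator leaves 2h/x^2, and each of the two symmetric tails
  contributes at most 2h/c.\<close>

lemma nn_integral_Cauchy_tail:
  assumes h: "h > 0" and c: "c > 0"
  shows "(\<integral>\<^sup>+x. ennreal (2 * h / (x\<^sup>2 + h\<^sup>2)) * indicator {x. c \<le> \<bar>x\<bar>} x \<partial>lborel) \<le> ennreal (4 * h / c)"
proof -
  have pos: "x\<^sup>2 + h\<^sup>2 > 0" for x :: real using h by (simp add: add_nonneg_pos)
  have "(\<integral>\<^sup>+x. ennreal (2 * h / (x\<^sup>2 + h\<^sup>2)) * indicator {c..} x \<partial>lborel) \<le>
     (\<integral>\<^sup>+x. ennreal (2 * h / x\<^sup>2) * indicator {c..} x \<partial>lborel)"
  proof (rule nn_integral_mono)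
    fix x :: real
    have "2 * h / (x\<^sup>2 + h\<^sup>2) \<le> 2 * h / x\<^sup>2" if "c \<le> x"
      using h c that by (intro divide_left_mono mult_pos_pos pos) auto
    then show "ennreal (2 * h / (x\<^sup>2 + h\<^sup>2)) * indicator {c..} x \<le>
        ennreal (2 * h / x\<^sup>2) * indicator {c..} x"
      by (auto simp: indicator_def intro!: ennreal_leI)
  qed
  also have "\<dots> = ennreal (0 - (- 2 * h / c))"
  proof (rule nn_integral_FTC_atLeast[where F = "\<lambda>x. - 2 * h / x"])
    fix x assume "c \<le> x"
    then show "((\<lambda>x. - 2 * h / x) has_real_derivative 2 * h / x\<^sup>2) (at x)"
      using c by (auto intro!: derivative_eq_intros simp: power2_eq_square)
  next
    show "((\<lambda>x. - 2 * h / x) \<longlongrightarrow> 0) at_top"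
      by (rule tendsto_divide_0[OF tendsto_const filterlim_at_top_imp_at_infinity]) (rule filterlim_ident)
  qed (use h in auto)
  finally have "2 * (\<integral>\<^sup>+x. ennreal (2 * h / (x\<^sup>2 + h\<^sup>2)) * indicator {c..} x \<partial>lborel) \<le>
      2 * ennreal (2 * h / c)"
    by (intro mult_left_mono) auto
  also have "\<dots> = ennreal (4 * h / c)"
    using h c by (subst ennreal_numeral[symmetric], subst ennreal_mult[symmetric]) auto
  finally show ?thesis
    using nn_integral_even[of "\<lambda>x. ennreal (2 * h / (x\<^sup>2 + h\<^sup>2))" c] c by simp
qed

section \<open>The Poisson kernel of the half-space\<close>

lemma borel_measurable_fst_real [measurable]: "fst \<in> borel_measurable (borel :: (real \<times> real) measure)"
  by (intro borel_measurable_continuous_onI continuous_intros)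

lemma borel_measurable_snd_real [measurable]: "snd \<in> borel_measurable (borel :: (real \<times> real) measure)"
  by (intro borel_measurable_continuous_onI continuous_intros)

text \<open>The Poisson kernel of the half-space up to the factor 1/(2 pi). It is odd in h and
  vanishes for h = 0, so a signed height distinguishes the two sides and the surface itself.\<close>

definition poisson_kernel :: "real \<Rightarrow> real \<times> real \<Rightarrow> real" where
  "poisson_kernel h v = h / (sqrt ((fst v)\<^sup>2 + (snd v)\<^sup>2 + h\<^sup>2)) ^ 3"

lemma poisson_kernel_measurable [measurable]: "poisson_kernel h \<in> borel_measurable borel"
  unfolding poisson_kernel_def by measurable

lemma poisson_kernel_nonneg: "h \<ge> 0 \<Longrightarrow> poisson_kernel h v \<ge> 0"
  by (simp add: poisson_kernel_def)

lemma nn_integral_poisson_inner: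
  assumes "h > 0"
  shows "(\<integral>\<^sup>+y. ennreal (poisson_kernel h (x, y)) \<partial>lborel) = ennreal (2 * h / (x\<^sup>2 + h\<^sup>2))"
    and "(\<integral>\<^sup>+y. ennreal (poisson_kernel h (y, x)) \<partial>lborel) = ennreal (2 * h / (x\<^sup>2 + h\<^sup>2))"
proof -
  have pos: "x\<^sup>2 + h\<^sup>2 > 0" using assms by (simp add: add_nonneg_pos)
  have "(\<integral>\<^sup>+y. ennreal (poisson_kernel h (x, y)) \<partial>lborel) =
      (\<integral>\<^sup>+y. ennreal h * ennreal (1 / (sqrt (y\<^sup>2 + (x\<^sup>2 + h\<^sup>2))) ^ 3) \<partial>lborel)"
    using assms pos by (intro nn_integral_cong) (simp add: poisson_kernel_def ennreal_mult[symmetric] add_ac)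
  also have "\<dots> = ennreal (2 * h / (x\<^sup>2 + h\<^sup>2))"
    using assms pos by (subst nn_integral_cmult) (auto simp: nn_integral_inverse_cube ennreal_mult[symmetric] less_imp_le)
  finally show "(\<integral>\<^sup>+y. ennreal (poisson_kernel h (x, y)) \<partial>lborel) = ennreal (2 * h / (x\<^sup>2 + h\<^sup>2))" .
  then show "(\<integral>\<^sup>+y. ennreal (poisson_kernel h (y, x)) \<partial>lborel) = ennreal (2 * h / (x\<^sup>2 + h\<^sup>2))"
    by (simp add: poisson_kernel_def add_ac)
qed

text \<open>By Tonelli, integrating out one coordinate leaves the Cauchy density 2h/(x^2 + h^2),
  whose integral does not depend on h. This independence is the source of the jump.\<close>

lemma nn_integral_poisson:
  assumes "h > 0"
  shows "(\<integral>\<^sup>+v. ennreal (poisson_kernel h v) \<partial>lborel) = ennreal (2 * pi)"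
proof -
  have "(\<integral>\<^sup>+v. ennreal (poisson_kernel h v) \<partial>(lborel \<Otimes>\<^sub>M lborel)) =
      (\<integral>\<^sup>+x. \<integral>\<^sup>+y. ennreal (poisson_kernel h (x, y)) \<partial>lborel \<partial>lborel)"
    by (rule lborel.nn_integral_fst[symmetric]) (simp add: lborel_prod)
  then show ?thesis
    using assms by (simp add: lborel_prod nn_integral_poisson_inner nn_integral_Cauchy_density)
qed

text \<open>The region is the union of two, one for each coordinate; on each of them the other
  coordinate can be integrated out completely, which leaves a one-dimensional Cauchy tail.\<close>

lemma nn_integral_poisson_tail:
  assumes h: "h > 0" and c: "c > 0"
  shows "(\<integral>\<^sup>+v. ennreal (poisson_kernel h v) * indicator {v. c \<le> \<bar>fst v\<bar> \<or> c \<le> \<bar>snd v\<bar>} v \<partial>lborel)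
    \<le> ennreal (8 * h / c)"
proof -
  let ?k = "\<lambda>v. ennreal (poisson_kernel h v)"
  have "(\<integral>\<^sup>+v. ?k v * indicator {v. c \<le> \<bar>fst v\<bar> \<or> c \<le> \<bar>snd v\<bar>} v \<partial>lborel) \<le>
    (\<integral>\<^sup>+v. ?k v * indicator {x. c \<le> \<bar>x\<bar>} (fst v) + ?k v * indicator {x. c \<le> \<bar>x\<bar>} (snd v) \<partial>lborel)"
    by (intro nn_integral_mono) (auto simp: indicator_def)
  also have "\<dots> = (\<integral>\<^sup>+v. ?k v * indicator {x. c \<le> \<bar>x\<bar>} (fst v) \<partial>lborel) +
     (\<integral>\<^sup>+v. ?k v * indicator {x. c \<le> \<bar>x\<bar>} (snd v) \<partial>lborel)"
    by (rule nn_integral_add) auto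
  also have "(\<integral>\<^sup>+v. ?k v * indicator {x. c \<le> \<bar>x\<bar>} (fst v) \<partial>lborel) =
     (\<integral>\<^sup>+x. \<integral>\<^sup>+y. ?k (x, y) * indicator {x. c \<le> \<bar>x\<bar>} x \<partial>lborel \<partial>lborel)"
    unfolding lborel_prod[symmetric] by (subst lborel.nn_integral_fst[symmetric]) (auto simp: lborel_prod)
  also have "\<dots> \<le> ennreal (4 * h / c)"
    using nn_integral_Cauchy_tail[OF h c] 
    by (simp add: nn_integral_multc nn_integral_poisson_inner[OF h])
  also have "(\<integral>\<^sup>+v. ?k v * indicator {x. c \<le> \<bar>x\<bar>} (snd v) \<partial>lborel) =
     (\<integral>\<^sup>+y. \<integral>\<^sup>+x. ?k (x, y) * indicator {x. c \<le> \<bar>x\<bar>} y \<partial>lborel \<partial>lborel)"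
    unfolding lborel_prod[symmetric] by (subst lborel_pair.nn_integral_snd[symmetric]) (auto simp: lborel_prod)
  also have "\<dots> \<le> ennreal (4 * h / c)"
    using nn_integral_Cauchy_tail[OF h c] 
    by (simp add: nn_integral_multc nn_integral_poisson_inner[OF h])
  also have "ennreal (4 * h / c) + ennreal (4 * h / c) = ennreal (8 * h / c)"
    using h c by (subst ennreal_plus[symmetric]) auto
  finally show ?thesis by (simp add: add_right_mono)
qed

text \<open>A square instead of a disc, so that tails and majorants split into coordinates.\<close>

definition square :: "real \<Rightarrow> (real \<times> real) set" where
  "square \<delta> = {-\<delta><..<\<delta>} \<times> {-\<delta><..<\<delta>}"

lemma square_borel [measurable]: "square \<delta> \<in> sets borel"
  unfolding square_def by (intro borel_open open_Times) auto

lemma nn_integral_lborel_shift: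
  fixes f :: "'a::euclidean_space \<Rightarrow> ennreal"
  assumes [measurable]: "f \<in> borel_measurable borel"
  shows "(\<integral>\<^sup>+v. f (v - b) \<partial>lborel) = (\<integral>\<^sup>+v. f v \<partial>lborel)"
proof -
  have "(\<integral>\<^sup>+v. f (v - b) \<partial>lborel) = (\<integral>\<^sup>+v. f (v - b) \<partial>distr lborel borel ((+) b))"
    by (simp add: lborel_distr_plus)
  also have "\<dots> = (\<integral>\<^sup>+v. f v \<partial>lborel)"
    by (subst nn_integral_distr) auto
  finally show ?thesis .
qed

lemma nn_integral_poisson_square_le:
  assumes "h > 0"
  shows "(\<integral>\<^sup>+v. ennreal (poisson_kernel h (v - b)) * indicator (square \<delta>) v \<partial>lborel) \<le> ennreal (2 * pi)"
proof -
  have "(\<integral>\<^sup>+v. ennreal (poisson_kernel h (v - b)) * indicator (square \<delta>) v \<partial>lborel) \<le>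
     (\<integral>\<^sup>+v. ennreal (poisson_kernel h (v - b)) \<partial>lborel)"
    by (intro nn_integral_mono) (auto simp: indicator_def)
  then show ?thesis
    using nn_integral_lborel_shift[of "\<lambda>v. ennreal (poisson_kernel h v)" b]
      nn_integral_poisson[OF assms] by simp
qed

text \<open>If b lies in the half-size square, every point outside \<open>square \<delta>\<close>
  differs from b by at least \<delta>/2 in some coordinate. The mass lost is therefore part of a
  tail with c = \<delta>/2, which is at most 16h/\<delta>.\<close>

lemma nn_integral_poisson_square_ge:
  assumes h: "h > 0" and \<delta>: "\<delta> > 0" and b: "b \<in> square (\<delta> / 2)"
  shows "ennreal (2 * pi) \<le>
    (\<integral>\<^sup>+v. ennreal (poisson_kernel h (v - b)) * indicator (square \<delta>) v \<partial>lborel) + ennreal (16 * h / \<delta>)"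
proof -
  let ?k = "\<lambda>v. ennreal (poisson_kernel h v)"
  let ?T = "{v::real\<times>real. \<delta>/2 \<le> \<bar>fst v\<bar> \<or> \<delta>/2 \<le> \<bar>snd v\<bar>}"
  have [measurable]: "?T \<in> sets borel" by measurable
  have "ennreal (2 * pi) = (\<integral>\<^sup>+v. ?k (v - b) \<partial>lborel)"
    using nn_integral_lborel_shift[of ?k b] nn_integral_poisson[OF h] by simp
  also have "\<dots> \<le> (\<integral>\<^sup>+v. ?k (v - b) * indicator (square \<delta>) v + ?k (v - b) * indicator ?T (v - b) \<partial>lborel)"
    using b by (intro nn_integral_mono) (auto simp: indicator_def square_def mem_Times_iff)
  also have "\<dots> = (\<integral>\<^sup>+v. ?k (v - b) * indicator (square \<delta>) v \<partial>lborel) + (\<integral>\<^sup>+v. ?k (v - b) * indicator ?T (v - b) \<partial>lborel)"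
    by (rule nn_integral_add) auto
  also have "(\<integral>\<^sup>+v. ?k (v - b) * indicator ?T (v - b) \<partial>lborel) = (\<integral>\<^sup>+v. ?k v * indicator ?T v \<partial>lborel)"
    by (rule nn_integral_lborel_shift[of "\<lambda>v. ?k v * indicator ?T v"]) measurable
  also have "\<dots> \<le> ennreal (16 * h / \<delta>)"
    using nn_integral_poisson_tail[OF h, of "\<delta>/2"] \<delta> by simp
  finally show ?thesis by (simp add: add_left_mono)
qed

section \<open>Weak singularities in the plane\<close>

lemma nn_integral_abs_powr:
  assumes "\<kappa> > 0" "c > 0"
  shows "(\<integral>\<^sup>+x. ennreal (\<bar>x\<bar> powr (\<kappa> - 1)) * indicator {-c<..<c} x \<partial>lborel) \<le> ennreal (2 * c powr \<kappa> / \<kappa>)"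
proof -
  let ?f = "\<lambda>x. \<bar>x\<bar> powr (\<kappa> - 1) * indicator {-c..c} x"
  have "((\<lambda>x. x powr (\<kappa> - 1)) has_integral (c powr (\<kappa> - 1 + 1) / (\<kappa> - 1 + 1))) {0..c}"
    using assms by (intro has_integral_powr_from_0) auto
  then have "((\<lambda>x. if x \<in> {0..c} then x powr (\<kappa> - 1) else 0) has_integral (c powr \<kappa> / \<kappa>)) UNIV"
    by (subst has_integral_restrict_UNIV) simp
  then have "(\<integral>\<^sup>+x. ennreal (if x \<in> {0..c} then x powr (\<kappa> - 1) else 0) \<partial>lborel) = ennreal (c powr \<kappa> / \<kappa>)"
    by (intro nn_integral_has_integral_lborel) auto
  also have "(\<integral>\<^sup>+x. ennreal (if x \<in> {0..c} then x powr (\<kappa> - 1) else 0) \<partial>lborel) =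
     (\<integral>\<^sup>+x. ennreal (?f x) * indicator {0..} x \<partial>lborel)"
    by (intro nn_integral_cong) (auto simp: indicator_def)
  finally have "(\<integral>\<^sup>+x. ennreal (?f x) * indicator {0..} x \<partial>lborel) = ennreal (c powr \<kappa> / \<kappa>)" .
  moreover have "(\<integral>\<^sup>+x. ennreal (?f x) \<partial>lborel) = 2 * (\<integral>\<^sup>+x. ennreal (?f x) * indicator {0..} x \<partial>lborel)"
    by (rule nn_integral_even_UNIV) (auto simp: indicator_def)
  moreover have "2 * ennreal (c powr \<kappa> / \<kappa>) = ennreal (2 * c powr \<kappa> / \<kappa>)"
    using assms by (subst ennreal_numeral[symmetric], subst ennreal_mult[symmetric]) auto
  ultimately have "(\<integral>\<^sup>+x. ennreal (?f x) \<partial>lborel) = ennreal (2 * c powr \<kappa> / \<kappa>)" by simp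
  moreover have "(\<integral>\<^sup>+x. ennreal (\<bar>x\<bar> powr (\<kappa> - 1)) * indicator {-c<..<c} x \<partial>lborel) \<le> (\<integral>\<^sup>+x. ennreal (?f x) \<partial>lborel)"
    by (intro nn_integral_mono) (auto simp: indicator_def)
  ultimately show ?thesis by simp
qed

text \<open>The exponent is split evenly as 2(l/2 - 1). Each half is a nonpositive power of the
  norm, which dominates either coordinate. The result is a product of one-dimensional singularities,
  integrable for l > 0.\<close>

lemma norm_powr_le_product:
  assumes "x \<noteq> 0" "y \<noteq> 0" "l \<le> 2"
  shows "norm (x, y) powr (l - 2) \<le> \<bar>x\<bar> powr (l/2 - 1) * \<bar>y\<bar> powr (l/2 - 1)"
proof -
  have n: "norm (x, y) > 0" using assms by (simp add: zero_prod_def)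
  have "norm (x, y) powr (l - 2) = norm (x, y) powr (l/2 - 1) * norm (x, y) powr (l/2 - 1)"
    by (simp add: powr_add[symmetric])
  also have "\<dots> \<le> \<bar>x\<bar> powr (l/2 - 1) * \<bar>y\<bar> powr (l/2 - 1)"
    using assms norm_fst_le[of "(x,y)"] norm_snd_le[of "(x,y)"] norm_fst_le[of x y] norm_snd_le[of y x]
    by (intro mult_mono powr_mono2') auto
  finally show ?thesis .
qed

text \<open>Translation by b moves the square into the doubled one, and each coordinate contributes
  at most 4/l times the power l/2 of the doubled half side \<open>2 * \<delta>\<close>.\<close>

lemma nn_integral_weakly_singular:
  assumes l: "0 < l" "l \<le> 2" and \<delta>: "\<delta> > 0" and b: "b \<in> square \<delta>"
  shows "(\<integral>\<^sup>+v. ennreal (norm (v - b) powr (l - 2)) * indicator (square \<delta>) v \<partial>lborel)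
    \<le> ennreal (16 / l\<^sup>2 * (2 * \<delta>) powr l)"
proof -
  define c where "c = 2 * \<delta>"
  have c: "c > 0" using \<delta> by (simp add: c_def)
  let ?g = "\<lambda>x. ennreal (\<bar>x\<bar> powr (l/2 - 1)) * indicator {-c<..<c} x"
  let ?f = "\<lambda>v::real\<times>real. ennreal (norm v powr (l - 2)) * indicator (square c) v"
  have "(\<integral>\<^sup>+v. ennreal (norm (v - b) powr (l - 2)) * indicator (square \<delta>) v \<partial>lborel) \<le>
     (\<integral>\<^sup>+v. ?f (v - b) \<partial>lborel)"
    using b by (intro nn_integral_mono) (auto simp: indicator_def square_def c_def)
  also have "\<dots> = (\<integral>\<^sup>+v. ?f v \<partial>lborel)"
    by (rule nn_integral_lborel_shift) measurable
  also have "\<dots> = (\<integral>\<^sup>+x. \<integral>\<^sup>+y. ?f (x, y) \<partial>lborel \<partial>lborel)"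
    unfolding lborel_prod[symmetric] by (subst lborel.nn_integral_fst[symmetric]) (auto simp: lborel_prod)
  also have "\<dots> \<le> (\<integral>\<^sup>+x. \<integral>\<^sup>+y. ?g x * ?g y \<partial>lborel \<partial>lborel)"
  \<comment> \<open>The product bound fails on the coordinate axes, where \<open>0 powr\<close> of
    anything is 0; they are null.\<close>
  proof (rule nn_integral_mono_AE, rule AE_mp[OF AE_lborel_singleton[of 0]], rule AE_I2, rule impI)
    fix x :: real assume x: "x \<noteq> 0"
    show "(\<integral>\<^sup>+y. ?f (x, y) \<partial>lborel) \<le> (\<integral>\<^sup>+y. ?g x * ?g y \<partial>lborel)"
    proof (rule nn_integral_mono_AE, rule AE_mp[OF AE_lborel_singleton[of 0]], rule AE_I2, rule impI)
      fix y :: real assume "y \<noteq> 0"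
      then show "?f (x, y) \<le> ?g x * ?g y"
        using norm_powr_le_product[OF x, of y l] l
        by (auto simp: indicator_def square_def ennreal_mult[symmetric])
    qed
  qed
  also have "\<dots> = (\<integral>\<^sup>+x. ?g x \<partial>lborel) * (\<integral>\<^sup>+x. ?g x \<partial>lborel)"
    by (simp add: nn_integral_cmult nn_integral_multc)
  also have "\<dots> \<le> ennreal (2 * c powr (l/2) / (l/2)) * ennreal (2 * c powr (l/2) / (l/2))"
    using nn_integral_abs_powr[of "l/2" c] l c by (intro mult_mono) auto
  also have "\<dots> = ennreal (16 / l\<^sup>2 * (2 * \<delta>) powr l)"
  proof -
    have "c powr (l/2) * c powr (l/2) = c powr l" by (simp add: powr_add[symmetric])
    then have "2 * c powr (l/2) / (l/2) * (2 * c powr (l/2) / (l/2)) = 16 / l\<^sup>2 * (2 * \<delta>) powr l"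
      using l by (simp add: field_simps power2_eq_square c_def)
    then show ?thesis using l by (subst ennreal_mult[symmetric]) auto
  qed
  finally show ?thesis .
qed

section \<open>Local graph representation of a Lyapunov surface\<close>

locale tangent_frame =
  fixes N e1 e2 n :: "real^3"
  assumes n_unit: "norm n = 1" and e1_unit: "norm e1 = 1" and e2_unit: "norm e2 = 1"
    and e1_n: "e1 \<bullet> n = 0" and e2_n: "e2 \<bullet> n = 0" and e1_e2: "e1 \<bullet> e2 = 0"
    and cross: "cross3 e1 e2 = n"
begin

lemma frame_dots [simp]:
  "e1 \<bullet> e1 = 1" "e2 \<bullet> e2 = 1" "n \<bullet> n = 1" "e1 \<bullet> e2 = 0" "e2 \<bullet> e1 = 0"
  "e1 \<bullet> n = 0" "n \<bullet> e1 = 0" "e2 \<bullet> n = 0" "n \<bullet> e2 = 0"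
  using n_unit e1_unit e2_unit e1_n e2_n e1_e2 by (simp_all add: norm_eq_1 inner_commute)

definition plane :: "real \<times> real \<Rightarrow> real^3" where
  "plane a = fst a *\<^sub>R e1 + snd a *\<^sub>R e2"

definition pt :: "real \<times> real \<Rightarrow> real \<Rightarrow> real^3" where
  "pt a t = N + plane a + t *\<^sub>R n"

definition proj :: "real^3 \<Rightarrow> real \<times> real" where
  "proj q = (e1 \<bullet> (q - N), e2 \<bullet> (q - N))"

definition height :: "real^3 \<Rightarrow> real" where
  "height q = n \<bullet> (q - N)"

text \<open>Completeness of the frame comes from \<open>cross\<close>: the residual y is orthogonal
  to all three vectors, and by Lagrange's identity its cross product with n vanishes as well, so it
  is both orthogonal and parallel to n.\<close>

lemma frame_expansion: "x = (e1 \<bullet> x) *\<^sub>R e1 + (e2 \<bullet> x) *\<^sub>R e2 + (n \<bullet> x) *\<^sub>R n"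
proof -
  define y where "y = x - ((e1 \<bullet> x) *\<^sub>R e1 + (e2 \<bullet> x) *\<^sub>R e2 + (n \<bullet> x) *\<^sub>R n)"
  have d: "e1 \<bullet> y = 0" "e2 \<bullet> y = 0" "n \<bullet> y = 0"
    by (simp_all add: y_def inner_diff_right inner_add_right)
  have "cross3 y n = cross3 y (cross3 e1 e2)" by (simp add: cross)
  also have "\<dots> = (y \<bullet> e2) *\<^sub>R e1 - (y \<bullet> e1) *\<^sub>R e2" by (rule Lagrange)
  finally have "cross3 y n = 0" using d by (simp add: inner_commute)
  then have "y = 0" using norm_and_cross_eq_0[of y n] d n_unit by (auto simp: inner_commute)
  then show ?thesis by (simp add: y_def)
qed

lemma plane_simps [simp]: "e1 \<bullet> plane a = fst a" "e2 \<bullet> plane a = snd a" "n \<bullet> plane a = 0"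
  by (simp_all add: plane_def inner_add_right)

lemma norm_plane_add: "norm (plane a + t *\<^sub>R n) = sqrt ((norm a)\<^sup>2 + t\<^sup>2)"
proof -
  have "(norm (plane a + t *\<^sub>R n))\<^sup>2 = (norm a)\<^sup>2 + t\<^sup>2"
    unfolding power2_norm_eq_inner
    by (simp add: inner_add_left inner_add_right plane_def inner_prod_def power2_eq_square)
  then show ?thesis by (metis norm_ge_zero real_sqrt_unique)
qed

lemma norm_plane [simp]: "norm (plane a) = norm a"
  using norm_plane_add[of a 0] by simp

lemma plane_add: "plane (a + b) = plane a + plane b" and plane_diff: "plane (a - b) = plane a - plane b"
  and plane_scaleR: "plane (c *\<^sub>R a) = c *\<^sub>R plane a"
  by (simp_all add: plane_def algebra_simps)

lemma pt_proj_height: "pt (proj q) (height q) = q"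
  using frame_expansion[of "q - N"] by (simp add: pt_def proj_def height_def plane_def algebra_simps)

lemma proj_pt [simp]: "proj (pt a t) = a" and height_pt [simp]: "height (pt a t) = t"
  by (simp_all add: proj_def height_def pt_def plane_def inner_add_right)

lemma proj_N [simp]: "proj N = 0" and height_N [simp]: "height N = 0"
  by (simp_all add: proj_def height_def zero_prod_def)

lemma diff_eq: "q - q' = plane (proj q - proj q') + (height q - height q') *\<^sub>R n"
proof -
  have "q - q' = pt (proj q) (height q) - pt (proj q') (height q')" by (simp add: pt_proj_height)
  also have "\<dots> = plane (proj q - proj q') + (height q - height q') *\<^sub>R n"
    by (simp add: pt_def plane_diff algebra_simps)
  finally show ?thesis .
qed

lemma norm_diff: "norm (q - q') = sqrt ((norm (proj q - proj q'))\<^sup>2 + (height q - height q')\<^sup>2)"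
  using diff_eq[of q q'] norm_plane_add by simp

lemma norm_diff_le: "norm (q - q') \<le> norm (proj q - proj q') + \<bar>height q - height q'\<bar>"
  unfolding norm_diff using sqrt_sum_squares_le_sum_abs[of "norm (proj q - proj q')"] by simp

lemma continuous_on_proj [continuous_intros]: "continuous_on S proj"
  unfolding proj_def by (intro continuous_intros)

lemma continuous_on_height [continuous_intros]: "continuous_on S height"
  unfolding height_def by (intro continuous_intros)

lemma continuous_on_pt [continuous_intros]:
  "continuous_on S f \<Longrightarrow> continuous_on S g \<Longrightarrow> continuous_on S (\<lambda>x. pt (f x) (g x))"
  unfolding pt_def plane_def by (intro continuous_intros) auto

definition cyl :: "real \<Rightarrow> real \<Rightarrow> (real^3) set" where
  "cyl \<delta> H = {q. proj q \<in> square \<delta> \<and> \<bar>height q\<bar> < H}"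

lemma open_square: "open (square \<delta>)"
  unfolding square_def by (intro open_Times) auto

lemma open_cyl: "open (cyl \<delta> H)"
proof -
  have "cyl \<delta> H = proj -` square \<delta> \<inter> height -` {-H<..<H}"
    by (auto simp: cyl_def)
  then show ?thesis
    by (auto intro!: open_Int open_vimage open_square continuous_on_proj continuous_on_height)
qed

lemma square_norm: "a \<in> square \<delta> \<Longrightarrow> norm a < 2 * \<delta>"
  using norm_Pair_le[of "fst a" "snd a"] by (auto simp: square_def)

lemma cyl_subset_ball: "cyl \<delta> H \<subseteq> ball N (2 * \<delta> + H)"
proof
  fix q assume q: "q \<in> cyl \<delta> H"
  have "dist N q = norm (q - N)" by (simp add: dist_norm norm_minus_commute)
  also have "\<dots> \<le> norm (proj q) + \<bar>height q\<bar>" using norm_diff_le[of q N] by simp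
  finally show "q \<in> ball N (2 * \<delta> + H)" using q square_norm[of "proj q" \<delta>] by (auto simp: cyl_def)
qed

text \<open>The slope bound \<epsilon> can be prescribed, whereas C and l come from the surface
  alone; \<delta> and H are chosen afterwards. D lies below the graph because n points out of
  D.\<close>

definition local_graph ::
  "(real^3) set \<Rightarrow> (real^3 \<Rightarrow> real^3) \<Rightarrow> (real^3) set \<Rightarrow> real \<Rightarrow> real \<Rightarrow> real \<Rightarrow> real \<Rightarrow> real
    \<Rightarrow> (real \<times> real \<Rightarrow> real) \<Rightarrow> bool" where
  "local_graph \<Gamma> \<nu> D C l \<epsilon> \<delta> H f \<longleftrightarrow>
    (\<forall>a\<in>square \<delta>. \<bar>f a\<bar> < H \<and> pt a (f a) \<in> \<Gamma>) \<and>
    (\<forall>q\<in>\<Gamma> \<inter> cyl \<delta> H. height q = f (proj q)) \<and>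
    (\<forall>q\<in>\<Gamma> \<inter> cyl \<delta> H. norm (\<nu> q) = 1 \<and> \<nu> q \<bullet> n \<ge> 1 / 2) \<and>
    (\<forall>q\<in>\<Gamma> \<inter> cyl \<delta> H. \<forall>q'\<in>\<Gamma> \<inter> cyl \<delta> H.
       \<bar>\<nu> q \<bullet> (q - q')\<bar> \<le> C * norm (proj q - proj q') powr (1 + l) \<and>
       \<bar>height q - height q'\<bar> \<le> \<epsilon> * norm (proj q - proj q')) \<and>
    (\<forall>p\<in>cyl \<delta> H \<inter> D. height p < f (proj p)) \<and>
    (\<forall>p\<in>cyl \<delta> H - closure D. height p > f (proj p)) \<and>
    continuous_on (square \<delta>) f"

end

lemma tangent_frame_exists:
  assumes "norm n = 1"
  obtains e1 e2 where "tangent_frame e1 e2 n"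
proof -
  have n0: "n \<noteq> 0" and nn: "n \<bullet> n = 1" using assms by (auto simp: norm_eq_1)
  obtain x where x: "cross3 n x \<noteq> 0" using cross_basis_nonzero[OF n0] by blast
  define e1 where "e1 = cross3 n x /\<^sub>R norm (cross3 n x)"
  define e2 where "e2 = cross3 n e1"
  have 1: "norm e1 = 1" using x by (simp add: e1_def)
  then have 1: "norm e1 = 1" "e1 \<bullet> e1 = 1" by (simp_all add: norm_eq_1)
  have 2: "n \<bullet> e1 = 0" by (simp add: e1_def dot_cross_self)
  have 3: "(norm e2)\<^sup>2 = 1"
    using norm_cross_dot[of n e1] 1 2 assms by (simp add: e2_def)
  have "cross3 e1 e2 = n" using Lagrange[of e1 n e1] 1 2 by (simp add: e2_def inner_commute)
  moreover have "norm e2 = 1" using 3 by (metis norm_ge_zero one_power2 power2_eq_imp_eq zero_le_one)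
  ultimately have "tangent_frame e1 e2 n"
    using 1 2 assms by unfold_locales (auto simp: e2_def dot_cross_self inner_commute)
  then show ?thesis by (rule that)
qed

text \<open>The chord is at most the arc: |x - y|^2 = 2 - 2 cos t = 4 sin^2(t/2) \<le> t^2. This
  turns Lyapunov's angle condition into a Hoelder bound for the unit normals.\<close>

lemma norm_diff_le_arccos:
  fixes x y :: "'a::real_inner"
  assumes "norm x = 1" "norm y = 1"
  shows "norm (x - y) \<le> arccos (x \<bullet> y)"
proof -
  define t where "t = arccos (x \<bullet> y)"
  have b: "\<bar>x \<bullet> y\<bar> \<le> 1" using Cauchy_Schwarz_ineq2[of x y] assms by simp
  then have t: "0 \<le> t" "cos t = x \<bullet> y" unfolding t_def by (auto intro!: arccos_lbound)
  have "(norm (x - y))\<^sup>2 = 2 - 2 * cos t"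
    unfolding t power2_norm_eq_inner using assms
    by (simp add: inner_diff_left inner_diff_right norm_eq_1 inner_commute)
  also have "\<dots> \<le> t\<^sup>2"
  proof -
    have "cos t = 1 - 2 * (sin (t / 2))\<^sup>2" using cos_double_sin[of "t/2"] by simp
    moreover have "(sin (t / 2))\<^sup>2 \<le> (t / 2)\<^sup>2"
      using abs_sin_x_le_abs_x[of "t/2"] abs_le_square_iff by blast
    ultimately show ?thesis by (simp add: power2_eq_square)
  qed
  finally show ?thesis unfolding t_def[symmetric] using t(1) by (rule power2_le_imp_le)
qed

section \<open>Differentiability of the graph and the Lyapunov estimates\<close>

context tangent_frame
begin

lemma plane_inner_le: "norm m = 1 \<Longrightarrow> \<bar>m \<bullet> plane v\<bar> \<le> norm v"
  using Cauchy_Schwarz_ineq2[of m "plane v"] by simp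

text \<open>Implicit differentiation of m . (M - q) = o(|M - q|). The norm on the right contains the
  unknown increment of f; since m . n \<ge> 1/2 the increment can be absorbed, which gives first a
  Lipschitz bound and with it the derivative.\<close>

lemma graph_has_derivative:
  assumes S: "open S" "a \<in> S" and graph: "\<And>b. b \<in> S \<Longrightarrow> pt b (f b) \<in> \<Gamma>"
    and cont: "continuous_on S f"
    and normal: "unit_normal_at \<Gamma> (pt a (f a)) m" and k: "m \<bullet> n \<ge> 1 / 2"
  shows "(f has_derivative (\<lambda>v. - (m \<bullet> plane v) / (m \<bullet> n))) (at a)"
  unfolding has_derivative_at_alt
proof (intro conjI allI impI)
  show "bounded_linear (\<lambda>v. - (m \<bullet> plane v) / (m \<bullet> n))"
    unfolding linear_conv_bounded_linear[symmetric]
    by (rule linearI) (simp_all add: plane_add plane_scaleR inner_add_right add_divide_distrib diff_divide_distrib)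
next
  fix e :: real assume e: "e > 0"
  have m1: "norm m = 1" using normal by (simp add: unit_normal_at_def)
  \<comment> \<open>The bound 1/4 suffices to absorb the increment of f; the final error is
    \<open>12 * \<eta> * norm v\<close>, hence the second term.\<close>
  define \<eta> where "\<eta> = min (1/4) (e / 12)"
  have \<eta>: "\<eta> > 0" "\<eta> \<le> 1/4" "12 * \<eta> \<le> e" using e by (auto simp: \<eta>_def)
  let ?q = "pt a (f a)"
  have "((\<lambda>M. (m \<bullet> (M - ?q)) / norm (M - ?q)) \<longlongrightarrow> 0) (at ?q within \<Gamma>)"
    using normal by (simp add: unit_normal_at_def)
  from tendstoD[OF this \<eta>(1)] obtain \<rho> where \<rho>: "\<rho> > 0"
    and near: "\<And>M. M \<in> \<Gamma> \<Longrightarrow> M \<noteq> ?q \<Longrightarrow> dist M ?q < \<rho> \<Longrightarrow> \<bar>(m \<bullet> (M - ?q)) / norm (M - ?q)\<bar> < \<eta>"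
    unfolding eventually_at by auto
  have "continuous_on S (\<lambda>b. pt b (f b))" using cont by (intro continuous_intros)
  then have "isCont (\<lambda>b. pt b (f b)) a" using S by (simp add: continuous_on_eq_continuous_at)
  then obtain d1 where d1: "d1 > 0" "\<And>b. dist b a < d1 \<Longrightarrow> dist (pt b (f b)) ?q < \<rho>"
    unfolding continuous_at_eps_delta using \<rho> by blast
  obtain d2 where d2: "d2 > 0" "ball a d2 \<subseteq> S" using S openE by blast
  show "\<exists>d>0. \<forall>y. norm (y - a) < d \<longrightarrow>
      norm (f y - f a - - (m \<bullet> plane (y - a)) / (m \<bullet> n)) \<le> e * norm (y - a)"
  proof (intro exI[of _ "min d1 d2"] conjI allI impI)
    fix y assume y: "norm (y - a) < min d1 d2"
    define v where "v = y - a"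
    define \<Delta> where "\<Delta> = f y - f a"
    define M where "M = pt y (f y)"
    have M: "M \<in> \<Gamma>" unfolding M_def using y d2 by (intro graph) (auto simp: dist_norm norm_minus_commute)
    have MM: "M - ?q = plane v + \<Delta> *\<^sub>R n" unfolding M_def diff_eq by (simp add: v_def \<Delta>_def)
    have nM: "norm (M - ?q) \<le> norm v + \<bar>\<Delta>\<bar>" unfolding MM
      using norm_triangle_ineq[of "plane v" "\<Delta> *\<^sub>R n"] n_unit by simp
    have "\<bar>m \<bullet> (M - ?q)\<bar> \<le> \<eta> * norm (M - ?q)"
    proof (cases "M = ?q")
      case False
      have "\<bar>(m \<bullet> (M - ?q)) / norm (M - ?q)\<bar> < \<eta>"
        using y d1 by (intro near M False) (auto simp: M_def dist_norm)
      then show ?thesis using False by (simp add: abs_divide divide_less_eq)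
    qed simp
    also have "\<dots> \<le> \<eta> * (norm v + \<bar>\<Delta>\<bar>)" using nM \<eta> by (intro mult_left_mono) auto
    finally have 1: "\<bar>m \<bullet> plane v + \<Delta> * (m \<bullet> n)\<bar> \<le> \<eta> * (norm v + \<bar>\<Delta>\<bar>)"
      by (simp add: MM inner_add_right)
    have 2: "\<bar>m \<bullet> plane v\<bar> \<le> norm v" by (rule plane_inner_le[OF m1])
    have 3: "\<bar>\<Delta>\<bar> / 2 \<le> \<bar>\<Delta> * (m \<bullet> n)\<bar>" using k mult_left_mono[of "1/2" "m \<bullet> n" "\<bar>\<Delta>\<bar>"] by (simp add: abs_mult)
    have 4: "\<eta> * (norm v + \<bar>\<Delta>\<bar>) \<le> (1/4) * (norm v + \<bar>\<Delta>\<bar>)" using \<eta> by (intro mult_right_mono) auto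
    have "\<bar>m \<bullet> plane v + \<Delta> * (m \<bullet> n)\<bar> \<le> (1/4) * (norm v + \<bar>\<Delta>\<bar>)" using 1 4 by (rule order_trans)
    \<comment> \<open>From d/2 \<le> |X| \<le> w + (w + d)/4 one gets d/4 \<le> 5w/4.\<close>
    moreover have "d \<le> 5 * w" if "\<bar>Y + X\<bar> \<le> (1/4) * (w + d)" "\<bar>Y\<bar> \<le> w" "d / 2 \<le> \<bar>X\<bar>" for X Y d w :: real
      using that by argo
    ultimately have "\<bar>\<Delta>\<bar> \<le> 5 * norm v" using 2 3 by blast
    then have "\<eta> * (norm v + \<bar>\<Delta>\<bar>) \<le> \<eta> * (6 * norm v)" using \<eta> by (intro mult_left_mono) auto
    with 1 have 5: "\<bar>m \<bullet> plane v + \<Delta> * (m \<bullet> n)\<bar> \<le> 6 * \<eta> * norm v" by simp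
    have "\<Delta> - - (m \<bullet> plane v) / (m \<bullet> n) = (m \<bullet> plane v + \<Delta> * (m \<bullet> n)) / (m \<bullet> n)"
      using k by (simp add: field_simps)
    then have "norm (\<Delta> - - (m \<bullet> plane v) / (m \<bullet> n)) = \<bar>m \<bullet> plane v + \<Delta> * (m \<bullet> n)\<bar> / (m \<bullet> n)"
      using k by simp
    also have "\<dots> \<le> \<bar>m \<bullet> plane v + \<Delta> * (m \<bullet> n)\<bar> / (1 / 2)"
      using k by (intro divide_left_mono) auto
    also have "\<dots> \<le> 12 * \<eta> * norm v" using 5 by simp
    also have "\<dots> \<le> e * norm v" using \<eta> by (intro mult_right_mono) auto
    finally show "norm (f y - f a - - (m \<bullet> plane (y - a)) / (m \<bullet> n)) \<le> e * norm (y - a)"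
      by (simp add: v_def \<Delta>_def)
  qed (use d1 d2 in auto)
qed

lemma convex_square: "convex (square \<delta>)"
  unfolding square_def by (intro convex_Times convex_real_interval)

text \<open>Mean value theorem along the segment from b to a. The slope is small because the normals
  are close to n, which is orthogonal to the plane. For the Lyapunov estimate the chord is compared
  with the tangent vector at an intermediate point: that vector is orthogonal to its own normal, so
  only the difference of two normals enters.\<close>

lemma local_graph_estimates:
  assumes graph: "\<And>a. a \<in> square \<delta> \<Longrightarrow> pt a (f a) \<in> \<Gamma>"
    and cont: "continuous_on (square \<delta>) f"
    and normal: "\<And>a. a \<in> square \<delta> \<Longrightarrow> unit_normal_at \<Gamma> (pt a (f a)) (\<nu> (pt a (f a)))"
    and near: "\<And>a. a \<in> square \<delta> \<Longrightarrow> norm (\<nu> (pt a (f a)) - n) \<le> \<eta>"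
    and \<eta>: "\<eta> \<le> 1/2" "2 * \<eta> \<le> \<epsilon>"
    and A: "A \<ge> 0" "0 < l" "l \<le> 1"
    and holder: "\<And>M M'. M \<in> \<Gamma> \<Longrightarrow> M' \<in> \<Gamma> \<Longrightarrow> norm (\<nu> M - \<nu> M') \<le> A * dist M M' powr l"
    and ab: "a \<in> square \<delta>" "b \<in> square \<delta>"
  shows "\<nu> (pt a (f a)) \<bullet> n \<ge> 1/2"
    and "\<bar>f a - f b\<bar> \<le> \<epsilon> * norm (a - b)"
    and "\<bar>\<nu> (pt a (f a)) \<bullet> (pt a (f a) - pt b (f b))\<bar> \<le> 4 * A * norm (a - b) powr (1 + l)"
proof -
  have un: "norm (\<nu> (pt a (f a))) = 1" if "a \<in> square \<delta>" for a
    using normal[OF that] by (simp add: unit_normal_at_def)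
  have k: "\<nu> (pt a (f a)) \<bullet> n \<ge> 1/2" if "a \<in> square \<delta>" for a
  proof -
    let ?m = "\<nu> (pt a (f a))"
    have "1 - ?m \<bullet> n = (n - ?m) \<bullet> n" by (simp add: inner_diff_left)
    also have "\<dots> \<le> norm (n - ?m) * norm n" by (rule norm_cauchy_schwarz)
    also have "\<dots> \<le> 1/2" using near[OF that] \<eta> n_unit by (simp add: norm_minus_commute)
    finally show ?thesis by simp
  qed
  show "\<nu> (pt a (f a)) \<bullet> n \<ge> 1/2" by (rule k[OF ab(1)])
  define v where "v = a - b"
  define c where "c \<tau> = b + \<tau> *\<^sub>R v" for \<tau>
  define m where "m \<tau> = \<nu> (pt (c \<tau>) (f (c \<tau>)))" for \<tau>
  define g' where "g' \<tau> = - (m \<tau> \<bullet> plane v) / (m \<tau> \<bullet> n)" for \<tau>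
  have c: "c \<tau> \<in> square \<delta>" if "0 \<le> \<tau>" "\<tau> \<le> 1" for \<tau>
  proof -
    have "c \<tau> = (1 - \<tau>) *\<^sub>R b + \<tau> *\<^sub>R a" by (simp add: c_def v_def algebra_simps)
    then show ?thesis using convexD[OF convex_square ab(2,1)] that by auto
  qed
  have der: "((\<lambda>\<tau>. f (c \<tau>)) has_real_derivative g' \<tau>) (at \<tau>)" if "0 \<le> \<tau>" "\<tau> \<le> 1" for \<tau>
  proof -
    have "(f has_derivative (\<lambda>v. - (m \<tau> \<bullet> plane v) / (m \<tau> \<bullet> n))) (at (c \<tau>))"
      unfolding m_def using c[OF that]
      by (intro graph_has_derivative[OF open_square _ graph cont normal k])
    moreover have "(c has_derivative (\<lambda>t. t *\<^sub>R v)) (at \<tau>)"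
      unfolding c_def by (auto intro!: derivative_eq_intros)
    ultimately have "((\<lambda>\<tau>. f (c \<tau>)) has_derivative (\<lambda>t. - (m \<tau> \<bullet> plane (t *\<^sub>R v)) / (m \<tau> \<bullet> n))) (at \<tau>)"
      by (rule has_derivative_compose[rotated])
    then show ?thesis
      by (rule has_derivative_imp_has_field_derivative) (simp add: g'_def plane_scaleR)
  qed
  have g': "\<bar>g' \<tau>\<bar> \<le> 2 * \<eta> * norm v" if "0 \<le> \<tau>" "\<tau> \<le> 1" for \<tau>
  proof -
    have "\<bar>m \<tau> \<bullet> plane v\<bar> = \<bar>(m \<tau> - n) \<bullet> plane v\<bar>" by (simp add: inner_diff_left)
    also have "\<dots> \<le> norm (m \<tau> - n) * norm v" using Cauchy_Schwarz_ineq2[of "m \<tau> - n" "plane v"] by simp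
    also have "\<dots> \<le> \<eta> * norm v" using near[OF c[OF that]] by (intro mult_right_mono) (auto simp: m_def)
    finally have 1: "\<bar>m \<tau> \<bullet> plane v\<bar> \<le> \<eta> * norm v" .
    have 2: "m \<tau> \<bullet> n \<ge> 1/2" unfolding m_def by (rule k[OF c[OF that]])
    have "\<bar>g' \<tau>\<bar> = \<bar>m \<tau> \<bullet> plane v\<bar> / (m \<tau> \<bullet> n)" using 2 by (simp add: g'_def)
    also have "\<dots> \<le> \<bar>m \<tau> \<bullet> plane v\<bar> / (1/2)" using 2 by (intro divide_left_mono) auto
    also have "\<dots> \<le> 2 * \<eta> * norm v" using 1 by simp
    finally show ?thesis .
  qed
  have lip: "\<bar>f (c \<tau>) - f (c \<sigma>)\<bar> \<le> (\<tau> - \<sigma>) * (2 * \<eta> * norm v)" if st: "0 \<le> \<sigma>" "\<sigma> < \<tau>" "\<tau> \<le> 1" for \<sigma> \<tau>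
  proof -
    obtain z where z: "\<sigma> < z" "z < \<tau>" "f (c \<tau>) - f (c \<sigma>) = (\<tau> - \<sigma>) * g' z"
    proof -
      have "\<exists>z>\<sigma>. z < \<tau> \<and> f (c \<tau>) - f (c \<sigma>) = (\<tau> - \<sigma>) * g' z"
        by (rule MVT2[OF st(2)]) (rule der, use st in linarith, use st in linarith)
      with that show ?thesis by blast
    qed
    then show ?thesis using g'[of z] st by (simp add: abs_mult mult_left_mono)
  qed
  have ends: "c 0 = b" "c 1 = a" by (simp_all add: c_def v_def)
  have "\<bar>f a - f b\<bar> \<le> 2 * \<eta> * norm v" using lip[of 0 1] by (simp add: ends)
  also have "\<dots> \<le> \<epsilon> * norm v" using \<eta> by (intro mult_right_mono) auto
  finally show "\<bar>f a - f b\<bar> \<le> \<epsilon> * norm (a - b)" by (simp add: v_def)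
  let ?q = "pt a (f a)"
  \<comment> \<open>F is measured along the fixed normal at the first point, so F 1 - F 0 is its
    inner product with the chord.\<close>
  define F where "F \<tau> = \<nu> ?q \<bullet> (pt (c \<tau>) (f (c \<tau>)))" for \<tau>
  have F: "F = (\<lambda>\<tau>. \<nu> ?q \<bullet> (N + plane b) + \<tau> * (\<nu> ?q \<bullet> plane v) + f (c \<tau>) * (\<nu> ?q \<bullet> n))"
    unfolding F_def by (simp add: fun_eq_iff pt_def c_def plane_add plane_scaleR inner_add_right)
  have dF: "(F has_real_derivative (\<nu> ?q \<bullet> plane v + g' \<tau> * (\<nu> ?q \<bullet> n))) (at \<tau>)" if "0 \<le> \<tau>" "\<tau> \<le> 1" for \<tau>
    unfolding F by (auto intro!: derivative_eq_intros der[OF that])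
  obtain z where z: "0 < z" "z < 1" "F 1 - F 0 = \<nu> ?q \<bullet> plane v + g' z * (\<nu> ?q \<bullet> n)"
  proof -
    have "\<exists>z>0. z < 1 \<and> F 1 - F 0 = (1 - 0) * (\<nu> ?q \<bullet> plane v + g' z * (\<nu> ?q \<bullet> n))"
      by (rule MVT2[OF zero_less_one dF])
    then show ?thesis unfolding diff_zero mult_1_left using that by blast
  qed
  have z01: "0 \<le> z" "z \<le> 1" using z by auto
  have "m z \<bullet> plane v + g' z * (m z \<bullet> n) = 0"
    using k[OF c[OF z01]] by (simp add: g'_def m_def)
  then have "F 1 - F 0 = (\<nu> ?q - m z) \<bullet> (plane v + g' z *\<^sub>R n)"
    by (simp add: z(3) inner_diff_left inner_add_right algebra_simps)
  then have "\<bar>F 1 - F 0\<bar> \<le> norm (\<nu> ?q - m z) * norm (plane v + g' z *\<^sub>R n)"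
    using Cauchy_Schwarz_ineq2 by simp
  \<comment> \<open>The slope is at most 1, so both the distance between the two surface points and
    the length of the tangent vector are at most \<open>2 * norm v\<close>.\<close>
  also have "\<dots> \<le> (A * (2 * norm v) powr l) * (2 * norm v)"
  proof (intro mult_mono)
    have "dist ?q (pt (c z) (f (c z))) \<le> norm (a - c z) + \<bar>f (c 1) - f (c z)\<bar>"
      using norm_diff_le[of ?q "pt (c z) (f (c z))"] by (simp add: dist_norm ends)
    also have "norm (a - c z) = (1 - z) * norm v"
    proof -
      have "a - c z = (1 - z) *\<^sub>R v" by (simp add: c_def v_def algebra_simps)
      then show ?thesis using z01 by simp
    qed
    also have "\<bar>f (c 1) - f (c z)\<bar> \<le> (1 - z) * (1 * norm v)"
    proof -
      have "(1 - z) * (2 * \<eta> * norm v) \<le> (1 - z) * (1 * norm v)"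
        using z01 \<eta> by (intro mult_left_mono mult_right_mono) auto
      moreover have "\<bar>f (c 1) - f (c z)\<bar> \<le> (1 - z) * (2 * \<eta> * norm v)" using lip[of z 1] z by simp
      ultimately show ?thesis by linarith
    qed
    also have "(1 - z) * norm v + (1 - z) * (1 * norm v) \<le> 2 * norm v"
      using z mult_right_mono[of "1 - z" 1 "norm v"] by (simp add: mult.commute)
    finally have "dist ?q (pt (c z) (f (c z))) \<le> 2 * norm v" by simp
    then have "A * dist ?q (pt (c z) (f (c z))) powr l \<le> A * (2 * norm v) powr l"
      using A by (intro mult_left_mono powr_mono2) auto
    then show "norm (\<nu> ?q - m z) \<le> A * (2 * norm v) powr l"
      using holder[OF graph[OF ab(1)] graph[OF c[OF z01]]] by (simp add: m_def)
    have "norm (plane v + g' z *\<^sub>R n) \<le> norm v + \<bar>g' z\<bar>"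
      using norm_triangle_ineq[of "plane v" "g' z *\<^sub>R n"] n_unit by simp
    also have "\<bar>g' z\<bar> \<le> 1 * norm v"
      using g'[OF z01] mult_right_mono[OF _ norm_ge_zero, of "2 * \<eta>" 1 v] \<eta>(1) by argo
    finally show "norm (plane v + g' z *\<^sub>R n) \<le> 2 * norm v" by simp
  qed (simp_all add: A(1))
  also have "\<dots> = 2 powr l * (2 * A * (norm v * norm v powr l))"
  proof -
    have "(2 * norm v) powr l = 2 powr l * norm v powr l" by (rule powr_mult)
    then show ?thesis by (simp only: mult_ac)
  qed
  also have "\<dots> \<le> 2 * (2 * A * (norm v * norm v powr l))"
  proof (rule mult_right_mono)
    have "(2::real) powr l \<le> 2 powr 1" using A by (intro powr_mono) auto
    then show "(2::real) powr l \<le> 2" by (simp only: powr_one zero_le_numeral)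
  qed (use A in auto)
  also have "\<dots> = 4 * A * norm v powr (1 + l)"
    unfolding powr_add powr_one[OF norm_ge_zero] by (simp only: mult_ac)
  finally show "\<bar>\<nu> ?q \<bullet> (?q - pt b (f b))\<bar> \<le> 4 * A * norm (a - b) powr (1 + l)"
    by (simp add: F_def ends v_def inner_diff_right)
qed

end

section \<open>Existence of the graph\<close>

context tangent_frame
begin

lemma closed_segment_pt:
  "closed_segment (pt a s) (pt a t) = pt a ` closed_segment s t"
proof -
  have "pt a ((1 - u) * s + u * t) = (1 - u) *\<^sub>R pt a s + u *\<^sub>R pt a t" for u
    by (simp add: pt_def algebra_simps)
  then show ?thesis by (auto simp: closed_segment_def image_iff) metis+
qed

lemma frontier_crossing:
  assumes "pt a s \<in> D" "pt a t \<notin> D"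
  obtains u where "u \<in> closed_segment s t" "pt a u \<in> frontier D"
proof -
  have "closed_segment (pt a s) (pt a t) \<inter> frontier D \<noteq> {}"
    using assms by (intro connected_Int_frontier) auto
  then show ?thesis using that unfolding closed_segment_pt by blast
qed

text \<open>The outward condition provides a height H with the lower end inside D and the upper end
  outside its closure, and openness extends this to all base points in a small square. Every
  vertical segment then crosses the frontier of D, which is \<Gamma> where x > 0, and the Lyapunov
  condition on lines parallel to the normal leaves a single crossing.\<close>

lemma local_graph_exists:
  assumes N: "N \<in> \<Gamma>" "\<nu> N = n" "N $ 1 > 0"
    and D: "open D" and front: "\<And>p. p \<in> frontier D \<Longrightarrow> p $ 1 > 0 \<Longrightarrow> p \<in> \<Gamma>"
    and \<Gamma>_front: "\<Gamma> \<subseteq> frontier D"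
    and out: "outward_at D N n"
    and normal: "\<And>M. M \<in> \<Gamma> \<Longrightarrow> unit_normal_at \<Gamma> M (\<nu> M)"
    and d: "d > 0" "\<And>p q c. p \<in> \<Gamma> \<Longrightarrow> p \<in> ball N d \<Longrightarrow> q \<in> \<Gamma> \<Longrightarrow> q \<in> ball N d \<Longrightarrow>
        q = p + c *\<^sub>R n \<Longrightarrow> q = p"
    and A: "A > 0" "0 < l" "l \<le> 1"
    and holder: "\<And>M M'. M \<in> \<Gamma> \<Longrightarrow> M' \<in> \<Gamma> \<Longrightarrow> norm (\<nu> M - \<nu> M') \<le> A * dist M M' powr l"
    and \<epsilon>: "\<epsilon> > 0" and \<rho>: "\<rho> > 0"
  obtains \<delta> H f where "0 < \<delta>" "\<delta> < \<rho>" "0 < H" "H < \<rho>" "local_graph \<Gamma> \<nu> D (4 * A) l \<epsilon> \<delta> H f"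
proof -
  define \<eta> where "\<eta> = min (1/2) (\<epsilon> / 2)"
  have \<eta>: "\<eta> > 0" "\<eta> \<le> 1/2" "2 * \<eta> \<le> \<epsilon>" using \<epsilon> by (auto simp: \<eta>_def)
  \<comment> \<open>Within distance r of N the normals differ from n by at most \<eta>.\<close>
  define r where "r = (\<eta> / A) powr (1 / l)"
  have r: "r > 0" "A * r powr l \<le> \<eta>" using \<eta> A by (auto simp: r_def powr_powr)
  \<comment> \<open>The cylinder will lie in the ball of radius \<open>3 * \<rho>1\<close>; the
    thirds keep that ball inside the Lyapunov ball, the ball of radius r and the half-space x >
    0.\<close>
  define \<rho>1 where "\<rho>1 = min (min \<rho> (d / 3)) (min (r / 3) (N $ 1 / 3))"
  have \<rho>1: "\<rho>1 > 0" "\<rho>1 \<le> \<rho>" "3 * \<rho>1 \<le> d" "3 * \<rho>1 \<le> r" "3 * \<rho>1 \<le> N $ 1"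
    using \<rho> d r N by (auto simp: \<rho>1_def)
  have "\<forall>\<^sub>F h in at_right 0. N - h *\<^sub>R n \<in> D \<and> N + h *\<^sub>R n \<notin> closure D \<and> h \<in> {0<..<\<rho>1}"
    using out unfolding outward_at_def
    by (auto intro!: eventually_conj eventually_at_right_real \<rho>1 elim!: eventually_elim2)
  then obtain H where H: "N - H *\<^sub>R n \<in> D" "N + H *\<^sub>R n \<notin> closure D" "0 < H" "H < \<rho>1"
    using eventually_happens[of _ "at_right (0::real)"] by (auto simp: trivial_limit_at_right_real)
  obtain r1 where r1: "r1 > 0" "ball (N - H *\<^sub>R n) r1 \<subseteq> D" using D H(1) openE by blast
  obtain r2 where r2: "r2 > 0" "ball (N + H *\<^sub>R n) r2 \<subseteq> - closure D"
    using H(2) openE[of "- closure D" "N + H *\<^sub>R n"] by (auto simp: open_Compl)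
  define \<delta> where "\<delta> = min (\<rho>1 / 2) (min (r1 / 2) (r2 / 2))"
  have \<delta>: "0 < \<delta>" "\<delta> < \<rho>1" "2 * \<delta> \<le> r1" "2 * \<delta> \<le> r2" using \<rho>1 r1 r2 by (auto simp: \<delta>_def)
  have cyl: "cyl \<delta> H \<subseteq> ball N (3 * \<rho>1)"
    using cyl_subset_ball[of \<delta> H] \<delta> H subset_ball[of "2 * \<delta> + H" "3 * \<rho>1" N] by auto
  have below: "pt a (-H) \<in> D" and above: "pt a H \<notin> closure D" if "a \<in> square \<delta>" for a
  proof -
    have "dist (pt 0 t) (pt a t) < 2 * \<delta>" for t
      using norm_diff[of "pt 0 t" "pt a t"] square_norm[OF that] by (simp add: dist_norm)
    moreover have "pt 0 (-H) = N - H *\<^sub>R n" "pt 0 H = N + H *\<^sub>R n"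
      by (simp_all add: pt_def plane_def)
    ultimately have "dist (N - H *\<^sub>R n) (pt a (-H)) < 2 * \<delta>" "dist (N + H *\<^sub>R n) (pt a H) < 2 * \<delta>"
      by metis+
    then have "pt a (-H) \<in> ball (N - H *\<^sub>R n) r1" "pt a H \<in> ball (N + H *\<^sub>R n) r2"
      using \<delta> by auto
    then show "pt a (-H) \<in> D" "pt a H \<notin> closure D" using r1(2) r2(2) by blast+
  qed
  have pos: "p $ 1 > 0" if "p \<in> ball N (3 * \<rho>1)" for p
  proof -
    have "\<bar>(N - p) $ 1\<bar> \<le> norm (N - p)" by (rule component_le_norm_cart)
    then show ?thesis using that \<rho>1 by (auto simp: dist_norm)
  qed
  have D_front: "D \<inter> frontier D = {}" using D by (auto simp: frontier_def interior_open)
  have cD_front: "p \<in> frontier D \<Longrightarrow> p \<in> closure D" for p by (simp add: frontier_def)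
  have clD: "D \<subseteq> closure D" by (rule closure_subset)
  have in_cyl: "pt a t \<in> cyl \<delta> H" if "a \<in> square \<delta>" "\<bar>t\<bar> < H" for a t
    using that by (simp add: cyl_def)
  have front': "\<bar>t\<bar> < H \<and> pt a t \<in> \<Gamma>" if a: "a \<in> square \<delta>" and "\<bar>t\<bar> \<le> H" "pt a t \<in> frontier D" for a t
  proof -
    have "t \<noteq> H" "t \<noteq> -H" using below[OF a] above[OF a] that D_front cD_front by auto
    then have t: "\<bar>t\<bar> < H" using that by auto
    then show ?thesis using front[OF that(3) pos] in_cyl[OF a t] cyl by auto
  qed
  have uniq: "t = t'" if a: "a \<in> square \<delta>" and t: "\<bar>t\<bar> < H" "\<bar>t'\<bar> < H" "pt a t \<in> \<Gamma>" "pt a t' \<in> \<Gamma>" for a t t'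
  proof -
    have b: "pt a t \<in> ball N d" "pt a t' \<in> ball N d"
      using in_cyl[OF a] t cyl subset_ball[OF \<rho>1(3), of N] by blast+
    have "pt a t' = pt a t + (t' - t) *\<^sub>R n" by (simp add: pt_def algebra_simps)
    then have "pt a t' = pt a t" using d(2) t b by blast
    then show ?thesis by (metis height_pt)
  qed
  have "\<exists>t. \<bar>t\<bar> < H \<and> pt a t \<in> \<Gamma>" if a: "a \<in> square \<delta>" for a
  proof -
    obtain u where "u \<in> closed_segment (-H) H" "pt a u \<in> frontier D"
      using frontier_crossing[OF below[OF a], of H] above[OF a] clD by blast
    moreover from this have "\<bar>u\<bar> \<le> H" using H(3) by (auto simp: closed_segment_eq_real_ivl abs_le_iff abs_less_iff split: if_splits)
    ultimately show ?thesis using front'[OF a, of u] by blast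
  qed
  then obtain f where f: "\<And>a. a \<in> square \<delta> \<Longrightarrow> \<bar>f a\<bar> < H \<and> pt a (f a) \<in> \<Gamma>" by metis
  have f_eq: "t = f a" if "a \<in> square \<delta>" "\<bar>t\<bar> \<le> H" "pt a t \<in> frontier D" for a t
    using front'[OF that] uniq[OF that(1)] f[OF that(1)] by blast
  \<comment> \<open>A point of D above the graph would force a second crossing on the way to the
    top, which lies outside.\<close>
  have side1: "t < f a" if a: "a \<in> square \<delta>" and t: "\<bar>t\<bar> < H" "pt a t \<in> D" for a t
  proof (rule ccontr)
    assume "\<not> t < f a"
    moreover have "t \<noteq> f a" using f[OF a] \<Gamma>_front t(2) D_front by auto
    ultimately have "t > f a" by auto
    obtain u where "u \<in> closed_segment t H" "pt a u \<in> frontier D"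
      using frontier_crossing[OF t(2), of H] above[OF a] clD by blast
    then show False using f_eq[OF a, of u] t \<open>t > f a\<close> by (auto simp: closed_segment_eq_real_ivl abs_le_iff abs_less_iff split: if_splits)
  qed
  have side2: "t > f a" if a: "a \<in> square \<delta>" and t: "\<bar>t\<bar> < H" "pt a t \<notin> closure D" for a t
  proof (rule ccontr)
    assume "\<not> t > f a"
    moreover have "t \<noteq> f a" using f[OF a] \<Gamma>_front t(2) cD_front by auto
    ultimately have "t < f a" by auto
    obtain u where "u \<in> closed_segment (-H) t" "pt a u \<in> frontier D"
      using frontier_crossing[OF below[OF a], of t] t(2) clD by blast
    then show False using f_eq[OF a, of u] t \<open>t < f a\<close> by (auto simp: closed_segment_eq_real_ivl abs_le_iff abs_less_iff split: if_splits)
  qed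
  \<comment> \<open>Conversely, a point below the graph but outside D would force a second crossing
    on the way up from the bottom.\<close>
  have side1': "pt a t \<in> D" if a: "a \<in> square \<delta>" and t: "\<bar>t\<bar> < H" "t < f a" for a t
  proof (rule ccontr)
    assume "pt a t \<notin> D"
    then obtain u where "u \<in> closed_segment (-H) t" "pt a u \<in> frontier D"
      using frontier_crossing[OF below[OF a], of t] by blast
    then show False using f_eq[OF a, of u] t by (auto simp: closed_segment_eq_real_ivl abs_le_iff abs_less_iff split: if_splits)
  qed
  have side2': "pt a t \<notin> closure D" if a: "a \<in> square \<delta>" and t: "\<bar>t\<bar> < H" "t > f a" for a t
  proof
    assume "pt a t \<in> closure D"
    then have "pt a t \<in> D \<or> pt a t \<in> frontier D" using D by (auto simp: frontier_def interior_open)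
    then show False using side1[OF a t(1)] f_eq[OF a, of t] t by auto
  qed
  \<comment> \<open>Being on a given side is an open condition in the base point: a height below
    \<open>f a\<close> stays in D for nearby base points, and a height above it stays outside the
    closure.\<close>
  have cont: "continuous_on (square \<delta>) f"
  proof (rule continuous_at_imp_continuous_on, rule ballI)
    fix a assume a: "a \<in> square \<delta>"
    have ev: "\<forall>\<^sub>F b in at a. b \<in> square \<delta>"
      using open_square a by (intro eventually_at_in_open') auto
    have iso: "isCont (\<lambda>b. pt b t) a" for t
      using continuous_on_pt[of UNIV "\<lambda>b. b" "\<lambda>_. t"] by (simp add: continuous_on_eq_continuous_at split_paired_all del: split_paired_All)
    show "isCont f a"
      unfolding isCont_def
    proof (rule order_tendstoI)
      fix y assume y: "y < f a"
      \<comment> \<open>The bound y is raised, if necessary, to a height above -H but still below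
        \<open>f a\<close>, since the sides are known only inside the cylinder.\<close>
      define t where "t = max y (- (\<bar>f a\<bar> + H) / 2)"
      have fa: "\<bar>f a\<bar> < H" using f[OF a] by simp
      have "- (\<bar>f a\<bar> + H) / 2 \<le> t" "y \<le> t" unfolding t_def by (rule max.cobounded2, rule max.cobounded1)
      moreover have "t < f a" unfolding t_def max_less_iff_conj using y fa by argo
      ultimately have t: "y \<le> t" "t < f a" "\<bar>t\<bar> < H" using fa by argo+
      have "\<forall>\<^sub>F b in at a. pt b t \<in> D"
        by (rule topological_tendstoD[OF iso[unfolded isCont_def] D side1'[OF a t(3,2)]])
      then show "\<forall>\<^sub>F b in at a. y < f b"
        using ev by eventually_elim (use side1 t in force)
    next
      fix y assume y: "f a < y"
      define t where "t = min y ((\<bar>f a\<bar> + H) / 2)"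
      have fa: "\<bar>f a\<bar> < H" using f[OF a] by simp
      have "t \<le> (\<bar>f a\<bar> + H) / 2" "t \<le> y" unfolding t_def by (rule min.cobounded2, rule min.cobounded1)
      moreover have "f a < t" unfolding t_def min_less_iff_conj using y fa by argo
      ultimately have t: "t \<le> y" "f a < t" "\<bar>t\<bar> < H" using fa by argo+
      have "\<forall>\<^sub>F b in at a. pt b t \<in> - closure D"
        by (rule topological_tendstoD[OF iso[unfolded isCont_def]]) (use side2'[OF a t(3,2)] in auto)
      then show "\<forall>\<^sub>F b in at a. f b < y"
        using ev by eventually_elim (use side2 t in force)
    qed
  qed
  have near: "norm (\<nu> q - n) \<le> \<eta>" if q: "q \<in> \<Gamma>" "q \<in> cyl \<delta> H" for q
  proof -
    have "dist q N \<le> r" using q cyl \<rho>1(4) by (auto simp: dist_commute)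
    then have "A * dist q N powr l \<le> A * r powr l" using A by (intro mult_left_mono powr_mono2) auto
    then show ?thesis using holder[OF q(1) N(1)] N(2) r(2) by simp
  qed
  note est = local_graph_estimates[of \<delta> f \<Gamma> \<nu> \<eta> \<epsilon> A l, OF _ cont normal near \<eta>(2,3) less_imp_le[OF A(1)] A(2,3) holder]
  have fcyl: "pt a (f a) \<in> cyl \<delta> H" if "a \<in> square \<delta>" for a using f[OF that] that by (auto intro: in_cyl)
  have h_eq: "height q = f (proj q)" if "q \<in> \<Gamma> \<inter> cyl \<delta> H" for q
    using that f_eq[of "proj q" "height q"] \<Gamma>_front by (auto simp: cyl_def pt_proj_height)
  have q_eq: "q = pt (proj q) (f (proj q))" "proj q \<in> square \<delta>" if "q \<in> \<Gamma> \<inter> cyl \<delta> H" for q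
    using pt_proj_height[of q] h_eq[OF that] that by (auto simp: cyl_def)
  have "local_graph \<Gamma> \<nu> D (4 * A) l \<epsilon> \<delta> H f"
    unfolding local_graph_def
  proof (intro conjI ballI)
    fix q assume q: "q \<in> \<Gamma> \<inter> cyl \<delta> H"
    show "norm (\<nu> q) = 1" using normal[of q] q by (auto simp: unit_normal_at_def)
    show "\<nu> q \<bullet> n \<ge> 1/2"
      using est(1)[of "proj q" "proj q"] f fcyl q_eq[OF q] by auto
    fix q' assume q': "q' \<in> \<Gamma> \<inter> cyl \<delta> H"
    show "\<bar>\<nu> q \<bullet> (q - q')\<bar> \<le> 4 * A * norm (proj q - proj q') powr (1 + l)"
      using est(3)[of "proj q" "proj q'"] f fcyl q_eq[OF q] q_eq[OF q'] by auto
    show "\<bar>height q - height q'\<bar> \<le> \<epsilon> * norm (proj q - proj q')"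
      using est(2)[of "proj q" "proj q'"] f fcyl q_eq[OF q] q_eq[OF q'] h_eq[OF q] h_eq[OF q'] by auto
  next
    fix p assume "p \<in> cyl \<delta> H \<inter> D"
    then show "height p < f (proj p)"
      using side1[of "proj p" "height p"] by (auto simp: cyl_def pt_proj_height)
  next
    fix p assume "p \<in> cyl \<delta> H - closure D"
    then show "f (proj p) < height p"
      using side2[of "proj p" "height p"] by (auto simp: cyl_def pt_proj_height)
  qed (use f h_eq cont in auto)
  then show ?thesis using that[of \<delta> H f] \<delta> H \<rho>1 by auto
qed

end

section \<open>Area formula in the plane\<close>

text \<open>The library proves change of variables only on \<open>real^'n\<close>, hence the transfer between
  \<open>real^2\<close> and pairs.\<close>

definition to_pair :: "real^2 \<Rightarrow> real \<times> real" where "to_pair x = (x $ 1, x $ 2)"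
definition of_pair :: "real \<times> real \<Rightarrow> real^2" where "of_pair a = vector [fst a, snd a]"

lemma to_pair_of_pair [simp]: "to_pair (of_pair a) = a"
  by (simp add: to_pair_def of_pair_def)

lemma of_pair_to_pair [simp]: "of_pair (to_pair x) = x"
  by (simp add: to_pair_def of_pair_def vec_eq_iff forall_2)

lemma bounded_linear_to_pair: "bounded_linear to_pair"
  unfolding to_pair_def linear_conv_bounded_linear[symmetric] by (rule linearI) auto

lemma bounded_linear_of_pair: "bounded_linear of_pair"
  unfolding of_pair_def linear_conv_bounded_linear[symmetric]
  by (rule linearI) (auto simp: vec_eq_iff forall_2)

lemma to_pair_measurable [measurable]: "to_pair \<in> borel_measurable borel"
  using bounded_linear_to_pair linear_continuous_on by (intro borel_measurable_continuous_onI) blast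

lemma lborel_to_pair: "distr lborel borel to_pair = lborel"
proof (rule lborel_eqI[symmetric])
  fix l u :: "real \<times> real"
  assume lu: "\<And>b. b \<in> Basis \<Longrightarrow> l \<bullet> b \<le> u \<bullet> b"
  have le: "fst l \<le> fst u" "snd l \<le> snd u"
    using lu[of "(1, 0)"] lu[of "(0, 1)"] by (auto simp: Basis_prod_def inner_prod_def)
  have Basis2: "(Basis :: (real^2) set) = {axis 1 1, axis 2 1}"
    by (auto simp: Basis_vec_def UNIV_2)
  have ax: "axis 1 1 \<noteq> (axis 2 1 :: real^2)" by (simp add: axis_eq_axis)
  have "to_pair -` box l u = box (of_pair l) (of_pair u)"
    by (auto simp: box_def Basis2 Basis_prod_def to_pair_def of_pair_def inner_prod_def inner_axis)
  then have "emeasure (distr lborel borel to_pair) (box l u) = emeasure lborel (box (of_pair l) (of_pair u))"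
    by (simp add: emeasure_distr)
  also have "\<dots> = (\<Prod>b\<in>Basis. (of_pair u - of_pair l) \<bullet> b)"
    using le by (intro emeasure_lborel_box) (auto simp: Basis2 of_pair_def inner_axis)
  also have "(\<Prod>b\<in>Basis. (of_pair u - of_pair l) \<bullet> b) = (fst u - fst l) * (snd u - snd l)"
    using ax by (simp add: Basis2 of_pair_def inner_axis)
  also have "\<dots> = (\<Prod>b\<in>Basis. (u - l) \<bullet> b)"
  proof -
    have B: "(Basis :: (real \<times> real) set) = {(1, 0), (0, 1)}" by (auto simp: Basis_prod_def)
    show ?thesis unfolding B by (simp add: inner_prod_def)
  qed
  finally show "emeasure (distr lborel borel to_pair) (box l u) = (\<Prod>b\<in>Basis. (u - l) \<bullet> b)" .
qed simp

lemma nn_integral_to_pair: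
  assumes [measurable]: "f \<in> borel_measurable borel"
  shows "(\<integral>\<^sup>+x. f (to_pair x) \<partial>lborel) = (\<integral>\<^sup>+u. f u \<partial>lborel)"
  by (subst lborel_to_pair[symmetric], subst nn_integral_distr) auto

lemma emeasure_to_pair_vimage:
  assumes [measurable]: "A \<in> sets borel"
  shows "emeasure lborel (to_pair -` A) = emeasure lborel A"
proof -
  have "emeasure lborel A = emeasure (distr lborel borel to_pair) A" by (simp add: lborel_to_pair)
  also have "\<dots> = emeasure lborel (to_pair -` A)" by (subst emeasure_distr) auto
  finally show ?thesis by simp
qed

section \<open>Change of variables, critical values and multiplicities\<close>

definition jac2 :: "(real \<times> real \<Rightarrow> real \<times> real) \<Rightarrow> real" where
  "jac2 L = fst (L (1, 0)) * snd (L (0, 1)) - snd (L (1, 0)) * fst (L (0, 1))"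

lemma det_conj_pair: "det (matrix (of_pair \<circ> L \<circ> to_pair)) = jac2 L"
  by (simp add: det_2 matrix_def of_pair_def to_pair_def jac2_def axis_def)

lemma has_derivative_conj_pair:
  assumes "(\<phi> has_derivative \<phi>') (at (to_pair x) within E)"
  shows "((of_pair \<circ> \<phi> \<circ> to_pair) has_derivative (of_pair \<circ> \<phi>' \<circ> to_pair)) (at x within to_pair -` E)"
proof -
  have "(to_pair has_derivative to_pair) (at x within to_pair -` E)"
    by (rule bounded_linear_imp_has_derivative[OF bounded_linear_to_pair])
  moreover have "(\<phi> has_derivative \<phi>') (at (to_pair x) within to_pair ` (to_pair -` E))"
    by (rule has_derivative_subset[OF assms]) auto
  ultimately have "((\<phi> \<circ> to_pair) has_derivative (\<phi>' \<circ> to_pair)) (at x within to_pair -` E)"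
    by (rule diff_chain_within)
  moreover have "(of_pair has_derivative of_pair) (at ((\<phi> \<circ> to_pair) x) within S)" for S
    by (rule bounded_linear_imp_has_derivative[OF bounded_linear_of_pair])
  ultimately show ?thesis
    unfolding o_assoc[symmetric] by (rule diff_chain_within)
qed

lemma conj_pair_image: "(of_pair \<circ> \<phi> \<circ> to_pair) ` (to_pair -` S) = to_pair -` (\<phi> ` S)"
proof -
  have "x \<in> (of_pair \<circ> \<phi> \<circ> to_pair) ` (to_pair -` S)" if "to_pair x = \<phi> s" "s \<in> S" for x s
    using that by (intro image_eqI[of _ _ "of_pair s"]) (simp_all flip: that(1))
  then show ?thesis by auto
qed

text \<open>Change of variables on \<open>real^2\<close>, conjugated by the measure-preserving
  \<open>to_pair\<close>, under which the determinant becomes \<open>jac2\<close>.\<close>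

lemma emeasure_injective_image:
  fixes \<phi> :: "real \<times> real \<Rightarrow> real \<times> real"
  assumes S [measurable]: "S \<in> sets borel" and im [measurable]: "\<phi> ` S \<in> sets borel"
    and der: "\<And>u. u \<in> S \<Longrightarrow> (\<phi> has_derivative \<phi>' u) (at u within S)"
    and inj: "inj_on \<phi> S"
    and J: "\<And>u. u \<in> S \<Longrightarrow> J u = jac2 (\<phi>' u)"
    and Jm [measurable]: "(\<lambda>u. \<bar>J u\<bar> * indicator S u) \<in> borel_measurable borel"
    and fin: "(\<integral>\<^sup>+u. ennreal (\<bar>J u\<bar> * indicator S u) \<partial>lborel) < \<infinity>"
  shows "emeasure lborel (\<phi> ` S) = (\<integral>\<^sup>+u. ennreal (\<bar>J u\<bar> * indicator S u) \<partial>lborel)"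
proof -
  let ?g = "of_pair \<circ> \<phi> \<circ> to_pair" and ?S = "to_pair -` S"
  let ?g' = "\<lambda>x. of_pair \<circ> \<phi>' (to_pair x) \<circ> to_pair"
  let ?f = "\<lambda>x. \<bar>J (to_pair x)\<bar> * indicator S (to_pair x)"
  define m where "m = enn2real (\<integral>\<^sup>+u. ennreal (\<bar>J u\<bar> * indicator S u) \<partial>lborel)"
  have m: "m \<ge> 0" "(\<integral>\<^sup>+u. ennreal (\<bar>J u\<bar> * indicator S u) \<partial>lborel) = ennreal m"
    using fin by (auto simp: m_def less_top)
  have Sb: "?S \<in> sets borel" using measurable_sets[OF to_pair_measurable S] by simp
  have fm: "?f \<in> borel_measurable borel"
    using measurable_compose[OF to_pair_measurable Jm] .
  have "(\<integral>\<^sup>+x. ennreal (?f x) \<partial>lborel) = ennreal m"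
    using nn_integral_to_pair[of "\<lambda>u. ennreal (\<bar>J u\<bar> * indicator S u)"] m by simp
  then have "(?f has_integral m) UNIV"
    using m fm by (intro nn_integral_has_integral) auto
  also have "?f = (\<lambda>x. if x \<in> ?S then \<bar>det (matrix (?g' x))\<bar> else 0)"
    by (auto simp: fun_eq_iff det_conj_pair J indicator_def)
  finally have "((\<lambda>x. \<bar>det (matrix (?g' x))\<bar>) has_integral m) ?S"
    unfolding has_integral_restrict_UNIV .
  moreover have "(?g has_derivative ?g' x) (at x within ?S)" if "x \<in> ?S" for x
    using that by (intro has_derivative_conj_pair der) auto
  moreover have "inj_on ?g ?S"
  proof (rule inj_onI)
    fix x y assume xy: "x \<in> ?S" "y \<in> ?S" "?g x = ?g y"
    then have "to_pair (?g x) = to_pair (?g y)" by simp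
    then have "to_pair x = to_pair y" using inj xy by (auto simp: inj_on_def)
    then show "x = y" by (metis of_pair_to_pair)
  qed
  ultimately have "?g ` ?S \<in> lmeasurable \<and> measure lebesgue (?g ` ?S) = m"
    using Sb by (subst has_measure_differentiable_image) auto
  then have "emeasure lebesgue (to_pair -` (\<phi> ` S)) = ennreal m"
    by (simp only: conj_pair_image emeasure_eq_measure2 fmeasurable_def)
  moreover have "to_pair -` (\<phi> ` S) \<in> sets borel" using measurable_sets[OF to_pair_measurable im] by simp
  ultimately have "emeasure lborel (to_pair -` (\<phi> ` S)) = ennreal m"
    by (simp add: emeasure_completion)
  then show ?thesis using emeasure_to_pair_vimage[OF im] m by simp
qed

text \<open>Two measures are compared: the image under \<phi> of the density |J| on E, and Lebesgue
  measure on the image of E. They agree on Borel sets by the set version applied to preimages in E,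
  and H is integrated against both.\<close>

lemma nn_integral_injective_image:
  fixes \<phi> :: "real \<times> real \<Rightarrow> real \<times> real"
  assumes E [measurable]: "E \<in> sets borel" and im [measurable]: "\<phi> ` E \<in> sets borel"
    and der: "\<And>u. u \<in> E \<Longrightarrow> (\<phi> has_derivative \<phi>' u) (at u within E)"
    and inj: "inj_on \<phi> E"
    and J: "\<And>u. u \<in> E \<Longrightarrow> J u = jac2 (\<phi>' u)"
    and Jm [measurable]: "(\<lambda>u. \<bar>J u\<bar> * indicator E u) \<in> borel_measurable borel"
    and fin: "(\<integral>\<^sup>+u. ennreal (\<bar>J u\<bar> * indicator E u) \<partial>lborel) < \<infinity>"
    and H [measurable]: "H \<in> borel_measurable borel"
  shows "(\<integral>\<^sup>+u. H (\<phi> u) * ennreal (\<bar>J u\<bar> * indicator E u) \<partial>lborel) = (\<integral>\<^sup>+a. H a * indicator (\<phi> ` E) a \<partial>lborel)"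
proof -
  \<comment> \<open>\<phi> is controlled only on E; \<psi> is a Borel function on the whole plane
    that agrees with it there.\<close>
  define \<psi> where "\<psi> u = (if u \<in> E then \<phi> u else 0)" for u
  have "continuous_on E \<phi>" using der by (meson has_derivative_continuous continuous_on_eq_continuous_within)
  then have \<psi> [measurable]: "\<psi> \<in> borel_measurable borel"
    unfolding \<psi>_def using borel_measurable_continuous_on_if[OF E _ continuous_on_const] by simp
  define M1 where "M1 = distr (density lborel (\<lambda>u. ennreal (\<bar>J u\<bar> * indicator E u))) borel \<psi>"
  define M2 where "M2 = density lborel (\<lambda>a. indicator (\<phi> ` E) a :: ennreal)"
  have "M1 = M2"
  proof (rule measure_eqI)
    fix B assume "B \<in> sets M1"
    then have B [measurable]: "B \<in> sets borel" by (simp add: M1_def)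
    define S where "S = E \<inter> \<psi> -` B"
    have S [measurable]: "S \<in> sets borel" unfolding S_def
      using measurable_sets[OF \<psi> B] by auto
    have S': "S = {u \<in> E. \<phi> u \<in> B}" by (auto simp: S_def \<psi>_def)
    have imS: "\<phi> ` S = \<phi> ` E \<inter> B" by (auto simp: S')
    have eq: "\<bar>J u\<bar> * indicator S u = (\<bar>J u\<bar> * indicator E u) * indicator S u" for u
      by (auto simp: S' indicator_def)
    have "emeasure M1 B = (\<integral>\<^sup>+u. ennreal (\<bar>J u\<bar> * indicator E u) * indicator (\<psi> -` B) u \<partial>lborel)"
      unfolding M1_def using measurable_sets[OF \<psi> B]
      by (subst emeasure_distr) (auto simp: emeasure_density)
    also have "\<dots> = (\<integral>\<^sup>+u. ennreal (\<bar>J u\<bar> * indicator S u) \<partial>lborel)"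
      by (intro nn_integral_cong) (auto simp: S_def indicator_def)
    also have "\<dots> = emeasure lborel (\<phi> ` S)"
    proof (rule emeasure_injective_image[symmetric])
      show "(\<lambda>u. \<bar>J u\<bar> * indicator S u) \<in> borel_measurable borel"
        unfolding eq by measurable
      have "(\<integral>\<^sup>+u. ennreal (\<bar>J u\<bar> * indicator S u) \<partial>lborel) \<le> (\<integral>\<^sup>+u. ennreal (\<bar>J u\<bar> * indicator E u) \<partial>lborel)"
        by (intro nn_integral_mono) (auto simp: S_def indicator_def)
      then show "(\<integral>\<^sup>+u. ennreal (\<bar>J u\<bar> * indicator S u) \<partial>lborel) < \<infinity>"
        using fin by (rule le_less_trans)
      show "\<And>u. u \<in> S \<Longrightarrow> (\<phi> has_derivative \<phi>' u) (at u within S)"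
        using der by (auto simp: S_def intro: has_derivative_subset)
      show "\<phi> ` S \<in> sets borel" unfolding imS by measurable
      show "inj_on \<phi> S" using inj by (rule inj_on_subset) (auto simp: S_def)
    qed (auto simp: S_def J)
    also have "\<dots> = emeasure M2 B"
      unfolding M2_def imS by (simp add: emeasure_density indicator_inter_arith[symmetric])
    finally show "emeasure M1 B = emeasure M2 B" .
  qed (simp add: M1_def M2_def)
  then have "(\<integral>\<^sup>+a. H a \<partial>M1) = (\<integral>\<^sup>+a. H a \<partial>M2)" by simp
  also have "(\<integral>\<^sup>+a. H a \<partial>M2) = (\<integral>\<^sup>+a. H a * indicator (\<phi> ` E) a \<partial>lborel)"
    unfolding M2_def by (subst nn_integral_density) (auto simp: mult.commute)
  also have "(\<integral>\<^sup>+a. H a \<partial>M1) = (\<integral>\<^sup>+u. ennreal (\<bar>J u\<bar> * indicator E u) * H (\<psi> u) \<partial>lborel)"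
    unfolding M1_def by (subst nn_integral_distr, simp, simp, subst nn_integral_density) auto
  also have "\<dots> = (\<integral>\<^sup>+u. H (\<phi> u) * ennreal (\<bar>J u\<bar> * indicator E u) \<partial>lborel)"
    by (intro nn_integral_cong) (auto simp: \<psi>_def mult.commute)
  finally show ?thesis .
qed

text \<open>Sard's theorem in equal dimensions: a vanishing determinant means that the derivative
  has rank below 2.\<close>

lemma critical_values_null:
  fixes \<phi> :: "real \<times> real \<Rightarrow> real \<times> real"
  assumes der: "\<And>u. u \<in> Z \<Longrightarrow> (\<phi> has_derivative \<phi>' u) (at u within Z)"
    and J: "\<And>u. u \<in> Z \<Longrightarrow> jac2 (\<phi>' u) = 0"
  shows "negligible (\<phi> ` Z)"
proof -
  let ?g = "of_pair \<circ> \<phi> \<circ> to_pair" and ?S = "to_pair -` Z"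
  let ?g' = "\<lambda>x. of_pair \<circ> \<phi>' (to_pair x) \<circ> to_pair"
  have "negligible (?g ` ?S)"
  proof (rule baby_Sard)
    fix x assume "x \<in> ?S"
    then show "(?g has_derivative ?g' x) (at x within ?S)" by (intro has_derivative_conj_pair der) auto
    have "det (matrix (?g' x)) = 0" using J \<open>x \<in> ?S\<close> by (simp only: det_conj_pair) auto
    then show "rank (matrix (?g' x)) < CARD(2)" by (simp only: det_eq_0_rank)
  qed simp
  then have "to_pair -` (\<phi> ` Z) \<in> null_sets lebesgue"
    unfolding conj_pair_image by (simp add: negligible_iff_null_sets)
  \<comment> \<open>The image need not be Borel, so the transfer from \<open>real^2\<close> to pairs
    goes through a Borel null superset.\<close>
  then obtain B where B: "B \<in> null_sets lborel" "to_pair -` (\<phi> ` Z) \<subseteq> B"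
    using null_sets_completion_iff2[of _ lborel] by blast
  have B1: "B \<in> sets borel" "emeasure lborel B = 0" using B by auto
  have of_pair_m: "of_pair \<in> borel_measurable borel"
    using bounded_linear_of_pair linear_continuous_on by (intro borel_measurable_continuous_onI) blast
  have B2: "of_pair -` B \<in> sets borel" using measurable_sets[OF of_pair_m B1(1)] by simp
  have "to_pair -` (of_pair -` B) = B" by (simp add: vimage_def)
  then have "emeasure lborel (of_pair -` B) = 0" using emeasure_to_pair_vimage[OF B2] B1 by simp
  then have "of_pair -` B \<in> null_sets lborel" using B2 by auto
  moreover have "\<phi> ` Z \<subseteq> of_pair -` B"
  proof
    fix a assume "a \<in> \<phi> ` Z"
    then have "of_pair a \<in> to_pair -` (\<phi> ` Z)" by simp
    then show "a \<in> of_pair -` B" using B(2) by blast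
  qed
  ultimately have "\<phi> ` Z \<in> null_sets lebesgue" using null_sets_completion_iff2[of _ lborel] by blast
  then show ?thesis by (simp add: negligible_iff_null_sets)
qed

text \<open>An open set is a countable union of compact sets, so the image is one too. For general
  Borel sets a continuous image need not be Borel.\<close>

lemma borel_image_open_Int_closed:
  fixes f :: "'a::euclidean_space \<Rightarrow> 'b::euclidean_space"
  assumes "open U" "closed F" "continuous_on U f"
  shows "f ` (U \<inter> F) \<in> sets borel"
proof -
  obtain C where C: "\<And>n::nat. compact (C n)" "\<And>n. C n \<subseteq> U" "\<Union>(range C) = U"
    using open_Union_compact_subsets[OF assms(1)] by metis
  have "f ` (U \<inter> F) = (\<Union>n. f ` (C n \<inter> F))" using C(3) by auto
  moreover have "compact (f ` (C n \<inter> F))" for n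
    using C assms by (intro compact_continuous_image compact_Int_closed continuous_on_subset[OF assms(3)]) auto
  then have "f ` (C n \<inter> F) \<in> sets borel" for n using compact_imp_closed borel_closed by blast
  ultimately show ?thesis by auto
qed

text \<open>The inverse \<open>g\<close> of the derivative at a is Cramer's rule, and continuity of
  the partial derivatives makes the derivative nearly constant, which gives injectivity on a
  ball.\<close>

lemma locally_injective_plane:
  fixes \<phi> A B :: "real \<times> real \<Rightarrow> real \<times> real"
  assumes V: "open V" "a \<in> V"
    and der: "\<And>u. u \<in> V \<Longrightarrow> (\<phi> has_derivative (\<lambda>v. fst v *\<^sub>R A u + snd v *\<^sub>R B u)) (at u)"
    and cont: "continuous_on V A" "continuous_on V B"
    and J: "fst (A a) * snd (B a) - snd (A a) * fst (B a) \<noteq> 0"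
  obtains r where "r > 0" "ball a r \<subseteq> V" "inj_on \<phi> (ball a r)"
proof -
  define j where "j = fst (A a) * snd (B a) - snd (A a) * fst (B a)"
  define g where "g w = ((fst w * snd (B a) - snd w * fst (B a)) / j, (fst (A a) * snd w - snd (A a) * fst w) / j)" for w
  have "bounded_linear g" unfolding linear_conv_bounded_linear[symmetric] g_def
    by (rule linearI) (simp_all add: algebra_simps add_divide_distrib diff_divide_distrib)
  moreover have "g \<circ> (\<lambda>v. fst v *\<^sub>R A a + snd v *\<^sub>R B a) = id"
  proof
    fix v
    have "fst (g (fst v *\<^sub>R A a + snd v *\<^sub>R B a)) = (fst v * j) / j"
      "snd (g (fst v *\<^sub>R A a + snd v *\<^sub>R B a)) = (snd v * j) / j"
      unfolding g_def by (simp_all add: j_def algebra_simps)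
    then show "(g \<circ> (\<lambda>v. fst v *\<^sub>R A a + snd v *\<^sub>R B a)) v = id v"
      using J by (simp add: prod_eq_iff j_def)
  qed
  moreover have "\<exists>d>0. \<forall>x. dist a x < d \<longrightarrow>
      onorm (\<lambda>v. (fst v *\<^sub>R A x + snd v *\<^sub>R B x) - (fst v *\<^sub>R A a + snd v *\<^sub>R B a)) < e" if "e > 0" for e
  proof -
    have "isCont A a" "isCont B a" using cont V by (auto simp: continuous_on_eq_continuous_at)
    moreover have e4: "e / 4 > 0" using that by simp
    ultimately obtain d1 d2 where d: "d1 > 0" "\<And>x. dist x a < d1 \<Longrightarrow> dist (A x) (A a) < e / 4"
        "d2 > 0" "\<And>x. dist x a < d2 \<Longrightarrow> dist (B x) (B a) < e / 4"
      unfolding continuous_at_eps_delta by metis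
    have "onorm (\<lambda>v. (fst v *\<^sub>R A x + snd v *\<^sub>R B x) - (fst v *\<^sub>R A a + snd v *\<^sub>R B a)) \<le> e / 2"
      if "dist a x < min d1 d2" for x
    proof (rule onorm_le)
      fix v :: "real \<times> real"
      have "norm ((fst v *\<^sub>R A x + snd v *\<^sub>R B x) - (fst v *\<^sub>R A a + snd v *\<^sub>R B a)) =
          norm (fst v *\<^sub>R (A x - A a) + snd v *\<^sub>R (B x - B a))" by (simp add: algebra_simps)
      also have "\<dots> \<le> \<bar>fst v\<bar> * norm (A x - A a) + \<bar>snd v\<bar> * norm (B x - B a)"
        by (rule norm_triangle_le) simp
      also have "\<dots> \<le> norm v * (e / 4) + norm v * (e / 4)"
      proof (intro add_mono mult_mono)
        have "dist x a < d1" "dist x a < d2" using that by (simp_all add: dist_commute)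
        then show "norm (A x - A a) \<le> e / 4" "norm (B x - B a) \<le> e / 4"
          using d(2,4) by (simp_all add: dist_norm less_imp_le)
        show "\<bar>fst v\<bar> \<le> norm v" "\<bar>snd v\<bar> \<le> norm v"
          using norm_fst_le[of "fst v" "snd v"] norm_snd_le[of "snd v" "fst v"] by simp_all
      qed auto
      finally show "norm ((fst v *\<^sub>R A x + snd v *\<^sub>R B x) - (fst v *\<^sub>R A a + snd v *\<^sub>R B a)) \<le> e / 2 * norm v"
        by (simp add: algebra_simps)
    qed
    then show ?thesis using d that by (intro exI[of _ "min d1 d2"]) force
  qed
  ultimately show ?thesis
    using has_derivative_locally_injective[OF V(2,1), of g "\<lambda>u v. fst v *\<^sub>R A u + snd v *\<^sub>R B u" \<phi>] der that by blast
qed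

text \<open>
  The sum over \<open>k\<close> counts the preimages of \<open>a\<close> in \<open>V\<close>, since the sets \<open>E k\<close> partition \<open>V\<close>
  and \<open>\<phi>\<close> is injective on each of them.
\<close>

lemma area_formula_plane:
  fixes \<phi> A B :: "real \<times> real \<Rightarrow> real \<times> real"
  assumes V: "open V" "bounded V"
    and der: "\<And>u. u \<in> V \<Longrightarrow> (\<phi> has_derivative (\<lambda>v. fst v *\<^sub>R A u + snd v *\<^sub>R B u)) (at u)"
    and cont: "continuous_on V A" "continuous_on V B"
    and J: "\<And>u. u \<in> V \<Longrightarrow> fst (A u) * snd (B u) - snd (A u) * fst (B u) = J u" "\<And>u. u \<in> V \<Longrightarrow> J u \<noteq> 0"
    and M: "\<And>u. u \<in> V \<Longrightarrow> \<bar>J u\<bar> \<le> M"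
  obtains W E :: "nat \<Rightarrow> (real \<times> real) set" where
    "\<And>k. open (W k)" "(\<Union>k. W k) = V" "\<And>k. inj_on \<phi> (W k)" "\<And>k. E k \<subseteq> W k"
    "disjoint_family E" "(\<Union>k. E k) = V" "\<And>k. \<phi> ` E k \<in> sets borel"
    "\<And>H :: real \<times> real \<Rightarrow> ennreal. H \<in> borel_measurable borel \<Longrightarrow>
       (\<integral>\<^sup>+u. H (\<phi> u) * ennreal (\<bar>J u\<bar> * indicator V u) \<partial>lborel) =
       (\<integral>\<^sup>+a. H a * (\<Sum>k. indicator (\<phi> ` E k) a) \<partial>lborel)"
proof -
  define F where "F = {W. open W \<and> W \<subseteq> V \<and> inj_on \<phi> W}"
  have "\<exists>W\<in>F. a \<in> W" if a: "a \<in> V" for a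
  proof -
    obtain r where "r > 0" "ball a r \<subseteq> V" "inj_on \<phi> (ball a r)"
      using locally_injective_plane[OF V(1) a der cont] J[OF a] by metis
    then show ?thesis by (intro bexI[of _ "ball a r"]) (auto simp: F_def)
  qed
  then have "\<Union>F = V" by (auto simp: F_def)
  moreover obtain F' where F': "F' \<subseteq> F" "countable F'" "\<Union>F' = \<Union>F"
    using Lindelof[of F] by (auto simp: F_def)
  \<comment> \<open>The inserted empty set makes the family nonempty, as the enumeration
    requires.\<close>
  moreover define W where "W = from_nat_into (insert {} F')"
  have rO: "range W = insert {} F'"
    unfolding W_def using F' by (intro range_from_nat_into) auto
  ultimately have UO: "(\<Union>k. W k) = V" by simp
  have W: "open (W k)" "W k \<subseteq> V" "inj_on \<phi> (W k)" for k
  proof -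
    have "W k \<in> insert {} F'" using rO by auto
    then show "open (W k)" "W k \<subseteq> V" "inj_on \<phi> (W k)" using F'(1) by (auto simp: F_def)
  qed
  define E where "E = disjointed W"
  have E1: "disjoint_family E" unfolding E_def by (rule disjoint_family_disjointed)
  have E2: "(\<Union>k. E k) = V" unfolding E_def UN_disjointed_eq by (rule UO)
  have E3: "E k \<subseteq> W k" for k unfolding E_def by (rule disjointed_subset)
  have EV: "E k \<subseteq> V" for k using E2 by auto
  \<comment> \<open>Each piece is an open set intersected with a closed one, so its image under
    \<phi> is Borel.\<close>
  have Eeq: "E k = W k \<inter> - (\<Union>i\<in>{0..<k}. W i)" for k unfolding E_def disjointed_def by auto
  have clo: "closed (- (\<Union>i\<in>{0..<k}. W i))" for k using W by (auto intro: closed_Compl)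
  have Eb [measurable]: "E k \<in> sets borel" for k
    unfolding Eeq using W clo by (intro sets.Int borel_open borel_closed) auto
  have cont\<phi>: "continuous_on V \<phi>"
    using der by (meson has_derivative_continuous continuous_at_imp_continuous_on)
  have im [measurable]: "\<phi> ` E k \<in> sets borel" for k
    unfolding Eeq using W clo by (intro borel_image_open_Int_closed continuous_on_subset[OF cont\<phi>]) auto
  have contJ: "continuous_on V J"
  proof -
    have "continuous_on V (\<lambda>u. fst (A u) * snd (B u) - snd (A u) * fst (B u))"
      using cont by (intro continuous_intros)
    then show ?thesis using J(1) by (simp cong: continuous_on_cong)
  qed
  have JE [measurable]: "(\<lambda>u. \<bar>J u\<bar> * indicator (E k) u) \<in> borel_measurable borel" for k
  proof -
    have "continuous_on (E k) (\<lambda>u. \<bar>J u\<bar>)" using continuous_on_subset[OF contJ EV] by (intro continuous_intros)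
    from borel_measurable_continuous_on_if[OF Eb this continuous_on_const, of 0]
    show ?thesis by (rule measurable_cong[THEN iffD1, rotated]) (auto simp: indicator_def)
  qed
  have fin: "(\<integral>\<^sup>+u. ennreal (\<bar>J u\<bar> * indicator (E k) u) \<partial>lborel) < \<infinity>" for k
  proof -
    have "(\<integral>\<^sup>+u. ennreal (\<bar>J u\<bar> * indicator (E k) u) \<partial>lborel) \<le> (\<integral>\<^sup>+u. ennreal M * indicator (E k) u \<partial>lborel)"
      using M EV[of k] by (intro nn_integral_mono) (auto simp: indicator_def intro!: ennreal_leI)
    also have "\<dots> = ennreal M * emeasure lborel (E k)" by (simp add: nn_integral_cmult_indicator)
    also have "\<dots> < \<infinity>"
      using emeasure_bounded_finite[of "E k"] bounded_subset[OF V(2) EV] by (simp add: ennreal_mult_less_top)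
    finally show ?thesis .
  qed
  have "(\<integral>\<^sup>+u. H (\<phi> u) * ennreal (\<bar>J u\<bar> * indicator V u) \<partial>lborel) =
       (\<integral>\<^sup>+a. H a * (\<Sum>k. indicator (\<phi> ` E k) a) \<partial>lborel)"
    if H [measurable]: "H \<in> borel_measurable borel" for H :: "real \<times> real \<Rightarrow> ennreal"
  proof -
    define \<psi> where "\<psi> u = (if u \<in> V then \<phi> u else 0)" for u
    have [measurable]: "\<psi> \<in> borel_measurable borel"
      unfolding \<psi>_def using V(1) by (intro borel_measurable_continuous_on_if cont\<phi> continuous_on_const) auto
    have "(\<integral>\<^sup>+u. H (\<phi> u) * ennreal (\<bar>J u\<bar> * indicator V u) \<partial>lborel) =
       (\<integral>\<^sup>+u. (\<Sum>k. H (\<psi> u) * ennreal (\<bar>J u\<bar> * indicator (E k) u)) \<partial>lborel)"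
    proof (intro nn_integral_cong)
      fix u
      have "ennreal (\<bar>J u\<bar> * indicator (E k) u) = ennreal \<bar>J u\<bar> * indicator (E k) u" for k
        by (auto simp: indicator_def)
      then have "(\<Sum>k. H (\<psi> u) * ennreal (\<bar>J u\<bar> * indicator (E k) u)) =
          H (\<psi> u) * (ennreal \<bar>J u\<bar> * (\<Sum>k. indicator (E k) u))"
        by simp
      also have "(\<Sum>k. indicator (E k) u :: ennreal) = indicator V u"
        using suminf_indicator[OF E1, of u] E2 by simp
      finally show "H (\<phi> u) * ennreal (\<bar>J u\<bar> * indicator V u) = (\<Sum>k. H (\<psi> u) * ennreal (\<bar>J u\<bar> * indicator (E k) u))"
        by (auto simp: indicator_def \<psi>_def)
    qed
    also have "\<dots> = (\<Sum>k. \<integral>\<^sup>+u. H (\<psi> u) * ennreal (\<bar>J u\<bar> * indicator (E k) u) \<partial>lborel)"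
      by (rule nn_integral_suminf) measurable
    also have "\<dots> = (\<Sum>k. \<integral>\<^sup>+a. H a * indicator (\<phi> ` E k) a \<partial>lborel)"
    proof (rule suminf_cong)
      fix k
      have "(\<integral>\<^sup>+u. H (\<psi> u) * ennreal (\<bar>J u\<bar> * indicator (E k) u) \<partial>lborel) =
          (\<integral>\<^sup>+u. H (\<phi> u) * ennreal (\<bar>J u\<bar> * indicator (E k) u) \<partial>lborel)"
        using EV[of k] by (intro nn_integral_cong) (auto simp: indicator_def \<psi>_def)
      also have "\<dots> = (\<integral>\<^sup>+a. H a * indicator (\<phi> ` E k) a \<partial>lborel)"
      proof (rule nn_integral_injective_image[OF Eb im _ _ _ JE fin H])
        fix u assume "u \<in> E k"
        then have u: "u \<in> V" using EV by auto
        show "(\<phi> has_derivative (\<lambda>v. fst v *\<^sub>R A u + snd v *\<^sub>R B u)) (at u within E k)"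
          using der[OF u] by (rule has_derivative_at_withinI)
        show "J u = jac2 (\<lambda>v. fst v *\<^sub>R A u + snd v *\<^sub>R B u)" using J(1)[OF u] by (simp add: jac2_def)
      qed (use W(3) E3 inj_on_subset in blast)
      finally show "(\<integral>\<^sup>+u. H (\<psi> u) * ennreal (\<bar>J u\<bar> * indicator (E k) u) \<partial>lborel) =
          (\<integral>\<^sup>+a. H a * indicator (\<phi> ` E k) a \<partial>lborel)" .
    qed
    also have "\<dots> = (\<integral>\<^sup>+a. (\<Sum>k. H a * indicator (\<phi> ` E k) a) \<partial>lborel)"
      by (rule nn_integral_suminf[symmetric]) measurable
    also have "\<dots> = (\<integral>\<^sup>+a. H a * (\<Sum>k. indicator (\<phi> ` E k) a) \<partial>lborel)"
      by simp
    finally show ?thesis .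
  qed
  then show ?thesis using that[of W E] W UO E1 E2 E3 im by blast
qed

text \<open>Every preimage of a lies in exactly one piece, and a piece contains at most one of them.
  So the indicator of the image of a piece counts the preimages in it, and the two sums can be
  interchanged.\<close>

lemma suminf_indicator_image_eq_card:
  assumes E: "disjoint_family E" "(\<Union>k. E k) = V" "\<And>k. inj_on \<phi> (E k)"
    and Q: "finite Q" "Q = {u \<in> V. \<phi> u = a}"
  shows "(\<Sum>k. indicator (\<phi> ` E k) a) = (of_nat (card Q) :: ennreal)"
proof -
  have "indicator (\<phi> ` E k) a = (\<Sum>u\<in>Q. indicator (E k) u :: ennreal)" for k
  proof (cases "a \<in> \<phi> ` E k")
    case True
    then obtain u where u: "u \<in> E k" "\<phi> u = a" by auto
    then have "u \<in> Q" using E(2) Q by auto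
    have "indicator (E k) v = (if v = u then 1 else 0 :: ennreal)" if "v \<in> Q" for v
    proof -
      have "\<phi> v = \<phi> u" using that u(2) Q(2) by simp
      then have "v \<in> E k \<longleftrightarrow> v = u" using inj_onD[OF E(3) _ _ u(1), of v] u(1) by blast
      then show ?thesis by (simp add: indicator_def)
    qed
    then have "(\<Sum>v\<in>Q. indicator (E k) v) = (\<Sum>v\<in>Q. if v = u then 1 else 0 :: ennreal)" by (intro sum.cong) auto
    then show ?thesis using True \<open>u \<in> Q\<close> Q(1) by simp
  next
    case False
    then have "(\<Sum>u\<in>Q. indicator (E k) u :: ennreal) = 0"
      using Q by (intro sum.neutral) (auto simp: indicator_def)
    then show ?thesis using False by simp
  qed
  then have "(\<Sum>k. indicator (\<phi> ` E k) a) = (\<Sum>k. \<Sum>u\<in>Q. indicator (E k) u :: ennreal)" by simp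
  also have "\<dots> = (\<Sum>u\<in>Q. \<Sum>k. indicator (E k) u)" by (rule suminf_sum) auto
  also have "\<dots> = (\<Sum>u\<in>Q. 1)"
    using E Q by (intro sum.cong) (auto simp: suminf_indicator)
  finally show ?thesis by simp
qed

section \<open>The surface measure\<close>

text \<open>Points with at least m preimages, phrased through finite subsets because
  \<open>card\<close> is 0 for infinite fibres.\<close>

definition fibre_ge :: "('a::euclidean_space \<Rightarrow> 'b::euclidean_space) \<Rightarrow> 'a set \<Rightarrow> nat \<Rightarrow> 'b set" where
  "fibre_ge P R m = {y. \<exists>Q\<subseteq>{v\<in>R. P v = y}. finite Q \<and> card Q = m}"

text \<open>A finite set has a positive minimal distance, and basis sets inside balls of radius less
  than half of it have disjoint closures. Closures keep compactness after intersecting with a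
  compact domain.\<close>

lemma separating_closures:
  fixes Q :: "'a::euclidean_space set"
  assumes B: "topological_basis B" and Q: "finite Q"
  obtains K where "\<And>q. q \<in> Q \<Longrightarrow> K q \<in> closure ` B" "\<And>q. q \<in> Q \<Longrightarrow> q \<in> K q"
    "\<And>q q'. q \<in> Q \<Longrightarrow> q' \<in> Q \<Longrightarrow> q \<noteq> q' \<Longrightarrow> K q \<inter> K q' = {}"
proof -
  have "\<exists>e>0. \<forall>q\<in>Q. \<forall>q'\<in>Q. q \<noteq> q' \<longrightarrow> 2 * e < dist q q'"
  proof -
    let ?D = "(\<lambda>(q, q'). dist q q') ` {(q, q') \<in> Q \<times> Q. q \<noteq> q'}"
    have "finite {(q, q') \<in> Q \<times> Q. q \<noteq> q'}" by (rule finite_subset[of _ "Q \<times> Q"]) (use Q in auto)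
    then have fin: "finite (insert 1 ?D)" by simp
    \<comment> \<open>The inserted 1 keeps the minimum meaningful when Q has at most one
      point.\<close>
    define m where "m = Min (insert 1 ?D)"
    have "m > 0" unfolding m_def using fin by (subst Min_gr_iff) auto
    moreover have "2 * (m / 3) < dist q q'" if "q \<in> Q" "q' \<in> Q" "q \<noteq> q'" for q q'
    proof -
      have "dist q q' \<in> insert 1 ?D" using that by (intro insertI2 rev_image_eqI[of "(q, q')"]) auto
      then have "m \<le> dist q q'" unfolding m_def using fin by (intro Min_le)
      then show ?thesis using \<open>m > 0\<close> by linarith
    qed
    ultimately show ?thesis by (intro exI[of _ "m / 3"]) auto
  qed
  then obtain e where e: "e > 0" "\<And>q q'. q \<in> Q \<Longrightarrow> q' \<in> Q \<Longrightarrow> q \<noteq> q' \<Longrightarrow> 2 * e < dist q q'" by blast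
  have "\<exists>C\<in>B. q \<in> C \<and> C \<subseteq> ball q e" for q
  proof -
    obtain C where "C \<in> B" "q \<in> C" "C \<subseteq> ball q e"
      by (rule topological_basisE[OF B open_ball[of q e], of q]) (simp_all add: e(1))
    then show ?thesis by blast
  qed
  then obtain C where C: "\<And>q. C q \<in> B" "\<And>q. q \<in> C q" "\<And>q. C q \<subseteq> ball q e" by metis
  have cl: "closure (C q) \<subseteq> cball q e" for q
    using closure_mono[OF C(3)[of q]] e(1) by simp
  show ?thesis
  proof (rule that[of "\<lambda>q. closure (C q)"])
    fix q q' assume "q \<in> Q" "q' \<in> Q" "q \<noteq> q'"
    then have "2 * e < dist q q'" by (rule e)
    have "False" if "x \<in> cball q e" "x \<in> cball q' e" for x
    proof -
      have "dist q x \<le> e" "dist q' x \<le> e" using that by simp_all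
      then show False using \<open>2 * e < dist q q'\<close> dist_triangle2[of q q' x] by linarith
    qed
    then show "closure (C q) \<inter> closure (C q') = {}" using cl by blast
  qed (use C closure_subset in blast)+
qed

text \<open>A point has at least \<open>m\<close> preimages iff it lies in the images of \<open>m\<close> pairwise disjoint
  members of a countable family of compact sets.\<close>

lemma fibre_ge_borel:
  fixes P :: "'a::euclidean_space \<Rightarrow> 'b::euclidean_space"
  assumes R: "compact R" and P: "continuous_on R P"
  shows "fibre_ge P R m \<in> sets borel"
proof -
  obtain B :: "'a set set" where B: "countable B" "topological_basis B" using ex_countable_basis by auto
  let ?C = "closure ` B"
  define \<F> where "\<F> = {F. F \<subseteq> ?C \<and> finite F \<and> card F = m \<and> (\<forall>K\<in>F. \<forall>K'\<in>F. K \<noteq> K' \<longrightarrow> K \<inter> K' = {})}"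
  have "\<F> \<subseteq> {F. F \<subseteq> ?C \<and> finite F}" by (auto simp: \<F>_def)
  moreover have "countable {F. F \<subseteq> ?C \<and> finite F}"
    using countable_Collect_finite_subset[of ?C] B by (auto simp: conj_commute)
  ultimately have cF: "countable \<F>" by (rule countable_subset)
  have "fibre_ge P R m = (\<Union>F\<in>\<F>. (\<Inter>K\<in>F. P ` (R \<inter> K)))"
  proof (intro set_eqI iffI)
    fix y assume "y \<in> fibre_ge P R m"
    then obtain Q where Q: "Q \<subseteq> {v\<in>R. P v = y}" "finite Q" "card Q = m" by (auto simp: fibre_ge_def)
    obtain K where K: "\<And>q. q \<in> Q \<Longrightarrow> K q \<in> ?C" "\<And>q. q \<in> Q \<Longrightarrow> q \<in> K q"
      "\<And>q q'. q \<in> Q \<Longrightarrow> q' \<in> Q \<Longrightarrow> q \<noteq> q' \<Longrightarrow> K q \<inter> K q' = {}"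
      using separating_closures[OF B(2) Q(2)] by metis
    have "inj_on K Q" using K(2,3) by (intro inj_onI) blast
    moreover have "A \<inter> A' = {}" if "A \<in> K ` Q" "A' \<in> K ` Q" "A \<noteq> A'" for A A'
      using that K(3) by blast
    ultimately have "K ` Q \<in> \<F>" unfolding \<F>_def using K(1) Q by (simp add: card_image image_subset_iff)
    moreover have "y \<in> (\<Inter>K\<in>K ` Q. P ` (R \<inter> K))"
      using K(2) Q(1) by (auto intro!: image_eqI)
    ultimately show "y \<in> (\<Union>F\<in>\<F>. (\<Inter>K\<in>F. P ` (R \<inter> K)))" by (rule UN_I)
  next
    fix y assume "y \<in> (\<Union>F\<in>\<F>. (\<Inter>K\<in>F. P ` (R \<inter> K)))"
    then obtain F where F: "F \<in> \<F>" "\<And>K. K \<in> F \<Longrightarrow> y \<in> P ` (R \<inter> K)" by auto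
    then have "\<forall>K\<in>F. \<exists>v. v \<in> R \<inter> K \<and> P v = y" by auto
    then obtain v where v: "\<And>K. K \<in> F \<Longrightarrow> v K \<in> R \<inter> K \<and> P (v K) = y" by metis
    have "inj_on v F"
    proof (rule inj_onI, rule ccontr)
      fix K K' assume K: "K \<in> F" "K' \<in> F" "v K = v K'" "K \<noteq> K'"
      then have "v K \<in> K \<inter> K'" using v[OF K(1)] v[OF K(2)] by auto
      then show False using F(1) K by (auto simp: \<F>_def)
    qed
    then show "y \<in> fibre_ge P R m"
      unfolding fibre_ge_def using F(1) v by (auto simp: \<F>_def card_image intro!: exI[of _ "v ` F"])
  qed
  also have "\<dots> \<in> sets borel"
  proof (rule sets.countable_UN'[OF cF], rule image_subsetI)
    fix F assume F: "F \<in> \<F>"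
    have "closed (P ` (R \<inter> K))" if "K \<in> F" for K
    proof -
      have "closed K" using F that by (auto simp: \<F>_def)
      then show ?thesis
        using R by (intro compact_imp_closed compact_continuous_image continuous_on_subset[OF P])
          (auto intro: compact_Int_closed)
    qed
    then show "(\<Inter>K\<in>F. P ` (R \<inter> K)) \<in> sets borel" by (intro borel_closed closed_INT) auto
  qed
  finally show ?thesis .
qed

text \<open>For k > 0, cardinality k means at least k but not at least k + 1 preimages. Cardinality
  0 covers empty as well as infinite fibres and is obtained as the complement of all positive
  values.\<close>

lemma card_fibre_measurable:
  fixes P :: "'a::euclidean_space \<Rightarrow> 'b::euclidean_space"
  assumes R: "compact R" and P: "continuous_on R P"
  shows "(\<lambda>y. card {v\<in>R. P v = y}) \<in> measurable borel (count_space UNIV)"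
proof -
  note [measurable] = fibre_ge_borel[OF assms]
  have eq: "(card {v\<in>R. P v = y} = k) \<longleftrightarrow> y \<in> fibre_ge P R k - fibre_ge P R (Suc k)" if k: "k > 0" for y k
  proof
    assume c: "card {v\<in>R. P v = y} = k"
    then have fin: "finite {v\<in>R. P v = y}" using k card_gt_0_iff by blast
    then have "y \<in> fibre_ge P R k" using c unfolding fibre_ge_def by blast
    moreover have "y \<notin> fibre_ge P R (Suc k)"
    proof
      assume "y \<in> fibre_ge P R (Suc k)"
      then obtain Q where "Q \<subseteq> {v\<in>R. P v = y}" "card Q = Suc k" by (auto simp: fibre_ge_def)
      then show False using card_mono[OF fin, of Q] c by simp
    qed
    ultimately show "y \<in> fibre_ge P R k - fibre_ge P R (Suc k)" by simp
  next
    assume y: "y \<in> fibre_ge P R k - fibre_ge P R (Suc k)"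
    then obtain Q where Q: "Q \<subseteq> {v\<in>R. P v = y}" "finite Q" "card Q = k" by (auto simp: fibre_ge_def)
    have "Q = {v\<in>R. P v = y}"
    proof (rule ccontr)
      assume "Q \<noteq> {v\<in>R. P v = y}"
      then obtain v where v: "v \<in> R" "P v = y" "v \<notin> Q" using Q(1) by blast
      then have "insert v Q \<subseteq> {v\<in>R. P v = y}" "finite (insert v Q)" "card (insert v Q) = Suc k"
        using Q by auto
      then have "y \<in> fibre_ge P R (Suc k)" unfolding fibre_ge_def by blast
      with y show False by simp
    qed
    then show "card {v\<in>R. P v = y} = k" using Q by simp
  qed
  have set: "{y. card {v\<in>R. P v = y} = k} \<in> sets borel" if "k > 0" for k
  proof -
    have "{y. card {v\<in>R. P v = y} = k} = fibre_ge P R k - fibre_ge P R (Suc k)" using eq[OF that] by auto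
    then show ?thesis by simp
  qed
  show ?thesis
  proof (rule measurable_count_space_eq2_countable[THEN iffD2], intro conjI ballI)
    fix k
    show "(\<lambda>y. card {v\<in>R. P v = y}) -` {k} \<inter> space borel \<in> sets borel"
    proof (cases "k > 0")
      case True
      then show ?thesis using set[OF True] by (simp add: vimage_def)
    next
      case False
      have "f -` {0} = - (\<Union>j. f -` {Suc j})" for f :: "'b \<Rightarrow> nat"
        using not0_implies_Suc by auto
      from this[of "\<lambda>y. card {v\<in>R. P v = y}"]
      have "(\<lambda>y. card {v\<in>R. P v = y}) -` {k} = - (\<Union>j. {y. card {v\<in>R. P v = y} = Suc j})"
        using False by (simp only: vimage_def singleton_iff neq0_conv not_gr_zero)
      moreover have "(\<Union>j. {y. card {v\<in>R. P v = y} = Suc j}) \<in> sets borel" using set by (intro sets.countable_UN) auto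
      ultimately show ?thesis by (simp only: space_borel Int_UNIV_right borel_comp)
    qed
  qed auto
qed

section \<open>Surface area as a measure on space\<close>

locale parametrized =
  fixes P :: "real \<times> real \<Rightarrow> real^3" and s1 s2 t1 t2 :: real
  assumes s: "s1 < s2" and t: "t1 < t2" and C1: "C1_parametrization P s1 s2 t1 t2"
begin

definition R :: "(real \<times> real) set" where "R = {s1..s2} \<times> {t1..t2}"

abbreviation "Ps \<equiv> partial_s P s1 s2"
abbreviation "Pt \<equiv> partial_t P t1 t2"

lemma R_compact: "compact R" by (simp add: R_def compact_Times)
lemma R_borel [measurable]: "R \<in> sets borel" using R_compact borel_compact by blast

lemma Ps_has: "(\<sigma>, \<tau>) \<in> R \<Longrightarrow> ((\<lambda>\<sigma>. P (\<sigma>, \<tau>)) has_vector_derivative Ps (\<sigma>, \<tau>)) (at \<sigma> within {s1..s2})"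
  using C1 by (simp add: C1_parametrization_def partial_s_def R_def vector_derivative_works[symmetric])

lemma Pt_has: "(\<sigma>, \<tau>) \<in> R \<Longrightarrow> ((\<lambda>\<tau>. P (\<sigma>, \<tau>)) has_vector_derivative Pt (\<sigma>, \<tau>)) (at \<tau> within {t1..t2})"
  using C1 by (simp add: C1_parametrization_def partial_t_def R_def vector_derivative_works[symmetric])

lemma Ps_cont: "continuous_on R Ps" and Pt_cont: "continuous_on R Pt"
  using C1 by (simp_all add: C1_parametrization_def R_def)

text \<open>Continuous partial derivatives give a total derivative, also relative to the closed
  rectangle at its edges.\<close>

lemma P_has_derivative:
  assumes u: "u \<in> R"
  shows "(P has_derivative (\<lambda>v. fst v *\<^sub>R Ps u + snd v *\<^sub>R Pt u)) (at u within R)"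
proof -
  obtain \<sigma> \<tau> where u': "u = (\<sigma>, \<tau>)" by (cases u)
  have "((\<lambda>(x, y). P (x, y)) has_derivative
      (\<lambda>(tx, ty). tx *\<^sub>R Ps (\<sigma>, \<tau>) + blinfun_scaleR_left (Pt (\<sigma>, \<tau>)) ty)) (at (\<sigma>, \<tau>) within {s1..s2} \<times> {t1..t2})"
  proof (rule has_derivative_partialsI[where fx = "\<lambda>tx. tx *\<^sub>R Ps (\<sigma>, \<tau>)" and fy = "\<lambda>x y. blinfun_scaleR_left (Pt (x, y))"])
    show "((\<lambda>x. P (x, \<tau>)) has_derivative (\<lambda>tx. tx *\<^sub>R Ps (\<sigma>, \<tau>))) (at \<sigma> within {s1..s2})"
      using Ps_has[of \<sigma> \<tau>] u u' by (simp add: has_vector_derivative_def)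
    show "((\<lambda>y. P (x, y)) has_derivative blinfun_apply (blinfun_scaleR_left (Pt (x, y)))) (at y within {t1..t2})"
      if "x \<in> {s1..s2}" "y \<in> {t1..t2}" for x y
      using Pt_has[of x y] that by (simp add: has_vector_derivative_def R_def)
    have "continuous (at (\<sigma>, \<tau>) within R) (\<lambda>u. blinfun_scaleR_left (Pt u))"
      using Pt_cont u u' unfolding continuous_on_eq_continuous_within
      by (intro bounded_linear.continuous[OF bounded_linear_blinfun_scaleR_left]) auto
    then show "continuous (at (\<sigma>, \<tau>) within {s1..s2} \<times> {t1..t2}) (\<lambda>(x, y). blinfun_scaleR_left (Pt (x, y)))"
      by (simp add: R_def case_prod_beta')
  qed (use u u' in \<open>auto simp: R_def\<close>)
  then show ?thesis by (simp add: u' R_def case_prod_beta')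
qed

lemma P_cont: "continuous_on R P"
  using P_has_derivative has_derivative_continuous continuous_on_eq_continuous_within by blast

definition mult :: "real^3 \<Rightarrow> nat" where "mult y = card {v\<in>R. P v = y}"

lemma mult_measurable [measurable]: "(\<lambda>y. real (mult y)) \<in> borel_measurable borel"
  unfolding mult_def
  by (rule measurable_compose[OF card_fibre_measurable[OF R_compact P_cont]]) simp

definition P0 :: "real \<times> real \<Rightarrow> real^3" where "P0 u = (if u \<in> R then P u else 0)"

lemma P0_measurable [measurable]: "P0 \<in> borel_measurable borel"
  unfolding P0_def by (intro borel_measurable_continuous_on_if R_borel P_cont continuous_on_const)

definition jac :: "real \<times> real \<Rightarrow> real" where
  "jac u = (if u \<in> R then norm (cross3 (Ps u) (Pt u)) else 0)"

lemma cross_cont: "continuous_on R (\<lambda>u. cross3 (Ps u) (Pt u))"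
  by (intro continuous_on_cross Ps_cont Pt_cont)

lemma jac_measurable [measurable]: "jac \<in> borel_measurable borel"
  unfolding jac_def by (intro borel_measurable_continuous_on_if R_borel continuous_on_norm cross_cont continuous_on_const)

lemma jac_bounded: obtains M where "M \<ge> 0" "\<And>u. jac u \<le> M" "\<And>u. jac u \<ge> 0"
proof -
  have "bounded ((\<lambda>u. cross3 (Ps u) (Pt u)) ` R)"
    by (intro compact_imp_bounded compact_continuous_image cross_cont R_compact)
  then obtain M where "\<And>u. u \<in> R \<Longrightarrow> norm (cross3 (Ps u) (Pt u)) \<le> M" by (auto simp: bounded_iff)
  then show ?thesis by (intro that[of "max M 0"]) (auto simp: jac_def intro: max.coboundedI1)
qed

definition weight :: "real \<times> real \<Rightarrow> real" where "weight u = jac u / real (mult (P0 u))"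

lemma weight_eq: "u \<in> R \<Longrightarrow> weight u = area_weight P s1 s2 t1 t2 u"
  by (simp add: weight_def area_weight_def jac_def P0_def mult_def R_def)

lemma weight_measurable [measurable]: "weight \<in> borel_measurable borel"
  unfolding weight_def by measurable

lemma weight_nonneg: "weight u \<ge> 0"
  by (simp add: weight_def jac_def)

lemma weight_0: "u \<notin> R \<Longrightarrow> weight u = 0"
  by (simp add: weight_def jac_def)

text \<open>Surface area transported to space, so that integrals of functions of the surface point
  no longer mention parameters.\<close>

definition area :: "(real^3) measure" where
  "area = distr (density lborel (\<lambda>u. ennreal (weight u))) borel P0"

lemma sets_area [simp, measurable_cong]: "sets area = sets borel" and space_area [simp]: "space area = UNIV"
  by (simp_all add: area_def)

lemma nn_integral_area:
  assumes [measurable]: "k \<in> borel_measurable borel"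
  shows "(\<integral>\<^sup>+q. k q \<partial>area) = (\<integral>\<^sup>+u. ennreal (weight u) * k (P0 u) \<partial>lborel)"
  unfolding area_def by (subst nn_integral_distr, simp, simp, subst nn_integral_density) auto

lemma finite_measure_area: "finite_measure area"
proof
  obtain M where M: "M \<ge> 0" "\<And>u. jac u \<le> M" "\<And>u. jac u \<ge> 0" using jac_bounded by metis
  have "weight u \<le> M * indicator R u" for u
  proof (cases "u \<in> R")
    case True
    \<comment> \<open>Division by a multiplicity of at least 1 does not increase, and multiplicity 0
      gives weight 0.\<close>
    have "weight u \<le> jac u \<or> weight u = 0"
    proof (cases "mult (P0 u) = 0")
      case False
      then have "jac u * 1 \<le> jac u * real (mult (P0 u))" using M(3)[of u] by (intro mult_left_mono) auto
      then show ?thesis using False by (simp add: weight_def divide_le_eq)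
    qed (simp add: weight_def)
    then show ?thesis using True M(1) M(2)[of u] by auto
  qed (simp add: weight_0)
  then have "ennreal (weight u) \<le> ennreal (M * indicator R u)" for u
    by (rule ennreal_leI)
  then have "ennreal (weight u) \<le> ennreal M * indicator R u" for u
    by (metis ennreal_indicator ennreal_mult' M(1) indicator_pos_le)
  then have "(\<integral>\<^sup>+u. ennreal (weight u) \<partial>lborel) \<le> (\<integral>\<^sup>+u. ennreal M * indicator R u \<partial>lborel)"
    by (intro nn_integral_mono)
  moreover have "(\<integral>\<^sup>+q. 1 \<partial>area) = (\<integral>\<^sup>+u. ennreal (weight u) \<partial>lborel)"
    by (subst nn_integral_area) simp_all
  ultimately have "(\<integral>\<^sup>+q. 1 \<partial>area) \<le> (\<integral>\<^sup>+u. ennreal M * indicator R u \<partial>lborel)" by simp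
  also have "\<dots> = ennreal M * emeasure lborel R" by (simp add: nn_integral_cmult_indicator)
  also have "\<dots> < \<infinity>"
    using emeasure_bounded_finite[of R] compact_imp_bounded[OF R_compact] by (simp add: ennreal_mult_less_top)
  finally show "emeasure area (space area) \<noteq> \<infinity>" by (simp add: nn_integral_const)
qed

lemma AE_area: "AE q in area. q \<in> P ` R"
proof -
  have c: "P ` R \<in> sets borel" using compact_continuous_image[OF P_cont R_compact] borel_compact by blast
  show ?thesis
    unfolding area_def using c
    by (subst AE_distr_iff) (auto simp: AE_density weight_0 P0_def intro!: AE_I2 intro: ccontr)
qed

text \<open>Only the values of k on the surface matter, and only the restricted function is assumed
  measurable. Since it is Borel, integrating with respect to \<open>lborel\<close> or its completion
  is the same.\<close>

lemma surface_integral_area: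
  assumes [measurable]: "(\<lambda>q. if q \<in> P ` R then k q else 0) \<in> borel_measurable borel"
  shows "surface_integrable P s1 s2 t1 t2 (\<lambda>u. k (P u)) \<longleftrightarrow> integrable area (\<lambda>q. if q \<in> P ` R then k q else 0)"
    and "surface_integral P s1 s2 t1 t2 (\<lambda>u. k (P u)) = (\<integral>q. (if q \<in> P ` R then k q else 0) \<partial>area)"
proof -
  let ?k = "\<lambda>q. if q \<in> P ` R then k q else 0"
  have eq: "(\<lambda>u. indicator R u *\<^sub>R (k (P u) * area_weight P s1 s2 t1 t2 u)) = (\<lambda>u. weight u *\<^sub>R ?k (P0 u))"
    by (auto simp: fun_eq_iff indicator_def weight_eq weight_0 P0_def)
  show "surface_integrable P s1 s2 t1 t2 (\<lambda>u. k (P u)) \<longleftrightarrow> integrable area ?k"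
    unfolding surface_integrable_def set_integrable_def R_def[symmetric] eq area_def
    by (subst integrable_completion, simp, subst integrable_distr_eq, simp, simp, subst integrable_density)
       (auto simp: weight_nonneg)
  show "surface_integral P s1 s2 t1 t2 (\<lambda>u. k (P u)) = (\<integral>q. ?k q \<partial>area)"
    unfolding surface_integral_def set_lebesgue_integral_def R_def[symmetric] eq area_def
    by (subst integral_completion, simp, subst integral_distr, simp, simp, subst integral_density)
       (auto simp: weight_nonneg)
qed

end

text \<open>The direction of the chord tends to that of v up to sign, so the normal condition forces
  |m . v| / |v| = 0. Absolute values absorb the sign of \<sigma> - a.\<close>

lemma unit_normal_orthogonal_tangent:
  fixes \<psi> :: "real \<Rightarrow> real^3"
  assumes nrm: "unit_normal_at S (\<psi> a) m"
    and der: "(\<psi> has_vector_derivative v) (at a within I)"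
    and ev: "\<forall>\<^sub>F \<sigma> in at a within I. \<psi> \<sigma> \<in> S" and nt: "at a within I \<noteq> bot"
  shows "m \<bullet> v = 0"
proof (rule ccontr)
  assume neq: "m \<bullet> v \<noteq> 0"
  then have v: "v \<noteq> 0" by auto
  have lim: "((\<lambda>\<sigma>. (\<psi> \<sigma> - \<psi> a) /\<^sub>R (\<sigma> - a)) \<longlongrightarrow> v) (at a within I)"
  proof (rule LIM_zero_cancel, rule tendsto_norm_zero_cancel, rule Lim_transform_eventually)
    show "((\<lambda>\<sigma>. norm ((1 / norm (\<sigma> - a)) *\<^sub>R (\<psi> \<sigma> - (\<psi> a + (\<sigma> - a) *\<^sub>R v)))) \<longlongrightarrow> 0) (at a within I)"
      using der unfolding has_vector_derivative_def has_derivative_within by (intro tendsto_norm_zero) simp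
    show "\<forall>\<^sub>F \<sigma> in at a within I. norm ((1 / norm (\<sigma> - a)) *\<^sub>R (\<psi> \<sigma> - (\<psi> a + (\<sigma> - a) *\<^sub>R v))) =
        norm ((\<psi> \<sigma> - \<psi> a) /\<^sub>R (\<sigma> - a) - v)"
      using eventually_neq_at_within[of a a I]
    proof eventually_elim
      case (elim \<sigma>)
      have "(\<psi> \<sigma> - \<psi> a) /\<^sub>R (\<sigma> - a) - v = inverse (\<sigma> - a) *\<^sub>R (\<psi> \<sigma> - (\<psi> a + (\<sigma> - a) *\<^sub>R v))"
        using elim by (simp add: diff_diff_eq[symmetric] scaleR_diff_right[of _ _ "(\<sigma> - a) *\<^sub>R v"])
      then show ?case by (simp add: divide_inverse)
    qed
  qed
  \<comment> \<open>The limit in \<open>unit_normal_at\<close> ignores the base point itself, so the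
    curve must leave it; it does because v \<noteq> 0.\<close>
  have ne: "\<forall>\<^sub>F \<sigma> in at a within I. \<psi> \<sigma> \<noteq> \<psi> a"
    using tendsto_imp_eventually_ne[OF lim v] by eventually_elim auto
  have cont: "(\<psi> \<longlongrightarrow> \<psi> a) (at a within I)"
    using der has_vector_derivative_continuous continuous_within by blast
  have "filterlim \<psi> (at (\<psi> a) within S) (at a within I)"
    unfolding filterlim_at using cont ne ev by (auto elim: eventually_elim2)
  then have l1: "((\<lambda>\<sigma>. (m \<bullet> (\<psi> \<sigma> - \<psi> a)) / norm (\<psi> \<sigma> - \<psi> a)) \<longlongrightarrow> 0) (at a within I)"
    using nrm filterlim_compose unfolding unit_normal_at_def by blast
  have "((\<lambda>\<sigma>. \<bar>m \<bullet> ((\<psi> \<sigma> - \<psi> a) /\<^sub>R (\<sigma> - a))\<bar> / norm ((\<psi> \<sigma> - \<psi> a) /\<^sub>R (\<sigma> - a))) \<longlongrightarrow> \<bar>m \<bullet> v\<bar> / norm v) (at a within I)"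
    using v by (intro tendsto_intros lim) auto
  moreover have "\<forall>\<^sub>F \<sigma> in at a within I. \<bar>m \<bullet> ((\<psi> \<sigma> - \<psi> a) /\<^sub>R (\<sigma> - a))\<bar> / norm ((\<psi> \<sigma> - \<psi> a) /\<^sub>R (\<sigma> - a))
      = \<bar>(m \<bullet> (\<psi> \<sigma> - \<psi> a)) / norm (\<psi> \<sigma> - \<psi> a)\<bar>"
    using eventually_neq_at_within[of a a I]
    by eventually_elim (simp add: abs_mult abs_divide)
  ultimately have "((\<lambda>\<sigma>. \<bar>(m \<bullet> (\<psi> \<sigma> - \<psi> a)) / norm (\<psi> \<sigma> - \<psi> a)\<bar>) \<longlongrightarrow> \<bar>m \<bullet> v\<bar> / norm v) (at a within I)"
    by (rule Lim_transform_eventually)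
  moreover have "((\<lambda>\<sigma>. \<bar>(m \<bullet> (\<psi> \<sigma> - \<psi> a)) / norm (\<psi> \<sigma> - \<psi> a)\<bar>) \<longlongrightarrow> \<bar>0\<bar>) (at a within I)"
    by (intro tendsto_rabs l1)
  ultimately have "\<bar>m \<bullet> v\<bar> / norm v = \<bar>0\<bar>" using tendsto_unique[OF nt] by blast
  then show False using neq v by simp
qed

text \<open>Since m is orthogonal to x and y, their cross product is a multiple of m.\<close>

lemma inner_cross3_of_orthogonal:
  fixes m n x y :: "real^3"
  assumes "norm m = 1" "m \<bullet> x = 0" "m \<bullet> y = 0" "m \<bullet> n \<ge> 0"
  shows "\<bar>n \<bullet> cross3 x y\<bar> = (m \<bullet> n) * norm (cross3 x y)"
proof -
  let ?w = "cross3 x y"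
  have "cross3 m ?w = 0" using assms by (simp add: Lagrange)
  then have "0 = (m \<bullet> ?w) *\<^sub>R m - (m \<bullet> m) *\<^sub>R ?w" using Lagrange[of m m ?w] by simp
  then have w: "?w = (m \<bullet> ?w) *\<^sub>R m" using assms(1) by (simp add: norm_eq_1)
  have "n \<bullet> ?w = (m \<bullet> ?w) * (m \<bullet> n)" by (subst w) (simp add: inner_commute)
  moreover have "norm ?w = \<bar>m \<bullet> ?w\<bar>" by (subst w) (simp add: assms(1))
  ultimately show ?thesis using assms(4) by (simp add: abs_mult)
qed

context parametrized
begin

text \<open>Both partial derivatives are tangent to the surface, also as one-sided derivatives on
  the edges of the rectangle. The factor m . n relates the area element to that of the plane
  orthogonal to n.\<close>

lemma cross_parallel_normal:
  assumes u: "u \<in> R" and S: "\<And>v. v \<in> R \<Longrightarrow> P v \<in> C \<Longrightarrow> P v \<in> S" "open C" "P u \<in> C"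
    and nrm: "unit_normal_at S (P u) m" and n: "m \<bullet> n \<ge> 0"
  shows "\<bar>n \<bullet> cross3 (Ps u) (Pt u)\<bar> = (m \<bullet> n) * norm (cross3 (Ps u) (Pt u))"
proof -
  obtain \<sigma> \<tau> where u': "u = (\<sigma>, \<tau>)" by (cases u)
  have st: "\<sigma> \<in> {s1..s2}" "\<tau> \<in> {t1..t2}" using u u' by (auto simp: R_def)
  have "m \<bullet> Ps u = 0"
  proof (rule unit_normal_orthogonal_tangent[where \<psi> = "\<lambda>\<sigma>. P (\<sigma>, \<tau>)" and a = \<sigma> and S = S and I = "{s1..s2}"])
    show der: "((\<lambda>\<sigma>. P (\<sigma>, \<tau>)) has_vector_derivative Ps u) (at \<sigma> within {s1..s2})"
      using Ps_has u u' by simp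
    have "((\<lambda>\<sigma>. P (\<sigma>, \<tau>)) \<longlongrightarrow> P (\<sigma>, \<tau>)) (at \<sigma> within {s1..s2})"
      using der has_vector_derivative_continuous continuous_within by blast
    then have "\<forall>\<^sub>F x in at \<sigma> within {s1..s2}. P (x, \<tau>) \<in> C"
      using S u' by (intro topological_tendstoD) auto
    moreover have "\<forall>\<^sub>F x in at \<sigma> within {s1..s2}. x \<in> {s1..s2}" by (simp add: eventually_at_filter)
    ultimately show "\<forall>\<^sub>F x in at \<sigma> within {s1..s2}. P (x, \<tau>) \<in> S"
      by eventually_elim (use S(1) st in \<open>auto simp: R_def\<close>)
    show "at \<sigma> within {s1..s2} \<noteq> bot"
      using s st by (simp add: trivial_limit_within islimpt_Icc)
  qed (use nrm u' in auto)
  moreover have "m \<bullet> Pt u = 0"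
  proof (rule unit_normal_orthogonal_tangent[where \<psi> = "\<lambda>\<tau>. P (\<sigma>, \<tau>)" and a = \<tau> and S = S and I = "{t1..t2}"])
    show der: "((\<lambda>\<tau>. P (\<sigma>, \<tau>)) has_vector_derivative Pt u) (at \<tau> within {t1..t2})"
      using Pt_has u u' by simp
    have "((\<lambda>\<tau>. P (\<sigma>, \<tau>)) \<longlongrightarrow> P (\<sigma>, \<tau>)) (at \<tau> within {t1..t2})"
      using der has_vector_derivative_continuous continuous_within by blast
    then have "\<forall>\<^sub>F x in at \<tau> within {t1..t2}. P (\<sigma>, x) \<in> C"
      using S u' by (intro topological_tendstoD) auto
    moreover have "\<forall>\<^sub>F x in at \<tau> within {t1..t2}. x \<in> {t1..t2}" by (simp add: eventually_at_filter)
    ultimately show "\<forall>\<^sub>F x in at \<tau> within {t1..t2}. P (\<sigma>, x) \<in> S"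
      by eventually_elim (use S(1) st in \<open>auto simp: R_def\<close>)
    show "at \<tau> within {t1..t2} \<noteq> bot"
      using t st by (simp add: trivial_limit_within islimpt_Icc)
  qed (use nrm u' in auto)
  ultimately show ?thesis
    using nrm n by (intro inner_cross3_of_orthogonal) (auto simp: unit_normal_at_def)
qed

end

section \<open>The area formula in a chart\<close>

locale local_chart = parametrized P s1 s2 t1 t2 + tangent_frame N e1 e2 n
  for P s1 s2 t1 t2 N e1 e2 n +
  fixes \<Gamma> D \<nu> C l \<epsilon> \<delta> H f
  assumes P_R: "P ` R = closure \<Gamma>"
    and closure_cyl: "closure \<Gamma> \<inter> cyl \<delta> H \<subseteq> \<Gamma>"
    and graph: "local_graph \<Gamma> \<nu> D C l \<epsilon> \<delta> H f"
    and normal: "\<And>M. M \<in> \<Gamma> \<Longrightarrow> unit_normal_at \<Gamma> M (\<nu> M)"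
    and \<nu>_cont: "continuous_on \<Gamma> \<nu>"
begin

definition patch :: "(real^3) set" where "patch = \<Gamma> \<inter> cyl \<delta> H"

lemma patch_eq: "patch = closure \<Gamma> \<inter> cyl \<delta> H"
  using closure_cyl closure_subset[of \<Gamma>] by (auto simp: patch_def)

lemma patch_borel [measurable]: "patch \<in> sets borel"
  unfolding patch_eq by (intro sets.Int borel_closed borel_open open_cyl) auto

lemma patchD:
  assumes q: "q \<in> patch"
  shows "q = pt (proj q) (f (proj q))" "proj q \<in> square \<delta>" "norm (\<nu> q) = 1" "\<nu> q \<bullet> n \<ge> 1/2"
proof -
  have "height q = f (proj q)" using q graph unfolding local_graph_def patch_def by blast
  then show "q = pt (proj q) (f (proj q))" using pt_proj_height[of q] by metis
  show "proj q \<in> square \<delta>" using q by (simp add: patch_def cyl_def)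
  show "norm (\<nu> q) = 1" "\<nu> q \<bullet> n \<ge> 1/2" using q graph unfolding local_graph_def patch_def by blast+
qed

lemma pt_patch:
  assumes a: "a \<in> square \<delta>" shows "pt a (f a) \<in> patch"
proof -
  have "pt a (f a) \<in> \<Gamma>" "\<bar>f a\<bar> < H" using a graph unfolding local_graph_def by blast+
  then show ?thesis using a by (simp add: patch_def cyl_def)
qed

lemma proj_measurable [measurable]: "proj \<in> borel_measurable borel"
  by (intro borel_measurable_continuous_onI continuous_on_proj)

lemma \<nu>n_measurable [measurable]: "(\<lambda>q. indicator patch q * (\<nu> q \<bullet> n)) \<in> borel_measurable borel"
proof -
  have "continuous_on patch (\<lambda>q. \<nu> q \<bullet> n)"
    by (intro continuous_intros continuous_on_subset[OF \<nu>_cont]) (auto simp: patch_def)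
  from borel_measurable_continuous_on_if[OF patch_borel this continuous_on_const, of 0]
  show ?thesis by (rule measurable_cong[THEN iffD1, rotated]) (auto simp: indicator_def)
qed

definition \<phi> :: "real \<times> real \<Rightarrow> real \<times> real" where "\<phi> u = proj (P u)"
definition As :: "real \<times> real \<Rightarrow> real \<times> real" where "As u = (e1 \<bullet> Ps u, e2 \<bullet> Ps u)"
definition At :: "real \<times> real \<Rightarrow> real \<times> real" where "At u = (e1 \<bullet> Pt u, e2 \<bullet> Pt u)"
definition J :: "real \<times> real \<Rightarrow> real" where "J u = n \<bullet> cross3 (Ps u) (Pt u)"

text \<open>Binet-Cauchy identity, with n the cross product of e1 and e2: the normal component of
  the parameter cross product is the Jacobian determinant of the projected map.\<close>

lemma J_eq: "fst (As u) * snd (At u) - snd (As u) * fst (At u) = J u"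
proof -
  have "J u = cross3 e1 e2 \<bullet> cross3 (Ps u) (Pt u)" by (simp add: J_def cross)
  then show ?thesis unfolding dot_cross by (simp add: As_def At_def)
qed

lemma \<phi>_has_derivative:
  assumes "u \<in> R" shows "(\<phi> has_derivative (\<lambda>v. fst v *\<^sub>R As u + snd v *\<^sub>R At u)) (at u within R)"
proof -
  have "(\<phi> has_derivative (\<lambda>v. (e1 \<bullet> (fst v *\<^sub>R Ps u + snd v *\<^sub>R Pt u), e2 \<bullet> (fst v *\<^sub>R Ps u + snd v *\<^sub>R Pt u)))) (at u within R)"
    unfolding \<phi>_def proj_def
    by (auto intro!: derivative_eq_intros P_has_derivative[OF assms] simp: inner_diff_right)
  then show ?thesis by (simp add: As_def At_def inner_add_right)
qed

definition U :: "(real \<times> real) set" where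
  "U = {u \<in> {s1<..<s2} \<times> {t1<..<t2}. P u \<in> cyl \<delta> H}"

definition V :: "(real \<times> real) set" where "V = {u \<in> U. J u \<noteq> 0}"

definition dR :: "(real \<times> real) set" where "dR = R - {s1<..<s2} \<times> {t1<..<t2}"

lemma int_R: "{s1<..<s2} \<times> {t1<..<t2} \<subseteq> R" by (auto simp: R_def)

lemma U_subset: "U \<subseteq> R" using int_R by (auto simp: U_def)

lemma open_int_R: "open ({s1<..<s2} \<times> {t1<..<t2})" by (intro open_Times) auto

lemma open_U: "open U"
proof -
  have "U = {s1<..<s2} \<times> {t1<..<t2} \<inter> P -` cyl \<delta> H" by (auto simp: U_def)
  moreover have "open ({s1<..<s2} \<times> {t1<..<t2} \<inter> P -` cyl \<delta> H)"
    by (intro continuous_open_preimage continuous_on_subset[OF P_cont int_R] open_int_R open_cyl)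
  ultimately show ?thesis by simp
qed

lemma J_cont: "continuous_on R J"
  unfolding J_def by (intro continuous_intros cross_cont)

lemma open_V: "open V"
proof -
  have "V = U \<inter> J -` (- {0})" by (auto simp: V_def)
  moreover have "open (U \<inter> J -` (- {0}))"
    by (intro continuous_open_preimage continuous_on_subset[OF J_cont U_subset] open_U) auto
  ultimately show ?thesis by simp
qed

lemma dR_negligible: "negligible dR"
proof -
  have "dR = cbox (s1, t1) (s2, t2) - box (s1, t1) (s2, t2)"
    by (auto simp: dR_def R_def box_def cbox_def Basis_prod_def inner_prod_def)
  then show ?thesis using negligible_frontier_interval by metis
qed

text \<open>The edges form a null set, and a differentiable map of the plane into itself preserves
  null sets.\<close>

lemma image_dR_negligible: "negligible (\<phi> ` dR)"
  by (rule negligible_differentiable_image_negligible[OF order_refl dR_negligible])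
     (auto simp: differentiable_on_def differentiable_def dR_def
       intro!: exI has_derivative_subset[OF \<phi>_has_derivative])

lemma critical_negligible: "negligible (\<phi> ` {u \<in> U. J u = 0})"
proof (rule critical_values_null)
  fix u assume u: "u \<in> {u \<in> U. J u = 0}"
  then show "(\<phi> has_derivative (\<lambda>v. fst v *\<^sub>R As u + snd v *\<^sub>R At u)) (at u within {u \<in> U. J u = 0})"
    using U_subset by (intro has_derivative_subset[OF \<phi>_has_derivative]) auto
  show "jac2 (\<lambda>v. fst v *\<^sub>R As u + snd v *\<^sub>R At u) = 0"
    using u J_eq[of u] by (simp add: jac2_def)
qed

lemma P_cyl: "u \<in> R \<Longrightarrow> P u \<in> cyl \<delta> H \<Longrightarrow> P u \<in> patch"
  using P_R by (auto simp: patch_eq)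

lemma J_abs: "u \<in> R \<Longrightarrow> P u \<in> cyl \<delta> H \<Longrightarrow> \<bar>J u\<bar> = (\<nu> (P u) \<bullet> n) * jac u"
  unfolding J_def
  using cross_parallel_normal[of u "cyl \<delta> H" \<Gamma> "\<nu> (P u)" n] P_cyl open_cyl normal patchD(4)[OF P_cyl, of u]
  by (auto simp: jac_def patch_def)

text \<open>Over the square the surface is a graph, so the parameters of the surface point over a
  are the preimages of a under \<phi>. Excluding critical values and the image of the edges leaves
  only regular interior parameters.\<close>

lemma fibre_eq:
  assumes a: "a \<in> square \<delta>" "a \<notin> \<phi> ` {u \<in> U. J u = 0}" "a \<notin> \<phi> ` dR"
  shows "{u \<in> R. P u = pt a (f a)} = {u \<in> V. \<phi> u = a}"
proof (intro set_eqI iffI)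
  fix u assume "u \<in> {u \<in> R. P u = pt a (f a)}"
  then have u: "u \<in> R" "P u = pt a (f a)" by auto
  then have "\<phi> u = a" by (simp add: \<phi>_def)
  moreover have "P u \<in> cyl \<delta> H" using pt_patch[OF a(1)] u by (simp add: patch_def)
  ultimately show "u \<in> {u \<in> V. \<phi> u = a}" using u a by (auto simp: V_def U_def dR_def)
next
  fix u assume "u \<in> {u \<in> V. \<phi> u = a}"
  then have u: "u \<in> R" "P u \<in> cyl \<delta> H" "\<phi> u = a" using U_subset by (auto simp: V_def U_def)
  then show "u \<in> {u \<in> R. P u = pt a (f a)}" using patchD(1)[OF P_cyl[OF u(1,2)]] by (simp add: \<phi>_def)
qed

lemma AE_square: "AE a in lborel. a \<in> square \<delta> \<longrightarrow> a \<notin> \<phi> ` {u \<in> U. J u = 0} \<and> a \<notin> \<phi> ` dR"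
proof -
  have "\<phi> ` {u \<in> U. J u = 0} \<union> \<phi> ` dR \<in> null_sets (completion lborel)"
    using critical_negligible image_dR_negligible by (simp add: negligible_iff_null_sets null_sets.Un)
  then have "AE a in completion lborel. a \<notin> \<phi> ` {u \<in> U. J u = 0} \<union> \<phi> ` dR" by (rule AE_not_in)
  then have "AE a in lborel. a \<notin> \<phi> ` {u \<in> U. J u = 0} \<union> \<phi> ` dR" by (simp only: AE_completion_iff)
  then show ?thesis by (rule eventually_mono) auto
qed

lemma mult_graph_measurable:
  "(\<lambda>a. if a \<in> square \<delta> then 1 / real (mult (pt a (f a))) else 0) \<in> borel_measurable borel"
proof -
  have "continuous_on (square \<delta>) (\<lambda>a. pt a (f a))"
    using graph unfolding local_graph_def by (intro continuous_intros) blast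
  from borel_measurable_continuous_on_if[OF square_borel this continuous_on_const, of 0]
  have [measurable]: "(\<lambda>a. if a \<in> square \<delta> then pt a (f a) else 0) \<in> borel_measurable borel" .
  have "(\<lambda>a. if a \<in> square \<delta> then 1 / real (mult (pt a (f a))) else 0) =
      (\<lambda>a. if a \<in> square \<delta> then 1 / real (mult (if a \<in> square \<delta> then pt a (f a) else 0)) else 0)"
    by auto
  also have "\<dots> \<in> borel_measurable borel" by measurable
  finally show ?thesis .
qed

text \<open>The area formula is applied to \<open>K\<close>, which is G divided by the multiplicity:
  the preimage count cancels the division contained in \<open>weight\<close>, and the factor
  \<open>\<nu> q \<bullet> n\<close> converts surface area into area of the plane.\<close>

lemma local_pushforward:
  assumes G [measurable]: "G \<in> borel_measurable borel"
  shows "(\<integral>\<^sup>+q. G (proj q) * ennreal (indicator patch q * (\<nu> q \<bullet> n)) \<partial>area) =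
     (\<integral>\<^sup>+a. G a * indicator (square \<delta>) a \<partial>lborel)"
proof -
  obtain M where M: "M \<ge> 0" "\<And>u. jac u \<le> M" "\<And>u. jac u \<ge> 0" using jac_bounded by metis
  have VU: "V \<subseteq> U" and VR: "V \<subseteq> R" using U_subset by (auto simp: V_def)
  have bV: "bounded V" using VR compact_imp_bounded[OF R_compact] bounded_subset by blast
  have der: "(\<phi> has_derivative (\<lambda>v. fst v *\<^sub>R As u + snd v *\<^sub>R At u)) (at u)" if "u \<in> V" for u
  proof -
    have "(\<phi> has_derivative (\<lambda>v. fst v *\<^sub>R As u + snd v *\<^sub>R At u)) (at u within V)"
      using VR that by (intro has_derivative_subset[OF \<phi>_has_derivative]) auto
    then show ?thesis using at_within_open[OF that open_V] by simp
  qed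
  have cA: "continuous_on V As" "continuous_on V At"
    unfolding As_def At_def
    by (intro continuous_intros continuous_on_subset[OF Ps_cont VR] continuous_on_subset[OF Pt_cont VR])+
  have JM: "\<bar>J u\<bar> \<le> M" if "u \<in> V" for u
  proof -
    have "\<bar>J u\<bar> \<le> norm n * norm (cross3 (Ps u) (Pt u))"
      unfolding J_def by (rule Cauchy_Schwarz_ineq2)
    also have "\<dots> = jac u" using that VR n_unit by (auto simp: jac_def)
    finally show ?thesis using M(2)[of u] by linarith
  qed
  obtain W E where W: "\<And>k::nat. open (W k)" "(\<Union>k. W k) = V" "\<And>k. inj_on \<phi> (W k)" "\<And>k. E k \<subseteq> W k"
    and E: "disjoint_family E" "(\<Union>k. E k) = V"
    and area: "\<And>H :: real \<times> real \<Rightarrow> ennreal. H \<in> borel_measurable borel \<Longrightarrow>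
       (\<integral>\<^sup>+u. H (\<phi> u) * ennreal (\<bar>J u\<bar> * indicator V u) \<partial>lborel) =
       (\<integral>\<^sup>+a. H a * (\<Sum>k. indicator (\<phi> ` E k) a) \<partial>lborel)"
    by (rule area_formula_plane[OF open_V bV der cA J_eq _ JM]) (auto simp: V_def)
  define K where "K a = G a * ennreal (if a \<in> square \<delta> then 1 / real (mult (pt a (f a))) else 0)" for a
  have [measurable]: "K \<in> borel_measurable borel"
    unfolding K_def using mult_graph_measurable by measurable
  have "(\<integral>\<^sup>+q. G (proj q) * ennreal (indicator patch q * (\<nu> q \<bullet> n)) \<partial>area) =
      (\<integral>\<^sup>+u. ennreal (weight u) * (G (proj (P0 u)) * ennreal (indicator patch (P0 u) * (\<nu> (P0 u) \<bullet> n))) \<partial>lborel)"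
    by (rule nn_integral_area) measurable
  also have "\<dots> = (\<integral>\<^sup>+u. K (\<phi> u) * ennreal (\<bar>J u\<bar> * indicator V u) \<partial>lborel)"
  proof (rule nn_integral_cong_AE)
    have "dR \<in> null_sets (completion lborel)" using dR_negligible by (simp add: negligible_iff_null_sets)
    then have "AE u in completion lborel. u \<notin> dR" by (rule AE_not_in)
    then have "AE u in lborel. u \<notin> dR" by (simp only: AE_completion_iff)
    then show "AE u in lborel. ennreal (weight u) * (G (proj (P0 u)) * ennreal (indicator patch (P0 u) * (\<nu> (P0 u) \<bullet> n)))
        = K (\<phi> u) * ennreal (\<bar>J u\<bar> * indicator V u)"
    proof (rule eventually_mono)
      fix u assume u: "u \<notin> dR"
      show "ennreal (weight u) * (G (proj (P0 u)) * ennreal (indicator patch (P0 u) * (\<nu> (P0 u) \<bullet> n)))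
        = K (\<phi> u) * ennreal (\<bar>J u\<bar> * indicator V u)"
      proof (cases "u \<in> U")
        case False
        have "weight u = 0 \<or> P0 u \<notin> patch"
          using False u by (auto simp: dR_def U_def patch_def P0_def weight_0)
        moreover have "u \<notin> V" using False VU by auto
        ultimately show ?thesis by auto
      next
        case True
        then have uR: "u \<in> R" and uc: "P u \<in> cyl \<delta> H" using U_subset by (auto simp: U_def)
        have p: "P u \<in> patch" by (rule P_cyl[OF uR uc])
        have sq: "\<phi> u \<in> square \<delta>" and pu: "P u = pt (\<phi> u) (f (\<phi> u))"
          using patchD(1,2)[OF p] by (simp_all add: \<phi>_def)
        have nn: "\<nu> (P u) \<bullet> n \<ge> 1/2" by (rule patchD(4)[OF p])
        \<comment> \<open>At a critical parameter both sides are 0, because the right-hand side is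
          |J u| by \<open>J_abs\<close>.\<close>
        have Jabs: "\<bar>J u\<bar> * indicator V u = (\<nu> (P u) \<bullet> n) * jac u"
          using J_abs[OF uR uc] True by (auto simp: V_def indicator_def)
        have "ennreal (weight u) * (G (proj (P0 u)) * ennreal (indicator patch (P0 u) * (\<nu> (P0 u) \<bullet> n))) =
            G (\<phi> u) * (ennreal (weight u) * ennreal (\<nu> (P u) \<bullet> n))"
          using uR p by (simp add: P0_def \<phi>_def mult_ac)
        also have "ennreal (weight u) * ennreal (\<nu> (P u) \<bullet> n) =
            ennreal (1 / real (mult (P u))) * ennreal ((\<nu> (P u) \<bullet> n) * jac u)"
          using nn M(3)[of u] uR by (simp add: ennreal_mult'[symmetric] weight_def P0_def mult_ac)
        finally show ?thesis unfolding K_def Jabs using sq pu by (simp add: mult_ac)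
      qed
    qed
  qed
  also have "\<dots> = (\<integral>\<^sup>+a. K a * (\<Sum>k. indicator (\<phi> ` E k) a) \<partial>lborel)"
    by (rule area) measurable
  also have "\<dots> = (\<integral>\<^sup>+a. G a * indicator (square \<delta>) a \<partial>lborel)"
  proof (rule nn_integral_cong_AE, rule eventually_mono[OF AE_square])
    fix a assume a: "a \<in> square \<delta> \<longrightarrow> a \<notin> \<phi> ` {u \<in> U. J u = 0} \<and> a \<notin> \<phi> ` dR"
    show "K a * (\<Sum>k. indicator (\<phi> ` E k) a) = G a * indicator (square \<delta>) a"
    proof (cases "a \<in> square \<delta>")
      case False
      then show ?thesis by (simp add: K_def)
    next
      case True
      define Q where "Q = {u \<in> R. P u = pt a (f a)}"
      have Q: "Q = {u \<in> V. \<phi> u = a}" unfolding Q_def using fibre_eq True a by blast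
      have "Q = R \<inter> P -` {pt a (f a)}" by (auto simp: Q_def)
      then have "closed Q" using R_compact P_cont
        by (simp add: continuous_closed_preimage compact_imp_closed)
      then have "compact (R \<inter> Q)" by (rule compact_Int_closed[OF R_compact])
      moreover have "R \<inter> Q = Q" by (auto simp: Q_def)
      ultimately have "compact Q" by simp
      moreover have "Q \<subseteq> \<Union>(range W)" using Q W(2) by auto
      \<comment> \<open>Finiteness of the fibre: it is compact and covered by finitely many of the
        sets \<open>W k\<close>, on each of which \<phi> is injective. An infinite fibre would have
        cardinality 0 and spoil the cancellation.\<close>
      ultimately obtain F where F: "F \<subseteq> range W" "finite F" "Q \<subseteq> \<Union>F"
        by (rule compactE[of Q "range W"]) (use W(1) in auto)
      have "finite (X \<inter> Q)" if X: "X \<in> F" for X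
      proof -
        obtain k where "X = W k" using F(1) X by blast
        then have "inj_on \<phi> (X \<inter> Q)" using inj_on_subset[OF W(3)[of k], of "X \<inter> Q"] by simp
        moreover have "\<phi> ` (X \<inter> Q) \<subseteq> {a}" using Q by auto
        ultimately show ?thesis by (meson finite.emptyI finite_imageD finite_insert finite_subset)
      qed
      then have "finite (\<Union>X\<in>F. X \<inter> Q)" using F(2) by blast
      moreover have "Q = (\<Union>X\<in>F. X \<inter> Q)" using F(3) by auto
      ultimately have finQ: "finite Q" by simp
      have "pt a (f a) \<in> P ` R" using pt_patch[OF True] by (simp add: P_R patch_eq)
      then obtain u where "u \<in> R" "P u = pt a (f a)" by (metis imageE)
      then have "u \<in> Q" by (simp add: Q_def)
      then have "Q \<noteq> {}" by blast
      then have c: "card Q > 0" using finQ by (simp add: card_gt_0_iff)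
      have m: "mult (pt a (f a)) = card Q" by (simp add: mult_def Q_def)
      have "(\<Sum>k. indicator (\<phi> ` E k) a) = (of_nat (card Q) :: ennreal)"
        by (rule suminf_indicator_image_eq_card[OF E _ finQ Q]) (use W(3,4) inj_on_subset in blast)
      then have "K a * (\<Sum>k. indicator (\<phi> ` E k) a) = G a * (ennreal (1 / real (card Q)) * ennreal (real (card Q)))"
        using True by (simp add: K_def m mult.assoc ennreal_of_nat_eq_real_of_nat)
      also have "ennreal (1 / real (card Q)) * ennreal (real (card Q)) = 1"
        using c by (subst ennreal_mult'[symmetric]) auto
      finally show ?thesis using True by simp
    qed
  qed
  finally show ?thesis .
qed

end

section \<open>The kernel\<close>

text \<open>Reflection in the plane x = 0; it turns \<open>dist_r1\<close> into an ordinary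
  distance.\<close>

definition mirror :: "real^3 \<Rightarrow> real^3" where "mirror p = vector [- p$1, p$2, p$3]"

lemma norm_real3: "norm (x :: real^3) = sqrt ((x$1)\<^sup>2 + (x$2)\<^sup>2 + (x$3)\<^sup>2)"
  by (simp add: norm_eq_sqrt_inner inner_vec_def sum_3 power2_eq_square)

lemma dist_r_eq: "dist_r p q = norm (p - q)"
  by (simp add: dist_r_def norm_real3)

lemma dist_r1_eq: "dist_r1 p q = norm (p - mirror q)"
  by (simp add: dist_r1_def norm_real3 mirror_def)

lemma norm_mirror_ge:
  assumes "p $ 1 \<ge> 0" "q $ 1 \<ge> 0"
  shows "norm (q - p) \<le> norm (q - mirror p)" "q $ 1 + p $ 1 \<le> norm (q - mirror p)"
proof -
  have "q$1 * p$1 \<ge> 0" using assms by simp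
  then have "(q$1 - p$1)\<^sup>2 \<le> (q$1 + p$1)\<^sup>2" by (simp add: power2_eq_square algebra_simps)
  then show "norm (q - p) \<le> norm (q - mirror p)" by (simp add: norm_real3 mirror_def)
  show "q $ 1 + p $ 1 \<le> norm (q - mirror p)"
    using component_le_norm_cart[of "q - mirror p" 1] by (simp add: mirror_def)
qed

lemma norm_line_derivative:
  fixes v e :: "'a::real_inner"
  assumes "v \<noteq> 0"
  shows "((\<lambda>h. norm (v + h *\<^sub>R e)) has_real_derivative (e \<bullet> v) / norm v) (at 0)"
proof -
  have "v \<bullet> v > 0" using assms by simp
  have "(\<lambda>h. norm (v + h *\<^sub>R e)) = (\<lambda>h. sqrt (v \<bullet> v + 2 * h * (e \<bullet> v) + h\<^sup>2 * (e \<bullet> e)))"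
    by (simp add: fun_eq_iff norm_eq_sqrt_inner inner_add_left inner_add_right inner_commute power2_eq_square algebra_simps)
  moreover have "((\<lambda>h. sqrt (v \<bullet> v + 2 * h * (e \<bullet> v) + h\<^sup>2 * (e \<bullet> e))) has_real_derivative (e \<bullet> v) / sqrt (v \<bullet> v)) (at 0)"
    using \<open>v \<bullet> v > 0\<close>
    by (auto intro!: derivative_eq_intros simp: field_simps) (metis inner_ge_zero not_less)
  ultimately show ?thesis by (simp add: norm_eq_sqrt_inner)
qed

text \<open>\<open>ker \<alpha> m q p\<close> is the closed form of the conormal derivative of \<open>q1\<close> at \<open>q\<close>.\<close>

definition ker :: "real \<Rightarrow> real^3 \<Rightarrow> real^3 \<Rightarrow> real^3 \<Rightarrow> real" where
  "ker \<alpha> m q p = (let r = norm (q - p); s = norm (q - mirror p);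
      a = (m \<bullet> (q - p)) / r; b = (m \<bullet> (q - mirror p)) / s in
    (q $ 1) powr (2 * \<alpha>) * (2 powr (2 * \<alpha> - 2) / pi) *
    ((1 - 2 * \<alpha>) * (r + s) powr (- 2 * \<alpha>) * (a + b) / (r * s)
      - (r + s) powr (1 - 2 * \<alpha>) * (a / (r\<^sup>2 * s) + b / (r * s\<^sup>2))))"

text \<open>Since p has positive first coordinate, q keeps a positive distance from the mirror image
  even on the plane x = 0. Directional derivatives of the closed form depend linearly on the
  direction, so the sum over the axes is the derivative along m.\<close>

lemma conormal_deriv_q1:
  assumes \<alpha>: "0 < 2 * \<alpha>" "2 * \<alpha> < 1" and p: "p $ 1 > 0" and q: "q $ 1 \<ge> 0" "q \<noteq> p"
  shows "conormal_deriv \<alpha> m (\<lambda>q. q1 \<alpha> q p) q = ker \<alpha> m q p"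
proof -
  define r where "r = norm (q - p)"
  define s where "s = norm (q - mirror p)"
  define c where "c = 2 powr (2 * \<alpha> - 2) / pi"
  define \<beta> where "\<beta> = 1 - 2 * \<alpha>"
  have r: "r > 0" using q by (simp add: r_def)
  have s: "s > 0" using norm_mirror_ge(2)[of p q] p q unfolding s_def by linarith
  define F where "F x y = c * (\<beta> * (r + s) powr (\<beta> - 1) * (x / r + y / s) / (r * s) -
      (r + s) powr \<beta> * ((x / r) / (r\<^sup>2 * s) + (y / s) / (r * s\<^sup>2)))" for x y
  have deriv: "deriv (\<lambda>h. q1 \<alpha> (q + h *\<^sub>R e) p) 0 = F (e \<bullet> (q - p)) (e \<bullet> (q - mirror p))" for e
  proof -
    let ?r = "\<lambda>h. norm (q - p + h *\<^sub>R e)" and ?s = "\<lambda>h. norm (q - mirror p + h *\<^sub>R e)"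
    have dr: "(?r has_real_derivative (e \<bullet> (q - p)) / r) (at 0)"
      using norm_line_derivative[of "q - p" e] q by (simp add: r_def)
    have ds: "(?s has_real_derivative (e \<bullet> (q - mirror p)) / s) (at 0)"
      using norm_line_derivative[of "q - mirror p" e] s by (simp add: s_def)
    have cr: "\<forall>\<^sub>F h in nhds 0. ?r h > 0" and cs: "\<forall>\<^sub>F h in nhds 0. ?s h > 0"
    proof -
      have "(?r \<longlongrightarrow> ?r 0) (nhds 0)" "(?s \<longlongrightarrow> ?s 0) (nhds 0)"
        using DERIV_isCont[OF dr] DERIV_isCont[OF ds] tendsto_at_iff_tendsto_nhds[of ?r 0]
          tendsto_at_iff_tendsto_nhds[of ?s 0] unfolding isCont_def by blast+
      moreover have "0 < ?r 0" "0 < ?s 0" using r s by (simp_all only: r_def s_def scaleR_zero_left add_0_right)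
      ultimately show "\<forall>\<^sub>F h in nhds 0. ?r h > 0" "\<forall>\<^sub>F h in nhds 0. ?s h > 0"
        using order_tendstoD(1) by blast+
    qed
    \<comment> \<open>\<open>deriv\<close> needs the closed form on a whole neighbourhood of q; it
      holds wherever both distances are positive.\<close>
    have eq: "\<forall>\<^sub>F h in nhds 0. q1 \<alpha> (q + h *\<^sub>R e) p = c * (?r h + ?s h) powr \<beta> / (?r h * ?s h)"
      using cr cs
    proof eventually_elim
      case (elim h)
      have d: "dist_r (q + h *\<^sub>R e) p = ?r h" "dist_r1 (q + h *\<^sub>R e) p = ?s h"
        by (simp_all add: dist_r_eq dist_r1_eq algebra_simps)
      show ?case using q1_closed_form[OF \<alpha>, of "q + h *\<^sub>R e" p] elim
        unfolding d c_def \<beta>_def by (simp only: simp_thms)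
    qed
    have "((\<lambda>h. (?r h + ?s h) powr \<beta>) has_real_derivative
        \<beta> * (r + s) powr (\<beta> - 1) * ((e \<bullet> (q - p)) / r + (e \<bullet> (q - mirror p)) / s)) (at 0)"
    proof -
      have "0 < ?r 0 + ?s 0" using r s by (simp only: r_def s_def scaleR_zero_left add_0_right)
      from DERIV_fun_powr[OF DERIV_add[OF dr ds] this, of \<beta>] show ?thesis
        by (simp add: r_def s_def)
    qed
    then have "((\<lambda>h. c * (?r h + ?s h) powr \<beta>) has_real_derivative
        c * (\<beta> * (r + s) powr (\<beta> - 1) * ((e \<bullet> (q - p)) / r + (e \<bullet> (q - mirror p)) / s))) (at 0)"
      by (rule DERIV_cmult)
    from DERIV_divide[OF this DERIV_mult[OF dr ds]]
    have "((\<lambda>h. c * (?r h + ?s h) powr \<beta> / (?r h * ?s h)) has_real_derivative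
        (c * (\<beta> * (r + s) powr (\<beta> - 1) * ((e \<bullet> (q - p)) / r + (e \<bullet> (q - mirror p)) / s)) * (r * s) -
         c * (r + s) powr \<beta> * ((e \<bullet> (q - p)) / r * s + (e \<bullet> (q - mirror p)) / s * r)) / (r * s * (r * s))) (at 0)"
      using r s by (simp add: r_def s_def)
    also have "(c * (\<beta> * (r + s) powr (\<beta> - 1) * ((e \<bullet> (q - p)) / r + (e \<bullet> (q - mirror p)) / s)) * (r * s) -
         c * (r + s) powr \<beta> * ((e \<bullet> (q - p)) / r * s + (e \<bullet> (q - mirror p)) / s * r)) / (r * s * (r * s)) =
         F (e \<bullet> (q - p)) (e \<bullet> (q - mirror p))"
    proof -
      have "(c * (B * (x + y)) * (r * s) - c * D * (x * s + y * r)) / (r * s * (r * s)) =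
        c * (B * (x + y) / (r * s) - D * (x / (r\<^sup>2 * s) + y / (r * s\<^sup>2)))" for B D x y
        using r s by (simp add: divide_simps power2_eq_square) (simp add: algebra_simps)
      then show ?thesis unfolding F_def by blast
    qed
    finally show ?thesis
      using DERIV_imp_deriv DERIV_cong_ev[OF refl eq refl] by blast
  qed
  have lin: "(\<Sum>i\<in>UNIV. m $ i * F (x $ i) (y $ i)) = F (m \<bullet> x) (m \<bullet> y)" for x y :: "real^3"
    by (simp add: F_def inner_vec_def sum_3 algebra_simps add_divide_distrib)
  have "(\<Sum>i\<in>UNIV. m $ i * deriv (\<lambda>h. q1 \<alpha> (q + h *\<^sub>R axis i 1) p) 0) =
      (\<Sum>i\<in>UNIV. m $ i * F ((q - p) $ i) ((q - mirror p) $ i))"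
    unfolding deriv by (simp add: inner_axis' inner_axis)
  also have "\<dots> = F (m \<bullet> (q - p)) (m \<bullet> (q - mirror p))" by (rule lin)
  finally have "conormal_deriv \<alpha> m (\<lambda>q. q1 \<alpha> q p) q = (q $ 1) powr (2 * \<alpha>) * F (m \<bullet> (q - p)) (m \<bullet> (q - mirror p))"
    by (simp add: conormal_deriv_def)
  also have "\<dots> = ker \<alpha> m q p"
    by (simp add: ker_def Let_def F_def r_def s_def c_def \<beta>_def mult.assoc)
  finally show ?thesis .
qed

section \<open>The singular part of the kernel and the bounded remainder\<close>

definition ker_G :: "real \<Rightarrow> real^3 \<Rightarrow> real^3 \<Rightarrow> real" where
  "ker_G \<alpha> q p = (q $ 1) powr (2 * \<alpha>) * (2 powr (2 * \<alpha> - 2) / pi) *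
     ((norm (q - p) + norm (q - mirror p)) powr (1 - 2 * \<alpha>) / norm (q - mirror p))"

text \<open>The terms with a single factor 1/r. For unit m the quotients a and b are bounded by 1,
  so only the distance s to the mirror image has to stay away from 0.\<close>

definition ker_R :: "real \<Rightarrow> real^3 \<Rightarrow> real^3 \<Rightarrow> real^3 \<Rightarrow> real" where
  "ker_R \<alpha> m q p = (let r = norm (q - p); s = norm (q - mirror p);
      a = (m \<bullet> (q - p)) / r; b = (m \<bullet> (q - mirror p)) / s in
    (q $ 1) powr (2 * \<alpha>) * (2 powr (2 * \<alpha> - 2) / pi) *
    ((1 - 2 * \<alpha>) * (r + s) powr (- 2 * \<alpha>) * (a + b) / s - (r + s) powr (1 - 2 * \<alpha>) * b / s\<^sup>2))"

lemma ker_split: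
  "ker \<alpha> m q p = - ker_G \<alpha> q p * ((m \<bullet> (q - p)) / norm (q - p) ^ 3) + ker_R \<alpha> m q p / norm (q - p)"
proof -
  have "K * (X / (r * s) - Y * (z / r / (r\<^sup>2 * s) + b / (r * s\<^sup>2))) =
      - (K * (Y / s)) * (z / r ^ 3) + K * (X / s - Y * b / s\<^sup>2) / r" for K X Y r s z b :: real
    \<comment> \<open>With division by 0 equal to 0 the identity extends to r = 0 and s = 0.\<close>
    by (cases "r = 0"; cases "s = 0") (simp_all add: divide_simps power2_eq_square power3_eq_cube, simp add: algebra_simps)
  then show ?thesis unfolding ker_def ker_G_def ker_R_def Let_def by blast
qed

lemma abs_inner_div_norm_le: "norm m = 1 \<Longrightarrow> \<bar>(m \<bullet> x) / norm x\<bar> \<le> 1"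
  using Cauchy_Schwarz_ineq2[of m x] by (cases "x = 0") (auto simp: abs_divide divide_le_eq)

lemma ker_R_bound:
  assumes \<alpha>: "0 < 2 * \<alpha>" "2 * \<alpha> < 1" and c: "c > 0"
  obtains M where "M \<ge> 0" "\<And>m q p. norm m = 1 \<Longrightarrow> 0 \<le> q $ 1 \<Longrightarrow> q $ 1 \<le> B \<Longrightarrow> c \<le> norm (q - mirror p) \<Longrightarrow>
     norm (q - p) \<le> B \<Longrightarrow> norm (q - mirror p) \<le> B \<Longrightarrow> \<bar>ker_R \<alpha> m q p\<bar> \<le> M"
proof -
  define M where "M = B powr (2 * \<alpha>) * (2 powr (2 * \<alpha> - 2) / pi) *
      (c powr (- 2 * \<alpha>) * 2 / c + (2 * B) powr (1 - 2 * \<alpha>) * 1 / c\<^sup>2)"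
  show ?thesis
  proof (rule that[of M])
    fix m q p :: "real^3"
    assume m: "norm m = 1" and q: "0 \<le> q $ 1" "q $ 1 \<le> B" and s: "c \<le> norm (q - mirror p)"
      and B: "norm (q - p) \<le> B" "norm (q - mirror p) \<le> B"
    define r where "r = norm (q - p)"
    define s where "s = norm (q - mirror p)"
    define a where "a = (m \<bullet> (q - p)) / r"
    define b where "b = (m \<bullet> (q - mirror p)) / s"
    have ab: "\<bar>a\<bar> \<le> 1" "\<bar>b\<bar> \<le> 1" unfolding a_def b_def r_def s_def by (intro abs_inner_div_norm_le m)+
    have r0: "0 \<le> r" "r \<le> B" "c \<le> s" "s \<le> B" using s B by (simp_all add: r_def s_def)
    have "\<bar>ker_R \<alpha> m q p\<bar> = (q $ 1) powr (2 * \<alpha>) * (2 powr (2 * \<alpha> - 2) / pi) *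
       \<bar>(1 - 2 * \<alpha>) * (r + s) powr (- 2 * \<alpha>) * (a + b) / s - (r + s) powr (1 - 2 * \<alpha>) * b / s\<^sup>2\<bar>"
      unfolding ker_R_def Let_def r_def[symmetric] s_def[symmetric] a_def[symmetric] b_def[symmetric]
      by (simp add: abs_mult)
    also have "\<dots> \<le> B powr (2 * \<alpha>) * (2 powr (2 * \<alpha> - 2) / pi) *
       (c powr (- 2 * \<alpha>) * 2 / c + (2 * B) powr (1 - 2 * \<alpha>) * 1 / c\<^sup>2)"
    proof (intro mult_mono)
      show "(q $ 1) powr (2 * \<alpha>) \<le> B powr (2 * \<alpha>)" using q \<alpha> by (intro powr_mono2) auto
      have "\<bar>(1 - 2 * \<alpha>) * (r + s) powr (- 2 * \<alpha>) * (a + b) / s\<bar> =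
          \<bar>1 - 2 * \<alpha>\<bar> * (r + s) powr (- 2 * \<alpha>) * \<bar>a + b\<bar> / s"
        using r0 c by (simp add: abs_mult)
      also have "\<dots> \<le> 1 * c powr (- 2 * \<alpha>) * 2 / c"
        using r0 c \<alpha> ab by (intro frac_le mult_mono powr_mono2') auto
      finally have 1: "\<bar>(1 - 2 * \<alpha>) * (r + s) powr (- 2 * \<alpha>) * (a + b) / s\<bar> \<le> c powr (- 2 * \<alpha>) * 2 / c" by simp
      have "\<bar>(r + s) powr (1 - 2 * \<alpha>) * b / s\<^sup>2\<bar> = (r + s) powr (1 - 2 * \<alpha>) * \<bar>b\<bar> / s\<^sup>2"
        by (simp add: abs_mult)
      also have "\<dots> \<le> (2 * B) powr (1 - 2 * \<alpha>) * 1 / c\<^sup>2"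
        using r0 c \<alpha> ab by (intro frac_le mult_mono powr_mono2 power_mono) auto
      finally show "\<bar>(1 - 2 * \<alpha>) * (r + s) powr (- 2 * \<alpha>) * (a + b) / s - (r + s) powr (1 - 2 * \<alpha>) * b / s\<^sup>2\<bar>
          \<le> c powr (- 2 * \<alpha>) * 2 / c + (2 * B) powr (1 - 2 * \<alpha>) * 1 / c\<^sup>2"
        using 1 by linarith
    qed auto
    finally show "\<bar>ker_R \<alpha> m q p\<bar> \<le> M" by (simp add: M_def)
  qed (use c in \<open>simp add: M_def\<close>)
qed

lemma ker_G_bound:
  assumes \<alpha>: "0 < 2 * \<alpha>" "2 * \<alpha> < 1" and c: "c > 0"
  obtains M where "M \<ge> 0" "\<And>q p. 0 \<le> q $ 1 \<Longrightarrow> q $ 1 \<le> B \<Longrightarrow> c \<le> norm (q - mirror p) \<Longrightarrow>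
     norm (q - p) \<le> B \<Longrightarrow> norm (q - mirror p) \<le> B \<Longrightarrow> \<bar>ker_G \<alpha> q p\<bar> \<le> M"
proof -
  define M where "M = B powr (2 * \<alpha>) * (2 powr (2 * \<alpha> - 2) / pi) * ((2 * B) powr (1 - 2 * \<alpha>) / c)"
  show ?thesis
  proof (rule that[of M])
    fix q p :: "real^3"
    assume "0 \<le> q $ 1" "q $ 1 \<le> B" "c \<le> norm (q - mirror p)" "norm (q - p) \<le> B" "norm (q - mirror p) \<le> B"
    then have "(q $ 1) powr (2 * \<alpha>) \<le> B powr (2 * \<alpha>)"
      "(norm (q - p) + norm (q - mirror p)) powr (1 - 2 * \<alpha>) / norm (q - mirror p) \<le> (2 * B) powr (1 - 2 * \<alpha>) / c"
      using c \<alpha> by (auto intro!: powr_mono2 frac_le)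
    then have "ker_G \<alpha> q p \<le> M"
      unfolding ker_G_def M_def by (intro mult_mono order_refl) auto
    then show "\<bar>ker_G \<alpha> q p\<bar> \<le> M" by (simp add: ker_G_def)
  qed (use c in \<open>simp add: M_def\<close>)
qed

text \<open>In the half-space x \<ge> 0 the mirror image of p is at least as far from q as p itself,
  so one lower bound on r controls every denominator, also for q on the plane x = 0.\<close>

lemma ker_far_bound:
  assumes \<alpha>: "0 < 2 * \<alpha>" "2 * \<alpha> < 1" and c: "c > 0"
  obtains M where "\<And>m q p. norm m = 1 \<Longrightarrow> 0 \<le> q $ 1 \<Longrightarrow> 0 \<le> p $ 1 \<Longrightarrow> c \<le> norm (q - p) \<Longrightarrow>
     norm q \<le> B \<Longrightarrow> norm p \<le> B \<Longrightarrow> \<bar>ker \<alpha> m q p\<bar> \<le> M"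
proof -
  obtain M1 where M1: "M1 \<ge> 0" "\<And>m q p. norm m = 1 \<Longrightarrow> 0 \<le> q $ 1 \<Longrightarrow> q $ 1 \<le> 2 * B \<Longrightarrow> c \<le> norm (q - mirror p) \<Longrightarrow>
     norm (q - p) \<le> 2 * B \<Longrightarrow> norm (q - mirror p) \<le> 2 * B \<Longrightarrow> \<bar>ker_R \<alpha> m q p\<bar> \<le> M1"
    using ker_R_bound[OF assms, of "2 * B"] by metis
  obtain M2 where M2: "M2 \<ge> 0" "\<And>q p. 0 \<le> q $ 1 \<Longrightarrow> q $ 1 \<le> 2 * B \<Longrightarrow> c \<le> norm (q - mirror p) \<Longrightarrow>
     norm (q - p) \<le> 2 * B \<Longrightarrow> norm (q - mirror p) \<le> 2 * B \<Longrightarrow> \<bar>ker_G \<alpha> q p\<bar> \<le> M2"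
    using ker_G_bound[OF assms, of "2 * B"] by metis
  show ?thesis
  proof (rule that[of "M2 * (1 / c\<^sup>2) + M1 / c"])
    fix m q p :: "real^3"
    assume m: "norm m = 1" and q: "0 \<le> q $ 1" "0 \<le> p $ 1" "c \<le> norm (q - p)" "norm q \<le> B" "norm p \<le> B"
    have "norm (mirror p) = norm p" by (simp add: norm_real3 mirror_def)
    then have n: "norm (q - p) \<le> 2 * B" "norm (q - mirror p) \<le> 2 * B" "c \<le> norm (q - mirror p)" "q $ 1 \<le> 2 * B"
      using norm_triangle_ineq4[of q p] norm_triangle_ineq4[of q "mirror p"] q norm_mirror_ge(1)[of p q]
        component_le_norm_cart[of q 1] norm_ge_zero[of p] by linarith+
    have "\<bar>(m \<bullet> (q - p)) / norm (q - p) ^ 3\<bar> = \<bar>(m \<bullet> (q - p)) / norm (q - p)\<bar> * (1 / (norm (q - p))\<^sup>2)"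
      by (simp add: abs_mult power2_eq_square power3_eq_cube)
    also have "\<dots> \<le> 1 * (1 / c\<^sup>2)"
      using q c by (intro mult_mono abs_inner_div_norm_le m frac_le power_mono) auto
    finally have 1: "\<bar>(m \<bullet> (q - p)) / norm (q - p) ^ 3\<bar> \<le> 1 / c\<^sup>2" by simp
    have "\<bar>ker \<alpha> m q p\<bar> \<le> \<bar>ker_G \<alpha> q p\<bar> * \<bar>(m \<bullet> (q - p)) / norm (q - p) ^ 3\<bar> + \<bar>ker_R \<alpha> m q p\<bar> / norm (q - p)"
      unfolding ker_split by (rule abs_triangle_ineq[THEN order_trans]) (simp add: abs_mult)
    also have "\<dots> \<le> M2 * (1 / c\<^sup>2) + M1 / c"
      using q n c M1 M2 m by (intro add_mono mult_mono 1 frac_le) auto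
    finally show "\<bar>ker \<alpha> m q p\<bar> \<le> M2 * (1 / c\<^sup>2) + M1 / c" .
  qed
qed

lemma mirror_eq: "mirror p = p - (2 * p $ 1) *\<^sub>R axis 1 1"
  by (simp add: mirror_def vec_eq_iff forall_3 axis_def)

lemma continuous_mirror [continuous_intros]: "continuous F g \<Longrightarrow> continuous F (\<lambda>x. mirror (g x))"
  unfolding mirror_eq by (intro continuous_intros)

lemma norm_minus_mirror_self: "p $ 1 \<ge> 0 \<Longrightarrow> norm (p - mirror p) = 2 * p $ 1"
  by (simp add: mirror_eq)

text \<open>On the diagonal r = 0 and s = 2x, so all powers of x and all \<alpha>-dependent powers
  of 2 cancel. After multiplication by \<open>x powr (2 * \<alpha>)\<close> the singularity of
  \<open>q1\<close> is that of the Newtonian potential 1/(4 pi r).\<close>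

lemma ker_G_diagonal:
  assumes "N $ 1 > 0" shows "ker_G \<alpha> N N = 1 / (4 * pi)"
proof -
  let ?x = "N $ 1"
  have "ker_G \<alpha> N N = ?x powr (2 * \<alpha>) * (2 powr (2 * \<alpha> - 2) / pi) * ((2 * ?x) powr (1 - 2 * \<alpha>) / (2 * ?x))"
    using assms norm_minus_mirror_self[of N] by (simp add: ker_G_def)
  also have "(2 * ?x) powr (1 - 2 * \<alpha>) / (2 * ?x) = 2 powr (- 2 * \<alpha>) * ?x powr (- 2 * \<alpha>)"
  proof -
    have "(2 * ?x) powr (1 - 2 * \<alpha>) = (2 * ?x) powr 1 * (2 * ?x) powr (- 2 * \<alpha>)"
      by (simp only: powr_add[symmetric]) simp
    then show ?thesis using assms by (simp add: powr_mult)
  qed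
  also have "?x powr (2 * \<alpha>) * (2 powr (2 * \<alpha> - 2) / pi) * (2 powr (- 2 * \<alpha>) * ?x powr (- 2 * \<alpha>)) =
      (?x powr (2 * \<alpha>) * ?x powr (- 2 * \<alpha>)) * (2 powr (2 * \<alpha> - 2) * 2 powr (- 2 * \<alpha>)) / pi"
    by (simp only: times_divide_eq_left times_divide_eq_right mult_ac)
  also have "?x powr (2 * \<alpha>) * ?x powr (- 2 * \<alpha>) = 1" using assms by (simp add: powr_add[symmetric])
  also have "2 powr (2 * \<alpha> - 2) * 2 powr (- 2 * \<alpha>) = (2::real) powr (- 2)" by (simp add: powr_add[symmetric])
  also have "(2::real) powr (- 2) = 1 / 4" by (simp add: powr_minus_divide)
  finally show ?thesis by simp
qed

lemma ker_G_near_diagonal: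
  assumes N: "N $ 1 > 0" and e: "e > 0"
  obtains \<rho> where "\<rho> > 0" "\<And>q p. dist q N < \<rho> \<Longrightarrow> dist p N < \<rho> \<Longrightarrow> \<bar>ker_G \<alpha> q p - 1 / (4 * pi)\<bar> < e"
proof -
  have "isCont (\<lambda>x. ker_G \<alpha> (fst x) (snd x)) (N, N)"
    unfolding ker_G_def using N norm_minus_mirror_self[of N]
    by (intro continuous_intros continuous_at_within_powr) auto
  then obtain d where d: "d > 0"
    "\<And>x. dist x (N, N) < d \<Longrightarrow> dist (ker_G \<alpha> (fst x) (snd x)) (ker_G \<alpha> N N) < e"
    unfolding continuous_at_eps_delta using e by fastforce
  show ?thesis
  proof (rule that[of "d / 2"])
    fix q p assume "dist q N < d / 2" "dist p N < d / 2"
    then have "dist (q, p) (N, N) < d"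
      using dist_Pair_Pair[of q p N N] sqrt_sum_squares_le_sum_abs[of "dist q N" "dist p N"] by simp
    from d(2)[OF this] show "\<bar>ker_G \<alpha> q p - 1 / (4 * pi)\<bar> < e"
      by (simp add: ker_G_diagonal[OF N] dist_real_def)
  qed (use d in auto)
qed

lemma isCont_ker:
  assumes q: "q \<noteq> p" "q \<noteq> mirror p"
  shows "isCont (\<lambda>p. ker \<alpha> m q p) p"
proof -
  have "norm (q - p) > 0" "norm (q - mirror p) > 0" using q by auto
  then have *: "norm (q - p) + norm (q - mirror p) \<noteq> 0" "norm (q - p) \<noteq> 0" "norm (q - mirror p) \<noteq> 0"
    "norm (q - p) * norm (q - mirror p) \<noteq> 0" "(norm (q - p))\<^sup>2 * norm (q - mirror p) \<noteq> 0"
    "norm (q - p) * (norm (q - mirror p))\<^sup>2 \<noteq> 0" by (linarith, simp_all)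
  show ?thesis
    unfolding ker_def Let_def by (intro continuous_intros * | rule *)+
qed

lemma borel_measurable_vec_nth3 [measurable]: "(\<lambda>x::real^3. x $ i) \<in> borel_measurable borel"
  by (intro borel_measurable_continuous_onI continuous_intros)

lemma ker_measurable:
  assumes [measurable]: "m \<in> borel_measurable borel"
  shows "(\<lambda>q. ker \<alpha> (m q) q p) \<in> borel_measurable borel"
  unfolding ker_def Let_def by measurable

text \<open>The 8 comes from r \<ge> \<rho>/2. In the factorisation of \<rho>^3 - r^3 the quadratic
  factor is at most (1 + 3/2 + 9/4)\<rho>^2, below 5\<rho>^2, and 5 times 8 gives the 40.\<close>

lemma inverse_cube_perturbation:
  fixes r \<rho> \<epsilon> :: real
  assumes "\<rho> > 0" "\<bar>r - \<rho>\<bar> \<le> \<epsilon> * \<rho>" "0 \<le> \<epsilon>" "\<epsilon> \<le> 1/2"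
  shows "1 / r ^ 3 \<le> 8 / \<rho> ^ 3" "\<bar>1 / r ^ 3 - 1 / \<rho> ^ 3\<bar> \<le> 40 * \<epsilon> / \<rho> ^ 3"
proof -
  have "\<epsilon> * \<rho> \<le> (1/2) * \<rho>" using assms by (intro mult_right_mono) auto
  then have r: "\<rho> / 2 \<le> r" "r \<le> 3 / 2 * \<rho>" using assms(2) by linarith+
  have r0: "r > 0" using r assms(1) by linarith
  have "(\<rho> / 2) ^ 3 \<le> r ^ 3" using r assms by (intro power_mono) auto
  then have r3: "\<rho> ^ 3 \<le> 8 * r ^ 3" by (simp add: power_divide)
  then show "1 / r ^ 3 \<le> 8 / \<rho> ^ 3" using r0 assms by (simp add: divide_simps)
  have "\<bar>\<rho> ^ 3 - r ^ 3\<bar> = \<bar>r - \<rho>\<bar> * (\<rho> * \<rho> + \<rho> * r + r * r)"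
  proof -
    have "\<rho> ^ 3 - r ^ 3 = (\<rho> - r) * (\<rho> * \<rho> + \<rho> * r + r * r)" by (simp add: power3_eq_cube algebra_simps)
    moreover have "\<rho> * \<rho> + \<rho> * r + r * r \<ge> 0" using assms r0 by simp
    ultimately show ?thesis by (simp add: abs_mult abs_minus_commute)
  qed
  also have "\<dots> \<le> (\<epsilon> * \<rho>) * (\<rho> * \<rho> + \<rho> * (3 / 2 * \<rho>) + (3 / 2 * \<rho>) * (3 / 2 * \<rho>))"
    using assms r r0 by (intro mult_mono add_mono) auto
  also have "\<dots> = 19 / 4 * (\<epsilon> * \<rho> ^ 3)" by (simp add: power3_eq_cube)
  also have "\<dots> \<le> 5 * (\<epsilon> * \<rho> ^ 3)" using assms by (intro mult_right_mono) auto
  finally have "\<bar>\<rho> ^ 3 - r ^ 3\<bar> \<le> 5 * \<epsilon> * \<rho> ^ 3" by simp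
  also have "\<dots> \<le> 5 * \<epsilon> * (8 * r ^ 3)" using r3 assms by (intro mult_left_mono) auto
  finally have "\<bar>\<rho> ^ 3 - r ^ 3\<bar> \<le> 40 * \<epsilon> * r ^ 3" by simp
  moreover have "\<bar>1 / r ^ 3 - 1 / \<rho> ^ 3\<bar> = \<bar>\<rho> ^ 3 - r ^ 3\<bar> / (r ^ 3 * \<rho> ^ 3)"
  proof -
    have "1 / r ^ 3 - 1 / \<rho> ^ 3 = (\<rho> ^ 3 - r ^ 3) / (r ^ 3 * \<rho> ^ 3)"
      using r0 assms by (simp add: diff_frac_eq)
    then show ?thesis using r0 assms by simp
  qed
  moreover have "\<bar>\<rho> ^ 3 - r ^ 3\<bar> / (r ^ 3 * \<rho> ^ 3) \<le> (40 * \<epsilon> * r ^ 3) / (r ^ 3 * \<rho> ^ 3)"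
    by (rule divide_right_mono[OF calculation(1)]) (use r0 assms in simp)
  ultimately have "\<bar>1 / r ^ 3 - 1 / \<rho> ^ 3\<bar> \<le> (40 * \<epsilon> * r ^ 3) / (r ^ 3 * \<rho> ^ 3)"
    by linarith
  also have "\<dots> = 40 * \<epsilon> / \<rho> ^ 3" using r0 by simp
  finally show "\<bar>1 / r ^ 3 - 1 / \<rho> ^ 3\<bar> \<le> 40 * \<epsilon> / \<rho> ^ 3" .
qed

text \<open>The bookkeeping for \<open>kernel_pointwise\<close>: g is the density times
  \<open>ker_G\<close>, \<kappa> its limit, t the inner product of the normal with the chord, h the
  height of the surface above p, w the inner product of the normal with n, d the distance in the
  plane, r the distance in space, and \<rho> = sqrt(d^2 + h^2). The three errors come from the
  chord, from the remainder \<open>ker_R\<close>, and from replacing g by \<kappa> and r by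
  \<rho>.\<close>

lemma kernel_arithmetic:
  fixes g \<kappa> e \<epsilon> w h r \<rho> d t R B C l :: real
  assumes g: "\<bar>g - \<kappa>\<bar> \<le> e" and t: "\<bar>t\<bar> \<le> C * d powr (1 + l)" and C: "C \<ge> 0" and d: "0 < d" "d \<le> r" and \<rho>: "\<rho> > 0"
    and r1: "1 / r ^ 3 \<le> 8 / \<rho> ^ 3" and r2: "\<bar>1 / r ^ 3 - 1 / \<rho> ^ 3\<bar> \<le> 40 * \<epsilon> / \<rho> ^ 3"
    and w: "w \<ge> 0" and R: "\<bar>R\<bar> \<le> B"
  shows "\<bar>- g * ((t + h * w) / r ^ 3) + R / r + \<kappa> * (w * (h / \<rho> ^ 3))\<bar> \<le>
    (\<bar>\<kappa>\<bar> + e) * C * d powr (l - 2) + B / d + (8 * e + 40 * \<epsilon> * \<bar>\<kappa>\<bar>) * (w * (\<bar>h\<bar> / \<rho> ^ 3))"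
proof -
  have r: "r > 0" using d by linarith
  have e: "e \<ge> 0" using g by linarith
  have "\<bar>g\<bar> \<le> \<bar>\<kappa>\<bar> + e" using g by linarith
  have "\<bar>g * (t / r ^ 3)\<bar> = \<bar>g\<bar> * (\<bar>t\<bar> / r ^ 3)" using r by (simp add: abs_mult)
  also have "\<dots> \<le> (\<bar>\<kappa>\<bar> + e) * ((C * d powr (1 + l)) / d ^ 3)"
    using \<open>\<bar>g\<bar> \<le> \<bar>\<kappa>\<bar> + e\<close> t d C e by (intro mult_mono frac_le power_mono) auto
  also have "(C * d powr (1 + l)) / d ^ 3 = C * d powr (l - 2)"
  proof -
    have "d powr (1 + l) = d powr 3 * d powr (l - 2)" by (simp add: powr_add[symmetric])
    also have "d powr 3 = d ^ 3" using d by (simp only: powr_numeral less_imp_le)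
    finally show ?thesis using d by simp
  qed
  finally have 1: "\<bar>g * (t / r ^ 3)\<bar> \<le> (\<bar>\<kappa>\<bar> + e) * C * d powr (l - 2)" by simp
  have 2: "\<bar>R / r\<bar> \<le> B / d" using R d r by (auto simp: abs_divide intro!: frac_le)
  have "g / r ^ 3 - \<kappa> / \<rho> ^ 3 = (g - \<kappa>) * (1 / r ^ 3) + \<kappa> * (1 / r ^ 3 - 1 / \<rho> ^ 3)"
    by (simp add: algebra_simps diff_divide_distrib)
  then have "\<bar>g / r ^ 3 - \<kappa> / \<rho> ^ 3\<bar> \<le> \<bar>g - \<kappa>\<bar> * (1 / r ^ 3) + \<bar>\<kappa>\<bar> * \<bar>1 / r ^ 3 - 1 / \<rho> ^ 3\<bar>"
    using r abs_triangle_ineq[of "(g - \<kappa>) * (1 / r ^ 3)" "\<kappa> * (1 / r ^ 3 - 1 / \<rho> ^ 3)"] by (simp add: abs_mult)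
  also have "\<dots> \<le> e * (8 / \<rho> ^ 3) + \<bar>\<kappa>\<bar> * (40 * \<epsilon> / \<rho> ^ 3)"
    using g r1 r2 r e by (intro add_mono mult_mono) auto
  also have "\<dots> = (8 * e + 40 * \<epsilon> * \<bar>\<kappa>\<bar>) / \<rho> ^ 3" by (simp add: add_divide_distrib mult_ac)
  finally have "\<bar>w * h\<bar> * \<bar>g / r ^ 3 - \<kappa> / \<rho> ^ 3\<bar> \<le> \<bar>w * h\<bar> * ((8 * e + 40 * \<epsilon> * \<bar>\<kappa>\<bar>) / \<rho> ^ 3)"
    by (intro mult_left_mono) auto
  then have 3: "\<bar>w * h * (g / r ^ 3 - \<kappa> / \<rho> ^ 3)\<bar> \<le> (8 * e + 40 * \<epsilon> * \<bar>\<kappa>\<bar>) * (w * (\<bar>h\<bar> / \<rho> ^ 3))"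
    using w by (simp add: abs_mult mult_ac)
  have "- g * ((t + h * w) / r ^ 3) + R / r + \<kappa> * (w * (h / \<rho> ^ 3)) =
      - (g * (t / r ^ 3)) + R / r - w * h * (g / r ^ 3 - \<kappa> / \<rho> ^ 3)"
    by (simp add: algebra_simps add_divide_distrib)
  then show ?thesis
  proof (rule ssubst)
    have gen: "\<bar>- x + y - z\<bar> \<le> X + Y + Z" if "\<bar>x\<bar> \<le> X" "\<bar>y\<bar> \<le> Y" "\<bar>z\<bar> \<le> Z" for x y z X Y Z :: real
      using that by linarith
    show "\<bar>- (g * (t / r ^ 3)) + R / r - w * h * (g / r ^ 3 - \<kappa> / \<rho> ^ 3)\<bar> \<le>
      (\<bar>\<kappa>\<bar> + e) * C * d powr (l - 2) + B / d + (8 * e + 40 * \<epsilon> * \<bar>\<kappa>\<bar>) * (w * (\<bar>h\<bar> / \<rho> ^ 3))"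
      by (rule gen[OF 1 2 3])
  qed
qed

section \<open>The kernel on a patch\<close>

context local_chart
begin

lemma patch_estimates:
  assumes q: "q \<in> patch" and q': "q' \<in> patch"
  shows "\<bar>\<nu> q \<bullet> (q - q')\<bar> \<le> C * norm (proj q - proj q') powr (1 + l)"
    "\<bar>height q - height q'\<bar> \<le> \<epsilon> * norm (proj q - proj q')"
    "height q = f (proj q)"
  using graph q q' unfolding local_graph_def patch_def by blast+

text \<open>The surface point q' on the vertical line through p splits q - p into the chord q - q'
  and a multiple of n. Lyapunov's condition controls the chord, and the vertical part produces the
  Poisson kernel.\<close>

lemma kernel_pointwise:
  fixes \<mu> \<kappa> e B :: real
  assumes q: "q \<in> patch" and p: "p \<in> cyl \<delta> H" and d: "proj q \<noteq> proj p" and C: "C \<ge> 0" and \<epsilon>: "0 \<le> \<epsilon>" "\<epsilon> \<le> 1/2"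
    and G: "\<bar>\<mu> * ker_G \<alpha> q p - \<kappa>\<bar> \<le> e" and R: "\<bar>\<mu> * ker_R \<alpha> (\<nu> q) q p\<bar> \<le> B"
  shows "\<bar>\<mu> * ker \<alpha> (\<nu> q) q p + \<kappa> * ((\<nu> q \<bullet> n) * poisson_kernel (f (proj p) - height p) (proj q - proj p))\<bar> \<le>
    (\<bar>\<kappa>\<bar> + e) * C * norm (proj q - proj p) powr (l - 2) + B / norm (proj q - proj p) +
    (8 * e + 40 * \<epsilon> * \<bar>\<kappa>\<bar>) * ((\<nu> q \<bullet> n) * poisson_kernel \<bar>f (proj p) - height p\<bar> (proj q - proj p))"
proof -
  define b where "b = proj p"
  define h where "h = f b - height p"
  define d where "d = norm (proj q - b)"
  define q' where "q' = pt b (f b)"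
  define r where "r = norm (q - p)"
  define \<rho> where "\<rho> = sqrt (d\<^sup>2 + h\<^sup>2)"
  have b: "b \<in> square \<delta>" using p by (simp add: b_def cyl_def)
  have q': "q' \<in> patch" "proj q' = b" "height q' = f b" using pt_patch[OF b] by (simp_all add: q'_def)
  have d0: "d > 0" using d by (simp add: d_def b_def)
  then have \<rho>0: "\<rho> > 0" unfolding \<rho>_def by (simp add: add_pos_nonneg)
  have pk: "poisson_kernel x (proj q - b) = x / (sqrt (d\<^sup>2 + x\<^sup>2)) ^ 3" for x
  proof -
    have "d\<^sup>2 = (fst (proj q - b))\<^sup>2 + (snd (proj q - b))\<^sup>2" by (simp add: d_def norm_prod_def)
    then show ?thesis by (simp only: poisson_kernel_def)
  qed
  have "q' - p = h *\<^sub>R n"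
    unfolding diff_eq[of q' p] by (simp add: q' b_def[symmetric] h_def) (simp add: plane_def)
  then have qp: "q - p = (q - q') + h *\<^sub>R n" by (simp add: algebra_simps)
  have inner: "\<nu> q \<bullet> (q - p) = \<nu> q \<bullet> (q - q') + h * (\<nu> q \<bullet> n)"
    unfolding qp by (simp only: inner_add_right inner_scaleR_right)
  have r_eq: "r = sqrt (d\<^sup>2 + ((height q - f b) + h)\<^sup>2)"
    unfolding r_def norm_diff[of q p] by (simp add: d_def b_def[symmetric] h_def)
  have dr: "d \<le> r" unfolding r_eq using d0 by (intro real_le_rsqrt) auto
  \<comment> \<open>r and \<rho> are norms of pairs differing only in the second component, by the
    height difference of q and q', which the slope bounds by \<epsilon>d.\<close>
  have "\<bar>r - \<rho>\<bar> = \<bar>norm (d, (height q - f b) + h) - norm (d, h)\<bar>"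
    by (simp add: r_eq \<rho>_def norm_Pair)
  also have "\<dots> \<le> norm ((d, (height q - f b) + h) - (d, h))" by (rule norm_triangle_ineq3)
  also have "\<dots> = \<bar>height q - height q'\<bar>" by (simp add: q' norm_Pair)
  also have "\<dots> \<le> \<epsilon> * d" using patch_estimates(2)[OF q q'(1)] by (simp add: q' d_def)
  also have "\<dots> \<le> \<epsilon> * \<rho>" using \<epsilon> unfolding \<rho>_def by (intro mult_left_mono real_le_rsqrt) auto
  finally have dr\<rho>: "\<bar>r - \<rho>\<bar> \<le> \<epsilon> * \<rho>" .
  have w: "\<nu> q \<bullet> n \<ge> 0" using patchD(4)[OF q] by linarith
  have "\<mu> * ker \<alpha> (\<nu> q) q p =
      - (\<mu> * ker_G \<alpha> q p) * ((\<nu> q \<bullet> (q - q') + h * (\<nu> q \<bullet> n)) / r ^ 3) + (\<mu> * ker_R \<alpha> (\<nu> q) q p) / r"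
    unfolding ker_split inner r_def[symmetric] by (simp add: algebra_simps)
  moreover have "poisson_kernel h (proj q - b) = h / \<rho> ^ 3" "poisson_kernel \<bar>h\<bar> (proj q - b) = \<bar>h\<bar> / \<rho> ^ 3"
    by (simp_all add: pk \<rho>_def)
  ultimately show ?thesis
    unfolding b_def[symmetric] h_def[symmetric] d_def[symmetric]
    using kernel_arithmetic[OF G _ C d0 dr \<rho>0 inverse_cube_perturbation[OF \<rho>0 dr\<rho> \<epsilon>] w R, of "\<nu> q \<bullet> (q - q')" l h]
      patch_estimates(1)[OF q q'(1)] by (simp add: q' d_def)
qed

end

section \<open>The potential near a surface point\<close>

context local_chart
begin

text \<open>The density of plane area with respect to surface area on the patch, extended by
  0.\<close>

definition w :: "real^3 \<Rightarrow> real" where "w q = indicator patch q * (\<nu> q \<bullet> n)"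

lemma w_measurable [measurable]: "w \<in> borel_measurable borel"
  unfolding w_def by (rule \<nu>n_measurable)

lemma w_patch: "q \<in> patch \<Longrightarrow> w q = \<nu> q \<bullet> n" "q \<in> patch \<Longrightarrow> w q \<ge> 1/2" "q \<notin> patch \<Longrightarrow> w q = 0"
  using patchD(4)[of q] by (auto simp: w_def)

lemma w_nonneg: "w q \<ge> 0"
  using w_patch[of q] by (cases "q \<in> patch") auto

lemma pushforward:
  assumes "G \<in> borel_measurable borel"
  shows "(\<integral>\<^sup>+q. G (proj q) * ennreal (w q) \<partial>area) = (\<integral>\<^sup>+a. G a * indicator (square \<delta>) a \<partial>lborel)"
  unfolding w_def by (rule local_pushforward[OF assms])

text \<open>A point of the plane is null, and \<open>pushforward\<close> carries this over to the
  patch because w is at least 1/2 there.\<close>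

lemma AE_proj_neq: "AE q in area. q \<in> patch \<longrightarrow> proj q \<noteq> b"
proof -
  have [measurable]: "{b} \<in> sets borel" by simp
  have "(\<integral>\<^sup>+q. indicator {b} (proj q) * ennreal (w q) \<partial>area) = (\<integral>\<^sup>+a. indicator {b} a * indicator (square \<delta>) a \<partial>lborel)"
    by (rule pushforward) measurable
  also have "\<dots> = 0"
    using AE_lborel_singleton[of b] by (subst nn_integral_0_iff_AE) (auto elim!: eventually_mono)
  finally have "AE q in area. indicator {b} (proj q) * ennreal (w q) = 0"
    by (subst (asm) nn_integral_0_iff_AE) auto
  then show ?thesis
    by (rule eventually_mono) (use w_patch in \<open>force simp: indicator_def split: if_splits\<close>)
qed

lemma AE_neq: "AE q in area. q \<in> patch \<longrightarrow> q \<noteq> p"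
  using AE_proj_neq[of "proj p"] by (rule eventually_mono) auto

lemma nn_integral_poisson_area_le:
  assumes "h > 0"
  shows "(\<integral>\<^sup>+q. ennreal (poisson_kernel h (proj q - b)) * ennreal (w q) \<partial>area) \<le> ennreal (2 * pi)"
proof -
  have "(\<integral>\<^sup>+q. ennreal (poisson_kernel h (proj q - b)) * ennreal (w q) \<partial>area) =
      (\<integral>\<^sup>+v. ennreal (poisson_kernel h (v - b)) * indicator (square \<delta>) v \<partial>lborel)"
    by (rule pushforward[of "\<lambda>a. ennreal (poisson_kernel h (a - b))"]) measurable
  then show ?thesis using nn_integral_poisson_square_le[OF assms] by simp
qed

text \<open>\<open>pushforward\<close> moves the integral to the square, where the total mass bounds
  it from above and the tail from below.\<close>

lemma poisson_area_pos:
  assumes h: "h > 0" and \<delta>: "\<delta> > 0" and b: "b \<in> square (\<delta> / 2)"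
  shows "integrable area (\<lambda>q. w q * poisson_kernel h (proj q - b))"
    and "\<bar>(\<integral>q. w q * poisson_kernel h (proj q - b) \<partial>area) - 2 * pi\<bar> \<le> 16 * h / \<delta>"
proof -
  have nn: "0 \<le> w q * poisson_kernel h (proj q - b)" for q
    using w_nonneg h by (simp add: poisson_kernel_nonneg)
  have eq: "(\<integral>\<^sup>+q. ennreal (w q * poisson_kernel h (proj q - b)) \<partial>area) =
      (\<integral>\<^sup>+q. ennreal (poisson_kernel h (proj q - b)) * ennreal (w q) \<partial>area)"
    using h by (intro nn_integral_cong) (simp add: ennreal_mult'[symmetric] poisson_kernel_nonneg mult.commute w_nonneg)
  have le: "(\<integral>\<^sup>+q. ennreal (w q * poisson_kernel h (proj q - b)) \<partial>area) \<le> ennreal (2 * pi)"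
    unfolding eq by (rule nn_integral_poisson_area_le[OF h])
  show int: "integrable area (\<lambda>q. w q * poisson_kernel h (proj q - b))"
    using nn le by (intro integrableI_nonneg) (auto simp: top.not_eq_extremum[symmetric] dest: neq_top_trans[rotated])
  define I where "I = (\<integral>q. w q * poisson_kernel h (proj q - b) \<partial>area)"
  have I: "(\<integral>\<^sup>+q. ennreal (w q * poisson_kernel h (proj q - b)) \<partial>area) = ennreal I"
    unfolding I_def using nn by (intro nn_integral_eq_integral[OF int]) auto
  have I0: "I \<ge> 0" unfolding I_def using nn by (intro integral_nonneg_AE) auto
  have 1: "I \<le> 2 * pi" using le I by simp
  have "(\<integral>\<^sup>+q. ennreal (poisson_kernel h (proj q - b)) * ennreal (w q) \<partial>area) =
      (\<integral>\<^sup>+v. ennreal (poisson_kernel h (v - b)) * indicator (square \<delta>) v \<partial>lborel)"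
    by (rule pushforward[of "\<lambda>a. ennreal (poisson_kernel h (a - b))"]) measurable
  then have "ennreal (2 * pi) \<le> ennreal I + ennreal (16 * h / \<delta>)"
    using nn_integral_poisson_square_ge[OF h \<delta> b] I eq by simp
  also have "\<dots> = ennreal (I + 16 * h / \<delta>)" using I0 h \<delta> by (subst ennreal_plus) auto
  finally have 2: "2 * pi \<le> I + 16 * h / \<delta>" using I0 h \<delta> by (subst (asm) ennreal_le_iff) auto
  show "\<bar>(\<integral>q. w q * poisson_kernel h (proj q - b) \<partial>area) - 2 * pi\<bar> \<le> 16 * h / \<delta>"
  proof -
    have "16 * h / \<delta> \<ge> 0" using h \<delta> by simp
    then show ?thesis using 1 2 unfolding I_def[symmetric] by linarith
  qed
qed

text \<open>The kernel is odd in h, so \<open>sgn h\<close> covers points below, on and above the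
  surface in one statement. The error is the Poisson mass outside the square.\<close>

lemma poisson_area:
  assumes \<delta>: "\<delta> > 0" and b: "b \<in> square (\<delta> / 2)"
  shows "integrable area (\<lambda>q. w q * poisson_kernel h (proj q - b))"
    and "\<bar>(\<integral>q. w q * poisson_kernel h (proj q - b) \<partial>area) - sgn h * (2 * pi)\<bar> \<le> 16 * \<bar>h\<bar> / \<delta>"
proof -
  consider "h > 0" | "h = 0" | "h < 0" by linarith
  then have "integrable area (\<lambda>q. w q * poisson_kernel h (proj q - b)) \<and>
    \<bar>(\<integral>q. w q * poisson_kernel h (proj q - b) \<partial>area) - sgn h * (2 * pi)\<bar> \<le> 16 * \<bar>h\<bar> / \<delta>"
  proof cases
    case 1
    then show ?thesis using poisson_area_pos[OF 1 \<delta> b] by simp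
  next
    case 2
    then show ?thesis by (simp add: poisson_kernel_def)
  next
    case 3
    then have h: "- h > 0" by simp
    have eq: "poisson_kernel h v = - poisson_kernel (- h) v" for v by (simp add: poisson_kernel_def)
    show ?thesis unfolding eq using poisson_area_pos[OF h \<delta> b] 3 by simp
  qed
  then show "integrable area (\<lambda>q. w q * poisson_kernel h (proj q - b))"
    "\<bar>(\<integral>q. w q * poisson_kernel h (proj q - b) \<partial>area) - sgn h * (2 * pi)\<bar> \<le> 16 * \<bar>h\<bar> / \<delta>" by auto
qed

text \<open>The errors of \<open>kernel_pointwise\<close> are integrated in the plane. The terms 1/d
  and d^(l-2) merge into one weak singularity of total size O(\<delta>^l); the Poisson term keeps
  its bounded mass, multiplied by K2.\<close>

lemma near_bound:
  fixes \<mu> :: "real^3 \<Rightarrow> real" and \<kappa> e B :: real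
  defines "K1 \<equiv> (\<bar>\<kappa>\<bar> + e) * C + B" and "K2 \<equiv> 8 * e + 40 * \<epsilon> * \<bar>\<kappa>\<bar>"
  assumes p: "p \<in> cyl \<delta> H" and C: "C \<ge> 0" and \<epsilon>: "0 \<le> \<epsilon>" "\<epsilon> \<le> 1/2" and \<delta>: "0 < \<delta>" "\<delta> \<le> 1/4"
    and l: "0 < l" "l \<le> 1" and eB: "e \<ge> 0" "B \<ge> 0"
    and G: "\<And>q. q \<in> patch \<Longrightarrow> \<bar>\<mu> q * ker_G \<alpha> q p - \<kappa>\<bar> \<le> e"
    and R: "\<And>q. q \<in> patch \<Longrightarrow> \<bar>\<mu> q * ker_R \<alpha> (\<nu> q) q p\<bar> \<le> B"
  shows "(\<integral>\<^sup>+q. ennreal \<bar>indicator patch q * (\<mu> q * ker \<alpha> (\<nu> q) q p) +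
      \<kappa> * (w q * poisson_kernel (f (proj p) - height p) (proj q - proj p))\<bar> \<partial>area) \<le>
    ennreal (2 * K1 * (16 / l\<^sup>2 * (2 * \<delta>) powr l) + K2 * (2 * pi))"
proof -
  define b where "b = proj p"
  define h where "h = f b - height p"
  have b: "b \<in> square \<delta>" using p by (simp add: b_def cyl_def)
  have K: "K1 \<ge> 0" "K2 \<ge> 0" using eB C \<epsilon> by (auto simp: K1_def K2_def intro!: add_nonneg_nonneg mult_nonneg_nonneg)
  let ?S = "\<lambda>q. ennreal (norm (proj q - b) powr (l - 2)) * ennreal (w q)"
  let ?Q = "\<lambda>q. ennreal (poisson_kernel \<bar>h\<bar> (proj q - b)) * ennreal (w q)"
  have "AE q in area. ennreal \<bar>indicator patch q * (\<mu> q * ker \<alpha> (\<nu> q) q p) +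
      \<kappa> * (w q * poisson_kernel h (proj q - b))\<bar> \<le> ennreal (2 * K1) * ?S q + ennreal K2 * ?Q q"
  proof (rule eventually_mono[OF AE_proj_neq[of b]])
    fix q assume neq: "q \<in> patch \<longrightarrow> proj q \<noteq> b"
    show "ennreal \<bar>indicator patch q * (\<mu> q * ker \<alpha> (\<nu> q) q p) +
      \<kappa> * (w q * poisson_kernel h (proj q - b))\<bar> \<le> ennreal (2 * K1) * ?S q + ennreal K2 * ?Q q"
    proof (cases "q \<in> patch")
      case False
      then show ?thesis by (simp add: w_patch)
    next
      case True
      define d where "d = norm (proj q - b)"
      have ww: "\<nu> q \<bullet> n = w q" "w q \<ge> 1/2" using w_patch True by auto
      have d: "d > 0" using neq True by (simp add: d_def)
      have "d \<le> norm (proj q) + norm b" unfolding d_def by (rule norm_triangle_ineq4)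
      also have "\<dots> \<le> 1" using square_norm[OF b] square_norm[OF patchD(2)[OF True]] \<delta> by linarith
      finally have d1: "d \<le> 1" .
      \<comment> \<open>Since d \<le> 1 and l \<le> 1, the term 1/d is absorbed by d^(l-2); the
        bound on d is the reason for \<delta> \<le> 1/4.\<close>
      have "1 / d = d powr (- 1)" using d by (simp add: powr_minus_divide)
      also have "\<dots> \<le> d powr (l - 2)" using d d1 l by (intro powr_mono') auto
      finally have "B / d \<le> B * d powr (l - 2)" using eB mult_left_mono[of "1 / d" "d powr (l - 2)" B] by simp
      have "\<bar>\<mu> q * ker \<alpha> (\<nu> q) q p + \<kappa> * (w q * poisson_kernel h (proj q - b))\<bar> \<le>
          (\<bar>\<kappa>\<bar> + e) * C * d powr (l - 2) + B / d + K2 * (w q * poisson_kernel \<bar>h\<bar> (proj q - b))"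
        using kernel_pointwise[OF True p _ C \<epsilon> G[OF True] R[OF True]] neq True
        unfolding b_def[symmetric] h_def[symmetric] d_def[symmetric] ww K2_def by blast
      also have "\<dots> \<le> K1 * d powr (l - 2) + K2 * (w q * poisson_kernel \<bar>h\<bar> (proj q - b))"
        using \<open>B / d \<le> B * d powr (l - 2)\<close> by (simp add: K1_def algebra_simps)
      \<comment> \<open>As w \<ge> 1/2, inserting w costs a factor 2 and prepares the passage to the
        plane.\<close>
      also have "K1 * d powr (l - 2) \<le> (2 * K1) * (d powr (l - 2) * w q)"
      proof -
        have "(K1 * d powr (l - 2)) * (1/2) \<le> (K1 * d powr (l - 2)) * w q"
          using K ww by (intro mult_left_mono) auto
        then show ?thesis by (simp add: mult_ac)
      qed
      finally have "\<bar>\<mu> q * ker \<alpha> (\<nu> q) q p + \<kappa> * (w q * poisson_kernel h (proj q - b))\<bar> \<le>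
          (2 * K1) * (d powr (l - 2) * w q) + K2 * (poisson_kernel \<bar>h\<bar> (proj q - b) * w q)"
        by (simp add: mult.commute)
      then have "ennreal \<bar>\<mu> q * ker \<alpha> (\<nu> q) q p + \<kappa> * (w q * poisson_kernel h (proj q - b))\<bar> \<le>
          ennreal ((2 * K1) * (d powr (l - 2) * w q) + K2 * (poisson_kernel \<bar>h\<bar> (proj q - b) * w q))"
        by (rule ennreal_leI)
      also have "\<dots> = ennreal (2 * K1) * ?S q + ennreal K2 * ?Q q"
        using K w_nonneg[of q] unfolding d_def
        by (simp add: ennreal_plus ennreal_mult poisson_kernel_nonneg)
      finally show ?thesis using True by simp
    qed
  qed
  then have "(\<integral>\<^sup>+q. ennreal \<bar>indicator patch q * (\<mu> q * ker \<alpha> (\<nu> q) q p) +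
      \<kappa> * (w q * poisson_kernel h (proj q - b))\<bar> \<partial>area) \<le>
      (\<integral>\<^sup>+q. ennreal (2 * K1) * ?S q + ennreal K2 * ?Q q \<partial>area)"
    by (rule nn_integral_mono_AE)
  also have "\<dots> = ennreal (2 * K1) * (\<integral>\<^sup>+q. ?S q \<partial>area) + ennreal K2 * (\<integral>\<^sup>+q. ?Q q \<partial>area)"
    by (simp add: nn_integral_add nn_integral_cmult)
  also have "(\<integral>\<^sup>+q. ?S q \<partial>area) \<le> ennreal (16 / l\<^sup>2 * (2 * \<delta>) powr l)"
  proof -
    have "(\<integral>\<^sup>+q. ?S q \<partial>area) = (\<integral>\<^sup>+v. ennreal (norm (v - b) powr (l - 2)) * indicator (square \<delta>) v \<partial>lborel)"
      by (rule pushforward[of "\<lambda>a. ennreal (norm (a - b) powr (l - 2))"]) measurable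
    then show ?thesis using nn_integral_weakly_singular[OF _ _ \<delta>(1) b, of l] l by simp
  qed
  also have "(\<integral>\<^sup>+q. ?Q q \<partial>area) \<le> ennreal (2 * pi)"
  proof (cases "h = 0")
    case True
    then show ?thesis by (simp add: poisson_kernel_def)
  qed (simp add: nn_integral_poisson_area_le)
  also have "ennreal (2 * K1) * ennreal (16 / l\<^sup>2 * (2 * \<delta>) powr l) + ennreal K2 * ennreal (2 * pi) =
      ennreal (2 * K1 * (16 / l\<^sup>2 * (2 * \<delta>) powr l) + K2 * (2 * pi))"
  proof -
    have "ennreal x * ennreal y + ennreal u * ennreal v = ennreal (x * y + u * v)"
      if "0 \<le> x" "0 \<le> y" "0 \<le> u" "0 \<le> v" for x y u v
      using that by (simp only: ennreal_mult[symmetric] ennreal_plus[symmetric] mult_nonneg_nonneg)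
    then show ?thesis using K by simp
  qed
  finally show ?thesis by (simp add: b_def h_def mult_left_mono add_mono)
qed

text \<open>The kernel plus \<kappa> times the Poisson term is integrable with controlled integral,
  and the Poisson term is integrable with known integral. Subtraction gives integrability of the
  kernel and the value \<open>- sgn h * (2 * pi * \<kappa>)\<close> up to errors.\<close>

lemma near_estimate:
  fixes \<mu> :: "real^3 \<Rightarrow> real" and \<kappa> e B :: real
  defines "K1 \<equiv> (\<bar>\<kappa>\<bar> + e) * C + B" and "K2 \<equiv> 8 * e + 40 * \<epsilon> * \<bar>\<kappa>\<bar>"
  assumes p: "p \<in> cyl \<delta> H" "proj p \<in> square (\<delta> / 2)" and C: "C \<ge> 0" and \<epsilon>: "0 \<le> \<epsilon>" "\<epsilon> \<le> 1/2" and \<delta>: "0 < \<delta>" "\<delta> \<le> 1/4"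
    and l: "0 < l" "l \<le> 1" and eB: "e \<ge> 0" "B \<ge> 0"
    and G: "\<And>q. q \<in> patch \<Longrightarrow> \<bar>\<mu> q * ker_G \<alpha> q p - \<kappa>\<bar> \<le> e"
    and R: "\<And>q. q \<in> patch \<Longrightarrow> \<bar>\<mu> q * ker_R \<alpha> (\<nu> q) q p\<bar> \<le> B"
    and meas [measurable]: "(\<lambda>q. indicator patch q * (\<mu> q * ker \<alpha> (\<nu> q) q p)) \<in> borel_measurable borel"
  shows "integrable area (\<lambda>q. indicator patch q * (\<mu> q * ker \<alpha> (\<nu> q) q p))"
    and "\<bar>(\<integral>q. indicator patch q * (\<mu> q * ker \<alpha> (\<nu> q) q p) \<partial>area) + sgn (f (proj p) - height p) * (2 * pi * \<kappa>)\<bar> \<le>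
      2 * K1 * (16 / l\<^sup>2 * (2 * \<delta>) powr l) + K2 * (2 * pi) + \<bar>\<kappa>\<bar> * (16 * \<bar>f (proj p) - height p\<bar> / \<delta>)"
proof -
  define h where "h = f (proj p) - height p"
  let ?k = "\<lambda>q. indicator patch q * (\<mu> q * ker \<alpha> (\<nu> q) q p)"
  let ?y = "\<lambda>q. w q * poisson_kernel h (proj q - proj p)"
  let ?Z = "2 * K1 * (16 / l\<^sup>2 * (2 * \<delta>) powr l) + K2 * (2 * pi)"
  have K: "K1 \<ge> 0" "K2 \<ge> 0" using eB C \<epsilon> by (auto simp: K1_def K2_def intro!: add_nonneg_nonneg mult_nonneg_nonneg)
  then have Z: "?Z \<ge> 0" by simp
  have nb: "(\<integral>\<^sup>+q. ennreal \<bar>?k q + \<kappa> * ?y q\<bar> \<partial>area) \<le> ennreal ?Z"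
    using near_bound[OF p(1) C \<epsilon> \<delta> l eB G R] unfolding K1_def K2_def h_def by blast
  have y: "integrable area ?y" "\<bar>(\<integral>q. ?y q \<partial>area) - sgn h * (2 * pi)\<bar> \<le> 16 * \<bar>h\<bar> / \<delta>"
    using poisson_area[OF \<delta>(1) p(2), of h] by auto
  have ky: "integrable area (\<lambda>q. ?k q + \<kappa> * ?y q)"
  proof (rule integrableI_bounded)
    show "(\<lambda>q. ?k q + \<kappa> * ?y q) \<in> borel_measurable area" by measurable
    show "(\<integral>\<^sup>+q. ennreal (norm (?k q + \<kappa> * ?y q)) \<partial>area) < \<infinity>"
      using nb by (simp add: le_less_trans[OF _ ennreal_less_top])
  qed
  have "integrable area (\<lambda>q. (?k q + \<kappa> * ?y q) - \<kappa> * ?y q)"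
    by (intro Bochner_Integration.integrable_diff ky integrable_mult_right y)
  then show k: "integrable area ?k" by simp
  have "ennreal (norm (\<integral>q. ?k q + \<kappa> * ?y q \<partial>area)) \<le> (\<integral>\<^sup>+q. ennreal (norm (?k q + \<kappa> * ?y q)) \<partial>area)"
    by (rule integral_norm_bound_ennreal[OF ky])
  also have "\<dots> \<le> ennreal ?Z" using nb by simp
  finally have "\<bar>\<integral>q. ?k q + \<kappa> * ?y q \<partial>area\<bar> \<le> ?Z" using Z by simp
  moreover have "(\<integral>q. ?k q + \<kappa> * ?y q \<partial>area) = (\<integral>q. ?k q \<partial>area) + \<kappa> * (\<integral>q. ?y q \<partial>area)"
    using k y by simp
  ultimately have 1: "\<bar>(\<integral>q. ?k q \<partial>area) + \<kappa> * (\<integral>q. ?y q \<partial>area)\<bar> \<le> ?Z" by simp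
  have 2: "\<bar>\<kappa> * ((\<integral>q. ?y q \<partial>area) - sgn h * (2 * pi))\<bar> \<le> \<bar>\<kappa>\<bar> * (16 * \<bar>h\<bar> / \<delta>)"
    unfolding abs_mult using y(2) by (intro mult_left_mono) auto
  have "(\<integral>q. ?k q \<partial>area) + sgn h * (2 * pi * \<kappa>) =
      ((\<integral>q. ?k q \<partial>area) + \<kappa> * (\<integral>q. ?y q \<partial>area)) - \<kappa> * ((\<integral>q. ?y q \<partial>area) - sgn h * (2 * pi))"
    by (simp add: algebra_simps)
  then have "\<bar>(\<integral>q. ?k q \<partial>area) + sgn h * (2 * pi * \<kappa>)\<bar> \<le> ?Z + \<bar>\<kappa>\<bar> * (16 * \<bar>h\<bar> / \<delta>)"
    using abs_triangle_ineq4[of "(\<integral>q. ?k q \<partial>area) + \<kappa> * (\<integral>q. ?y q \<partial>area)" "\<kappa> * ((\<integral>q. ?y q \<partial>area) - sgn h * (2 * pi))"] 1 2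
    by linarith
  then show "\<bar>(\<integral>q. ?k q \<partial>area) + sgn (f (proj p) - height p) * (2 * pi * \<kappa>)\<bar> \<le>
      ?Z + \<bar>\<kappa>\<bar> * (16 * \<bar>f (proj p) - height p\<bar> / \<delta>)"
    by (simp only: h_def)
qed

end

section \<open>The jump relations\<close>

locale layer = parametrized P s1 s2 t1 t2 for P s1 s2 t1 t2 +
  fixes \<Gamma> D :: "(real^3) set" and \<nu> :: "real^3 \<Rightarrow> real^3" and \<mu> :: "real^3 \<Rightarrow> real" and \<alpha> A l d :: real
  assumes \<alpha>: "0 < 2 * \<alpha>" "2 * \<alpha> < 1"
    and P_R: "P ` R = closure \<Gamma>"
    and \<Gamma>_pos: "\<And>q. q \<in> \<Gamma> \<Longrightarrow> q $ 1 > 0"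
    and \<Gamma>_bd: "\<And>q. q \<in> closure \<Gamma> \<Longrightarrow> q \<notin> \<Gamma> \<Longrightarrow> q $ 1 = 0"
    and normal: "\<And>M. M \<in> \<Gamma> \<Longrightarrow> unit_normal_at \<Gamma> M (\<nu> M)"
    and d: "d > 0" and line: "\<And>N p q c. N \<in> \<Gamma> \<Longrightarrow> p \<in> \<Gamma> \<Longrightarrow> p \<in> ball N d \<Longrightarrow> q \<in> \<Gamma> \<Longrightarrow> q \<in> ball N d \<Longrightarrow>
        q = p + c *\<^sub>R \<nu> N \<Longrightarrow> q = p"
    and A: "A > 0" "0 < l" "l \<le> 1"
    and holder: "\<And>M M'. M \<in> \<Gamma> \<Longrightarrow> M' \<in> \<Gamma> \<Longrightarrow> norm (\<nu> M - \<nu> M') \<le> A * dist M M' powr l"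
    and D: "open D" and front: "\<And>p. p \<in> frontier D \<Longrightarrow> p $ 1 > 0 \<Longrightarrow> p \<in> \<Gamma>"
    and \<Gamma>_front: "\<Gamma> \<subseteq> frontier D" and out: "\<And>N. N \<in> \<Gamma> \<Longrightarrow> outward_at D N (\<nu> N)"
    and \<mu>_cont: "continuous_on (closure \<Gamma>) \<mu>"
begin

lemma unit_\<nu>: "q \<in> \<Gamma> \<Longrightarrow> norm (\<nu> q) = 1"
  using normal by (simp add: unit_normal_at_def)

lemma \<nu>_cont: "continuous_on \<Gamma> \<nu>"
  unfolding continuous_on_def
proof
  fix M assume M: "M \<in> \<Gamma>"
  have "((\<lambda>x. dist x M) \<longlongrightarrow> 0) (at M within \<Gamma>)"
  proof -
    have "((\<lambda>x. dist x M) \<longlongrightarrow> dist M M) (at M within \<Gamma>)" by (intro tendsto_intros)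
    then show ?thesis by simp
  qed
  then have "((\<lambda>x. dist x M powr l) \<longlongrightarrow> 0) (at M within \<Gamma>)"
    by (rule tendsto_zero_powrI[OF _ tendsto_const]) (use A in auto)
  then have lim: "((\<lambda>x. A * dist x M powr l) \<longlongrightarrow> 0) (at M within \<Gamma>)"
    by (rule tendsto_mult_right_zero)
  have "((\<lambda>x. \<nu> x - \<nu> M) \<longlongrightarrow> 0) (at M within \<Gamma>)"
  proof (rule Lim_null_comparison[OF _ lim])
    have "\<forall>\<^sub>F x in at M within \<Gamma>. x \<in> \<Gamma>" by (simp add: eventually_at_filter)
    then show "\<forall>\<^sub>F x in at M within \<Gamma>. norm (\<nu> x - \<nu> M) \<le> A * dist x M powr l"
      by eventually_elim (use holder M in blast)
  qed
  then show "(\<nu> \<longlongrightarrow> \<nu> M) (at M within \<Gamma>)" by (rule LIM_zero_cancel)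
qed

lemma closure_\<Gamma>_nonneg: "q \<in> closure \<Gamma> \<Longrightarrow> q $ 1 \<ge> 0"
  using \<Gamma>_pos[of q] \<Gamma>_bd[of q] by (cases "q \<in> \<Gamma>") auto

lemma \<Gamma>_eq: "\<Gamma> = closure \<Gamma> \<inter> {q. q $ 1 > 0}"
  using \<Gamma>_pos \<Gamma>_bd closure_subset[of \<Gamma>] by force

lemma \<Gamma>_borel [measurable]: "\<Gamma> \<in> sets borel"
proof -
  have "{q::real^3. q $ 1 > 0} \<in> sets borel" by measurable
  then show ?thesis using sets.Int[OF borel_closed[OF closed_closure[of \<Gamma>]]] \<Gamma>_eq by metis
qed

lemma compact_closure_\<Gamma>: "compact (closure \<Gamma>)"
  using compact_continuous_image[OF P_cont R_compact] P_R by simp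

lemma \<mu>_bounded: obtains M where "M \<ge> 0" "\<And>q. q \<in> closure \<Gamma> \<Longrightarrow> \<bar>\<mu> q\<bar> \<le> M"
proof -
  have "bounded (\<mu> ` closure \<Gamma>)"
    by (intro compact_imp_bounded compact_continuous_image \<mu>_cont compact_closure_\<Gamma>)
  then obtain M where "\<And>q. q \<in> closure \<Gamma> \<Longrightarrow> \<bar>\<mu> q\<bar> \<le> M" by (auto simp: bounded_iff)
  then show ?thesis by (intro that[of "max M 0"]) (auto intro: max.coboundedI1)
qed

definition integrand :: "real^3 \<Rightarrow> real^3 \<Rightarrow> real" where
  "integrand p q = indicator \<Gamma> q * (\<mu> q * ker \<alpha> (\<nu> q) q p)"

lemma integrand_measurable [measurable]: "integrand p \<in> borel_measurable borel"
proof -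
  have [measurable]: "(\<lambda>q. if q \<in> \<Gamma> then \<nu> q else 0) \<in> borel_measurable borel"
    by (intro borel_measurable_continuous_on_if \<Gamma>_borel \<nu>_cont continuous_on_const)
  have [measurable]: "(\<lambda>q. if q \<in> \<Gamma> then \<mu> q else 0) \<in> borel_measurable borel"
    by (intro borel_measurable_continuous_on_if \<Gamma>_borel continuous_on_subset[OF \<mu>_cont closure_subset] continuous_on_const)
  have [measurable]: "(\<lambda>q. ker \<alpha> (if q \<in> \<Gamma> then \<nu> q else 0) q p) \<in> borel_measurable borel"
    by (rule ker_measurable) measurable
  have "integrand p = (\<lambda>q. indicator \<Gamma> q * ((if q \<in> \<Gamma> then \<mu> q else 0) * ker \<alpha> (if q \<in> \<Gamma> then \<nu> q else 0) q p))"
    by (auto simp: integrand_def fun_eq_iff indicator_def)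
  also have "\<dots> \<in> borel_measurable borel" by measurable
  finally show ?thesis .
qed

definition W :: "real^3 \<Rightarrow> real" where "W p = (\<integral>q. integrand p q \<partial>area)"

lemma integrand_bound:
  assumes c: "c > 0"
  obtains M where "\<And>p q. p $ 1 \<ge> 0 \<Longrightarrow> norm p \<le> B \<Longrightarrow> q \<in> closure \<Gamma> \<Longrightarrow> c \<le> norm (q - p) \<Longrightarrow> \<bar>integrand p q\<bar> \<le> M"
proof -
  obtain B1 where B1: "\<And>q. q \<in> closure \<Gamma> \<Longrightarrow> norm q \<le> B1"
    using compact_imp_bounded[OF compact_closure_\<Gamma>] by (auto simp: bounded_iff)
  obtain M1 where M1: "M1 \<ge> 0" "\<And>q. q \<in> closure \<Gamma> \<Longrightarrow> \<bar>\<mu> q\<bar> \<le> M1" using \<mu>_bounded by metis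
  obtain M where M: "\<And>m q p. norm m = 1 \<Longrightarrow> 0 \<le> q $ 1 \<Longrightarrow> 0 \<le> p $ 1 \<Longrightarrow> c \<le> norm (q - p) \<Longrightarrow>
     norm q \<le> max B B1 \<Longrightarrow> norm p \<le> max B B1 \<Longrightarrow> \<bar>ker \<alpha> m q p\<bar> \<le> M"
    using ker_far_bound[OF \<alpha> c, of "max B B1"] by metis
  show ?thesis
  proof (rule that[of "M1 * \<bar>M\<bar>"])
    fix p q assume pq: "p $ 1 \<ge> 0" "norm p \<le> B" "q \<in> closure \<Gamma>" "c \<le> norm (q - p)"
    show "\<bar>integrand p q\<bar> \<le> M1 * \<bar>M\<bar>"
    proof (cases "q \<in> \<Gamma>")
      case True
      have "\<bar>ker \<alpha> (\<nu> q) q p\<bar> \<le> \<bar>M\<bar>"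
        using M[OF unit_\<nu>[OF True] closure_\<Gamma>_nonneg[OF pq(3)] pq(1,4)] B1[OF pq(3)] pq(2) by fastforce
      then show ?thesis using True M1 pq by (simp add: integrand_def abs_mult mult_mono)
    qed (use M1 in \<open>simp add: integrand_def\<close>)
  qed
qed

lemma AE_closure: "AE q in area. q \<in> closure \<Gamma>"
  using AE_area by (simp add: P_R)

lemma integrable_integrand_off_surface:
  assumes p: "p $ 1 > 0" "p \<notin> \<Gamma>"
  shows "integrable area (integrand p)"
proof -
  interpret finite_measure area by (rule finite_measure_area)
  have "p \<notin> closure \<Gamma>" using \<Gamma>_bd[of p] p by auto
  then obtain c where c: "c > 0" "\<And>q. q \<in> closure \<Gamma> \<Longrightarrow> c \<le> dist p q"
    using separate_point_closed[of "closure \<Gamma>" p] by auto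
  obtain M where M: "\<And>p' q. p' $ 1 \<ge> 0 \<Longrightarrow> norm p' \<le> norm p \<Longrightarrow> q \<in> closure \<Gamma> \<Longrightarrow> c \<le> norm (q - p') \<Longrightarrow> \<bar>integrand p' q\<bar> \<le> M"
    using integrand_bound[OF c(1), of "norm p"] by metis
  show ?thesis
  proof (rule integrable_const_bound)
    show "AE q in area. norm (integrand p q) \<le> M"
      using AE_closure by (rule eventually_mono) (use c p in \<open>auto intro!: M simp: dist_norm norm_minus_commute\<close>)
  qed measurable
qed

lemma chart_exists:
  assumes N: "N \<in> \<Gamma>" and \<epsilon>: "\<epsilon> > 0" and \<rho>: "\<rho> > 0"
  obtains e1 e2 \<delta> H f where "0 < \<delta>" "\<delta> < \<rho>" "0 < H" "H < \<rho>"
    "local_chart P s1 s2 t1 t2 N e1 e2 (\<nu> N) \<Gamma> D \<nu> (4 * A) l \<epsilon> \<delta> H f"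
    "tangent_frame.cyl N e1 e2 (\<nu> N) \<delta> H \<subseteq> ball N (3 * \<rho>)"
proof -
  obtain e1 e2 where fr: "tangent_frame e1 e2 (\<nu> N)" using tangent_frame_exists[OF unit_\<nu>[OF N]] by metis
  interpret tangent_frame N e1 e2 "\<nu> N" by (rule fr)
  \<comment> \<open>Cylinders of this size stay in x > 0 and so avoid the boundary curve of
    \<Gamma>.\<close>
  define \<rho>' where "\<rho>' = min \<rho> (N $ 1 / 3)"
  have \<rho>': "\<rho>' > 0" "\<rho>' \<le> \<rho>" "3 * \<rho>' \<le> N $ 1" using \<rho> \<Gamma>_pos[OF N] by (auto simp: \<rho>'_def)
  obtain \<delta> H f where *: "0 < \<delta>" "\<delta> < \<rho>'" "0 < H" "H < \<rho>'" "local_graph \<Gamma> \<nu> D (4 * A) l \<epsilon> \<delta> H f"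
  proof (rule local_graph_exists[where \<nu> = \<nu>, OF N refl \<Gamma>_pos[OF N] D _ \<Gamma>_front out[OF N] _ d _ A _ \<epsilon> \<rho>'(1)])
    show "\<And>p. p \<in> frontier D \<Longrightarrow> p $ 1 > 0 \<Longrightarrow> p \<in> \<Gamma>" by (rule front)
    show "\<And>M. M \<in> \<Gamma> \<Longrightarrow> unit_normal_at \<Gamma> M (\<nu> M)" by (rule normal)
    show "\<And>p q c. p \<in> \<Gamma> \<Longrightarrow> p \<in> ball N d \<Longrightarrow> q \<in> \<Gamma> \<Longrightarrow> q \<in> ball N d \<Longrightarrow> q = p + c *\<^sub>R \<nu> N \<Longrightarrow> q = p"
      by (rule line[OF N])
    show "\<And>M M'. M \<in> \<Gamma> \<Longrightarrow> M' \<in> \<Gamma> \<Longrightarrow> norm (\<nu> M - \<nu> M') \<le> A * dist M M' powr l" by (rule holder)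
  qed (rule that)
  have cyl: "cyl \<delta> H \<subseteq> ball N (3 * \<rho>')" using cyl_subset_ball[of \<delta> H] * by force
  have "q $ 1 > 0" if "q \<in> cyl \<delta> H" for q
  proof -
    have "\<bar>(N - q) $ 1\<bar> \<le> norm (N - q)" by (rule component_le_norm_cart)
    also have "\<dots> < 3 * \<rho>'" using that cyl by (auto simp: dist_norm)
    finally show ?thesis using \<rho>' by simp
  qed
  then have "closure \<Gamma> \<inter> cyl \<delta> H \<subseteq> \<Gamma>" using \<Gamma>_bd by fastforce
  then have "local_chart P s1 s2 t1 t2 N e1 e2 (\<nu> N) \<Gamma> D \<nu> (4 * A) l \<epsilon> \<delta> H f"
    by unfold_locales (use P_R * normal \<nu>_cont in auto)
  moreover have "cyl \<delta> H \<subseteq> ball N (3 * \<rho>)" using cyl \<rho>' by (auto intro: order.strict_trans2)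
  ultimately show ?thesis using that[of \<delta> H e1 e2 f] * \<rho>' by auto
qed

text \<open>Any chart at N shows that the single point is null; its slope and size are arbitrary and
  set to 1.\<close>

lemma AE_neq_\<Gamma>:
  assumes N: "N \<in> \<Gamma>" shows "AE q in area. q \<noteq> N"
proof -
  obtain e1 e2 \<delta> H f where c: "0 < \<delta>" "0 < H" "local_chart P s1 s2 t1 t2 N e1 e2 (\<nu> N) \<Gamma> D \<nu> (4 * A) l 1 \<delta> H f"
    using chart_exists[OF N zero_less_one zero_less_one] by metis
  interpret c: local_chart P s1 s2 t1 t2 N e1 e2 "\<nu> N" \<Gamma> D \<nu> "4 * A" l 1 \<delta> H f by (rule c(3))
  have "N \<in> c.patch" using N c by (simp add: c.patch_def c.cyl_def square_def zero_prod_def)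
  then show ?thesis using c.AE_neq[of N] by (auto elim!: eventually_mono)
qed

lemma surface_integral_integrand:
  assumes p: "p $ 1 > 0"
  shows "surface_integrable P s1 s2 t1 t2 (\<lambda>u. \<mu> (P u) * conormal_deriv \<alpha> (\<nu> (P u)) (\<lambda>q. q1 \<alpha> q p) (P u)) \<longleftrightarrow>
      integrable area (integrand p)"
    and "surface_integral P s1 s2 t1 t2 (\<lambda>u. \<mu> (P u) * conormal_deriv \<alpha> (\<nu> (P u)) (\<lambda>q. q1 \<alpha> q p) (P u)) = W p"
proof -
  define k where "k q = \<mu> q * conormal_deriv \<alpha> (\<nu> q) (\<lambda>q. q1 \<alpha> q p) q" for q
  define k0 where "k0 q = (if q \<in> P ` R then k q else 0)" for q
  have eq: "k0 q = integrand p q" if "q \<noteq> p" for q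
  proof -
    consider "q \<in> \<Gamma>" | "q \<in> closure \<Gamma>" "q \<notin> \<Gamma>" | "q \<notin> closure \<Gamma>" by blast
    then show ?thesis
    proof cases
      case 1
      then have "q \<in> P ` R" using closure_subset[of \<Gamma>] P_R by auto
      then show ?thesis
        using 1 conormal_deriv_q1[OF \<alpha> p, of q "\<nu> q"] \<Gamma>_pos[OF 1] that by (simp add: k0_def k_def integrand_def)
    next
      case 2
      \<comment> \<open>On the boundary curve the factor \<open>(q $ 1) powr (2 * \<alpha>)\<close>
        of the conormal derivative is 0.\<close>
      then show ?thesis using \<Gamma>_bd[of q] by (simp add: k0_def k_def integrand_def conormal_deriv_def)
    next
      case 3
      then have "q \<notin> P ` R" "q \<notin> \<Gamma>" using closure_subset[of \<Gamma>] P_R by auto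
      then show ?thesis by (simp add: k0_def integrand_def)
    qed
  qed
  have "k0 = (\<lambda>q. if q = p then k0 p else integrand p q)" using eq by auto
  also have "\<dots> \<in> borel_measurable borel" by measurable
  finally have m [measurable]: "k0 \<in> borel_measurable borel" .
  have ae: "AE q in area. k0 q = integrand p q"
  proof (cases "p \<in> \<Gamma>")
    case True
    then show ?thesis using AE_neq_\<Gamma>[OF True] eq by (auto elim!: eventually_mono)
  next
    case False
    then have "p \<notin> closure \<Gamma>" using \<Gamma>_bd[of p] p by auto
    then have "k0 p = integrand p p" using False P_R by (simp add: k0_def integrand_def)
    then have "k0 q = integrand p q" for q using eq by (cases "q = p") auto
    then show ?thesis by simp
  qed
  have m': "(\<lambda>q. if q \<in> P ` R then k q else 0) \<in> borel_measurable borel" using m by (simp add: k0_def[abs_def])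
  have "integrable area k0 \<longleftrightarrow> integrable area (integrand p)" "(\<integral>q. k0 q \<partial>area) = W p"
    unfolding W_def using ae by (intro integrable_cong_AE integral_cong_AE; measurable)+
  then show "surface_integrable P s1 s2 t1 t2 (\<lambda>u. \<mu> (P u) * conormal_deriv \<alpha> (\<nu> (P u)) (\<lambda>q. q1 \<alpha> q p) (P u)) \<longleftrightarrow>
      integrable area (integrand p)"
    "surface_integral P s1 s2 t1 t2 (\<lambda>u. \<mu> (P u) * conormal_deriv \<alpha> (\<nu> (P u)) (\<lambda>q. q1 \<alpha> q p) (P u)) = W p"
    using surface_integral_area[OF m'] by (simp_all add: k0_def[abs_def] k_def)
qed

text \<open>Dominated convergence along sequences. If q lies outside C and p within r/2 of N, their
  distance is at least r/2, so the integrand is uniformly bounded on the surface, whose area is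
  finite.\<close>

lemma far_continuous:
  assumes N: "N \<in> \<Gamma>" and C: "open C" "N \<in> C" "C \<subseteq> {q. q $ 1 > 0}"
  shows "isCont (\<lambda>p. \<integral>q. indicator (- C) q * integrand p q \<partial>area) N"
    and "\<exists>r>0. \<forall>p\<in>ball N r. integrable area (\<lambda>q. indicator (- C) q * integrand p q)"
proof -
  interpret finite_measure area by (rule finite_measure_area)
  have [measurable]: "C \<in> sets borel" using C by auto
  obtain r where r: "r > 0" "ball N r \<subseteq> C" using C openE by blast
  have pos: "p $ 1 \<ge> 0" if "p \<in> ball N (r / 2)" for p
  proof -
    have "p \<in> ball N r" using that r by auto
    then have "p $ 1 > 0" using r(2) C(3) by blast
    then show ?thesis by simp
  qed
  obtain M where M: "\<And>p q. p $ 1 \<ge> 0 \<Longrightarrow> norm p \<le> norm N + r \<Longrightarrow> q \<in> closure \<Gamma> \<Longrightarrow> r / 2 \<le> norm (q - p) \<Longrightarrow> \<bar>integrand p q\<bar> \<le> M"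
    using integrand_bound[of "r / 2" "norm N + r"] r by (metis half_gt_zero)
  have bound: "\<bar>indicator (- C) q * integrand p q\<bar> \<le> \<bar>M\<bar>" if p: "p \<in> ball N (r / 2)" and q: "q \<in> closure \<Gamma>" for p q
  proof (cases "q \<in> C")
    case False
    then have "\<not> dist N q < r" using r by auto
    then have "r / 2 \<le> norm (q - p)"
      using p dist_triangle[of N q p] by (auto simp: dist_norm norm_minus_commute)
    moreover have "norm p \<le> norm N + r"
      using p r norm_triangle_ineq4[of N "N - p"] by (auto simp: dist_norm)
    ultimately show ?thesis using M[OF pos[OF p] _ q] False by fastforce
  qed simp
  have ae: "AE q in area. norm (indicator (- C) q * integrand p q) \<le> \<bar>M\<bar>" if "p \<in> ball N (r / 2)" for p
    using AE_closure by (rule eventually_mono) (use bound[OF that] in auto)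
  show "\<exists>r>0. \<forall>p\<in>ball N r. integrable area (\<lambda>q. indicator (- C) q * integrand p q)"
    using r ae by (intro exI[of _ "r / 2"]) (auto intro!: integrable_const_bound)
  show "isCont (\<lambda>p. \<integral>q. indicator (- C) q * integrand p q \<partial>area) N"
    unfolding continuous_at_sequentially
  proof (intro allI impI)
    fix X assume X: "X \<longlonglongrightarrow> N"
    have "\<forall>\<^sub>F n in sequentially. X n \<in> ball N (r / 2)"
      using X r by (intro topological_tendstoD) auto
    then obtain n0 where n0: "\<And>n. n \<ge> n0 \<Longrightarrow> X n \<in> ball N (r / 2)" by (auto simp: eventually_sequentially)
    define Y where "Y n = X (n + n0)" for n
    have Y: "Y \<longlonglongrightarrow> N" unfolding Y_def using X by (rule LIMSEQ_ignore_initial_segment)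
    have "(\<lambda>n. \<integral>q. indicator (- C) q * integrand (Y n) q \<partial>area) \<longlonglongrightarrow> (\<integral>q. indicator (- C) q * integrand N q \<partial>area)"
    proof (rule integral_dominated_convergence[where w = "\<lambda>_. \<bar>M\<bar>"])
      show "AE q in area. (\<lambda>n. indicator (- C) q * integrand (Y n) q) \<longlonglongrightarrow> indicator (- C) q * integrand N q"
      proof (rule AE_I2)
        fix q
        show "(\<lambda>n. indicator (- C) q * integrand (Y n) q) \<longlonglongrightarrow> indicator (- C) q * integrand N q"
        proof (cases "q \<in> \<Gamma> - C")
          case True
          \<comment> \<open>N lies in C, and its mirror image has negative first coordinate.\<close>
          then have "q \<noteq> N" "q \<noteq> mirror N"
            using C \<Gamma>_pos[of q] \<Gamma>_pos[OF N] by (auto simp: mirror_def)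
          then have "isCont (\<lambda>p. ker \<alpha> (\<nu> q) q p) N" by (rule isCont_ker)
          then have "(\<lambda>n. ker \<alpha> (\<nu> q) q (Y n)) \<longlonglongrightarrow> ker \<alpha> (\<nu> q) q N"
            using Y by (rule isCont_tendsto_compose)
          then show ?thesis unfolding integrand_def by (intro tendsto_intros)
        next
          case False
          then have "indicator (- C) q * integrand p q = 0" for p by (auto simp: integrand_def indicator_def)
          then show ?thesis by (simp only: tendsto_const)
        qed
      qed
      show "AE q in area. norm (indicator (- C) q * integrand (Y n) q) \<le> \<bar>M\<bar>" for n
        unfolding Y_def by (rule ae, rule n0) simp
      show "(\<lambda>q. indicator (- C) q * integrand N q) \<in> borel_measurable area" by measurable
      show "(\<lambda>q. indicator (- C) q * integrand (Y n) q) \<in> borel_measurable area" for n by measurable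
      show "integrable area (\<lambda>_. \<bar>M\<bar>)" by simp
    qed
    then have "(\<lambda>n. (\<lambda>p. \<integral>q. indicator (- C) q * integrand p q \<partial>area) (X (n + n0))) \<longlonglongrightarrow> (\<integral>q. indicator (- C) q * integrand N q \<partial>area)"
      by (simp add: Y_def)
    then show "((\<lambda>p. \<integral>q. indicator (- C) q * integrand p q \<partial>area) \<circ> X) \<longlonglongrightarrow> (\<integral>q. indicator (- C) q * integrand N q \<partial>area)"
      unfolding o_def by (rule LIMSEQ_offset)
  qed
qed

lemma norm_mirror_diff: "norm (mirror x - mirror y) = norm (x - y)"
proof -
  have "(- x $ 1 + y $ 1)\<^sup>2 = (x $ 1 - y $ 1)\<^sup>2" by (simp add: power2_commute)
  then show ?thesis by (simp add: norm_real3 mirror_def)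
qed

text \<open>Write x for the first coordinate of N. On the ball of radius x/2 about N all first
  coordinates exceed x/2, so the distance from a point to a mirror image lies between x and
  4x.\<close>

lemma ker_R_near:
  assumes N: "N $ 1 > 0"
  obtains M where "M \<ge> 0" "\<And>m q p. norm m = 1 \<Longrightarrow> q \<in> ball N (N $ 1 / 2) \<Longrightarrow> p \<in> ball N (N $ 1 / 2) \<Longrightarrow> \<bar>ker_R \<alpha> m q p\<bar> \<le> M"
proof -
  let ?x = "N $ 1"
  obtain M where M: "M \<ge> 0" "\<And>m q p. norm m = 1 \<Longrightarrow> 0 \<le> q $ 1 \<Longrightarrow> q $ 1 \<le> 4 * ?x \<Longrightarrow> ?x \<le> norm (q - mirror p) \<Longrightarrow>
     norm (q - p) \<le> 4 * ?x \<Longrightarrow> norm (q - mirror p) \<le> 4 * ?x \<Longrightarrow> \<bar>ker_R \<alpha> m q p\<bar> \<le> M"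
    using ker_R_bound[OF \<alpha> N, of "4 * ?x"] by metis
  show ?thesis
  proof (rule that[OF M(1)])
    fix m q p :: "real^3"
    assume m: "norm m = 1" and q: "q \<in> ball N (?x / 2)" and p: "p \<in> ball N (?x / 2)"
    have nq: "norm (q - N) < ?x / 2" and np: "norm (p - N) < ?x / 2" "norm (N - p) < ?x / 2"
      using q p by (simp_all add: dist_norm norm_minus_commute)
    have cq: "\<bar>q $ 1 - ?x\<bar> < ?x / 2" "\<bar>p $ 1 - ?x\<bar> < ?x / 2"
      using component_le_norm_cart[of "q - N" 1] component_le_norm_cart[of "p - N" 1] nq np by simp_all
    have 1: "?x \<le> norm (q - mirror p)"
      using norm_mirror_ge(2)[of p q] cq by linarith
    have "q - p = (q - N) + (N - p)" by simp
    then have 2: "norm (q - p) \<le> norm (q - N) + norm (N - p)" by (metis norm_triangle_ineq)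
    have "q - mirror p = (q - N) + ((N - mirror N) + (mirror N - mirror p))" by simp
    then have "norm (q - mirror p) \<le> norm (q - N) + norm ((N - mirror N) + (mirror N - mirror p))" by (metis norm_triangle_ineq)
    also have "\<dots> \<le> norm (q - N) + (norm (N - mirror N) + norm (mirror N - mirror p))"
      by (intro add_left_mono norm_triangle_ineq)
    also have "\<dots> \<le> ?x / 2 + (2 * ?x + ?x / 2)"
      using nq np norm_minus_mirror_self[of N] N by (simp add: norm_mirror_diff)
    finally have 3: "norm (q - mirror p) \<le> 4 * ?x" using N by linarith
    show "\<bar>ker_R \<alpha> m q p\<bar> \<le> M" using 1 2 3 nq np cq N by (intro M m) linarith+
  qed
qed

text \<open>The tolerance is distributed in advance: e/4 for the oscillation of the density and of
  \<open>ker_G\<close>, e/4 for the slope \<epsilon>, e/4 for the weak singularity through \<delta>,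
  and e/4 for the Poisson mass outside the square. Only the last one constrains p, once the chart is
  fixed. There is no circularity, since K1 and T do not depend on \<delta>.\<close>

lemma local_estimate:
  assumes N: "N \<in> \<Gamma>" and e: "e > 0"
  obtains C \<rho> where "open C" "N \<in> C" "C \<subseteq> {q. q $ 1 > 0}" "\<rho> > 0"
    "\<And>p. p \<in> ball N \<rho> \<Longrightarrow> integrable area (\<lambda>q. indicator C q * integrand p q)"
    "\<bar>\<integral>q. indicator C q * integrand N q \<partial>area\<bar> < e"
    "\<And>p. p \<in> ball N \<rho> \<Longrightarrow> p \<in> D \<Longrightarrow> \<bar>(\<integral>q. indicator C q * integrand p q \<partial>area) + \<mu> N / 2\<bar> < e"
    "\<And>p. p \<in> ball N \<rho> \<Longrightarrow> p \<notin> closure D \<Longrightarrow> \<bar>(\<integral>q. indicator C q * integrand p q \<partial>area) - \<mu> N / 2\<bar> < e"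
proof -
  have N1: "N $ 1 > 0" by (rule \<Gamma>_pos[OF N])
  define \<kappa> where "\<kappa> = \<mu> N / (4 * pi)"
  \<comment> \<open>The constants 8 and 40 of \<open>near_estimate\<close>, multiplied by the
    Poisson mass 2 pi, must each leave e/4: hence 64 and 320. The summand 1 covers \<kappa> =
    0.\<close>
  define e1 where "e1 = e / (64 * pi)"
  define \<epsilon> where "\<epsilon> = min (1/2) (e / (320 * pi * (\<bar>\<kappa>\<bar> + 1)))"
  have e1: "e1 > 0" using e by (simp add: e1_def)
  have \<epsilon>: "\<epsilon> > 0" "\<epsilon> \<le> 1/2" using e by (auto simp: \<epsilon>_def intro!: divide_pos_pos mult_pos_pos)
  have K2: "(8 * e1 + 40 * \<epsilon> * \<bar>\<kappa>\<bar>) * (2 * pi) \<le> e / 2"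
  proof -
    have "\<epsilon> * (\<bar>\<kappa>\<bar> + 1) \<le> e / (320 * pi * (\<bar>\<kappa>\<bar> + 1)) * (\<bar>\<kappa>\<bar> + 1)"
      unfolding \<epsilon>_def by (intro mult_right_mono min.cobounded2) auto
    also have "\<dots> = e / (320 * pi)"
    proof -
      have "\<bar>\<kappa>\<bar> + 1 \<noteq> 0" by linarith
      then show ?thesis by simp
    qed
    finally have "\<epsilon> * \<bar>\<kappa>\<bar> \<le> e / (320 * pi)" using \<epsilon> by (simp add: distrib_left)
    then have "40 * (\<epsilon> * \<bar>\<kappa>\<bar>) * (2 * pi) \<le> 40 * (e / (320 * pi)) * (2 * pi)"
      by (intro mult_right_mono mult_left_mono) auto
    also have "\<dots> = e / 4" by simp
    finally have "40 * (\<epsilon> * \<bar>\<kappa>\<bar>) * (2 * pi) \<le> e / 4" .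
    moreover have "8 * e1 * (2 * pi) = e / 4" by (simp add: e1_def)
    ultimately show ?thesis by (simp add: distrib_right mult.assoc)
  qed
  obtain M1 where M1: "M1 \<ge> 0" "\<And>q. q \<in> closure \<Gamma> \<Longrightarrow> \<bar>\<mu> q\<bar> \<le> M1" using \<mu>_bounded by metis
  obtain MR where MR: "MR \<ge> 0" "\<And>m q p. norm m = 1 \<Longrightarrow> q \<in> ball N (N $ 1 / 2) \<Longrightarrow> p \<in> ball N (N $ 1 / 2) \<Longrightarrow> \<bar>ker_R \<alpha> m q p\<bar> \<le> MR"
    using ker_R_near[OF N1] by metis
  define B where "B = M1 * MR"
  define K1 where "K1 = (\<bar>\<kappa>\<bar> + e1) * (4 * A) + B"
  have K1: "K1 \<ge> 0" "B \<ge> 0" using e1 A M1 MR by (auto simp: K1_def B_def)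
  define T where "T = 2 * K1 * (16 / l\<^sup>2)"
  have T: "T \<ge> 0" using K1 by (simp add: T_def)
  \<comment> \<open>Chosen so that T times \<open>(2 * \<rho>1) powr l\<close> is at most e/4; T + 1
    avoids division by 0.\<close>
  define \<rho>1 where "\<rho>1 = (e / (4 * (T + 1))) powr (1 / l) / 2"
  have \<rho>1: "\<rho>1 > 0" using e T by (simp add: \<rho>1_def)
  have T\<delta>: "2 * K1 * (16 / l\<^sup>2 * (2 * \<delta>) powr l) \<le> e / 4" if "0 < \<delta>" "\<delta> < \<rho>1" for \<delta>
  proof -
    have "(2 * \<delta>) powr l \<le> (2 * \<rho>1) powr l" using that A by (intro powr_mono2) auto
    also have "\<dots> = e / (4 * (T + 1))" using A e T by (simp add: \<rho>1_def powr_powr)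
    finally have "T * (2 * \<delta>) powr l \<le> T * (e / (4 * (T + 1)))" using T by (intro mult_left_mono)
    also have "\<dots> = e / 4 * (T / (T + 1))" by simp
    also have "\<dots> \<le> e / 4 * 1" using e T by (intro mult_left_mono) auto
    finally show ?thesis by (simp add: T_def mult.assoc)
  qed
  \<comment> \<open>Half of e1 goes to the deviation of \<open>ker_G\<close>, multiplied by the
    bound M1 of the density, and half to the oscillation of the density.\<close>
  define e2 where "e2 = e1 / (2 * (M1 + 1))"
  have e2: "e2 > 0" using e1 M1 by (simp add: e2_def)
  obtain \<rho>2 where \<rho>2: "\<rho>2 > 0" "\<And>q p. dist q N < \<rho>2 \<Longrightarrow> dist p N < \<rho>2 \<Longrightarrow> \<bar>ker_G \<alpha> q p - 1 / (4 * pi)\<bar> < e2"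
    using ker_G_near_diagonal[OF N1 e2] by metis
  have "N \<in> closure \<Gamma>" using N closure_subset by blast
  then obtain \<rho>3 where \<rho>3: "\<rho>3 > 0" "\<And>q. q \<in> closure \<Gamma> \<Longrightarrow> dist q N < \<rho>3 \<Longrightarrow> dist (\<mu> q) (\<mu> N) < e1 / 2"
    using \<mu>_cont half_gt_zero[OF e1] unfolding continuous_on_iff by metis
  \<comment> \<open>The cylinder will lie in the ball of radius \<open>3 * \<rho>0\<close>, which
    explains the thirds.\<close>
  define \<rho>0 where "\<rho>0 = min (min (1/4) \<rho>1) (min (N $ 1 / 6) (min (\<rho>2 / 3) (\<rho>3 / 3)))"
  have \<rho>0: "\<rho>0 > 0" "\<rho>0 \<le> 1/4" "\<rho>0 \<le> \<rho>1" "3 * \<rho>0 \<le> N $ 1 / 2" "3 * \<rho>0 \<le> \<rho>2" "3 * \<rho>0 \<le> \<rho>3"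
    using \<rho>1 \<rho>2 \<rho>3 N1 by (auto simp: \<rho>0_def)
  obtain v1 v2 \<delta> H f where \<delta>: "0 < \<delta>" "\<delta> < \<rho>0" and H: "0 < H" "H < \<rho>0"
    and chart: "local_chart P s1 s2 t1 t2 N v1 v2 (\<nu> N) \<Gamma> D \<nu> (4 * A) l \<epsilon> \<delta> H f"
    and sub: "tangent_frame.cyl N v1 v2 (\<nu> N) \<delta> H \<subseteq> ball N (3 * \<rho>0)"
    using chart_exists[OF N \<epsilon>(1) \<rho>0(1)] by metis
  interpret c: local_chart P s1 s2 t1 t2 N v1 v2 "\<nu> N" \<Gamma> D \<nu> "4 * A" l \<epsilon> \<delta> H f by (rule chart)
  let ?C = "c.cyl \<delta> H"
  let ?h = "\<lambda>p. f (c.proj p) - c.height p"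
  have NC: "N \<in> ?C" using \<delta> H by (simp add: c.cyl_def square_def zero_prod_def)
  have Npatch: "N \<in> c.patch" using N NC by (simp add: c.patch_def)
  have inb: "q \<in> ball N (N $ 1 / 2)" "dist q N < \<rho>2" "dist q N < \<rho>3" if "q \<in> ?C" for q
    using that sub \<rho>0 by (auto simp: dist_commute)
  have Cpos: "?C \<subseteq> {q. q $ 1 > 0}"
  proof
    fix q assume "q \<in> ?C"
    then have "norm (N - q) < N $ 1 / 2" using inb(1) by (simp add: dist_norm)
    then show "q \<in> {q. q $ 1 > 0}" using component_le_norm_cart[of "N - q" 1] by simp
  qed
  have eq: "(\<lambda>q. indicator ?C q * integrand p q) = (\<lambda>q. indicator c.patch q * (\<mu> q * ker \<alpha> (\<nu> q) q p))" for p
    by (auto simp: integrand_def c.patch_def indicator_def)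
  have Gest: "\<bar>\<mu> q * ker_G \<alpha> q p - \<kappa>\<bar> \<le> e1" if q: "q \<in> c.patch" and p: "p \<in> ?C" for q p
  proof -
    have qC: "q \<in> ?C" "q \<in> closure \<Gamma>" using q by (auto simp: c.patch_eq)
    have 1: "\<bar>ker_G \<alpha> q p - 1 / (4 * pi)\<bar> \<le> e2" using \<rho>2(2)[of q p] inb(2) qC p by (simp add: less_imp_le)
    have 2: "\<bar>\<mu> q - \<mu> N\<bar> \<le> e1 / 2" using \<rho>3(2)[of q] inb(3) qC by (simp add: dist_real_def less_imp_le)
    have "\<mu> q * ker_G \<alpha> q p - \<kappa> = \<mu> q * (ker_G \<alpha> q p - 1 / (4 * pi)) + (\<mu> q - \<mu> N) * (1 / (4 * pi))"
      by (simp add: \<kappa>_def algebra_simps diff_divide_distrib)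
    then have "\<bar>\<mu> q * ker_G \<alpha> q p - \<kappa>\<bar> \<le> \<bar>\<mu> q\<bar> * \<bar>ker_G \<alpha> q p - 1 / (4 * pi)\<bar> + \<bar>\<mu> q - \<mu> N\<bar> * (1 / (4 * pi))"
      using abs_triangle_ineq[of "\<mu> q * (ker_G \<alpha> q p - 1 / (4 * pi))" "(\<mu> q - \<mu> N) * (1 / (4 * pi))"] by (simp add: abs_mult)
    also have "\<dots> \<le> M1 * e2 + (e1 / 2) * 1"
      using 1 2 M1 qC e1 pi_gt3 by (intro add_mono mult_mono) auto
    also have "M1 * e2 \<le> (M1 + 1) * e2" using e2 by (intro mult_right_mono) auto
    also have "(M1 + 1) * e2 = e1 / 2"
    proof -
      have "M1 + 1 \<noteq> 0" using M1 by linarith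
      moreover have "s * (e1 / (2 * s)) = e1 / 2" if "s \<noteq> 0" for s using that by simp
      ultimately show ?thesis unfolding e2_def by blast
    qed
    finally show ?thesis by simp
  qed
  have Rest: "\<bar>\<mu> q * ker_R \<alpha> (\<nu> q) q p\<bar> \<le> B" if q: "q \<in> c.patch" and p: "p \<in> ?C" for q p
  proof -
    have qC: "q \<in> ?C" "q \<in> closure \<Gamma>" "q \<in> \<Gamma>" using q closure_subset[of \<Gamma>] by (auto simp: c.patch_def)
    show ?thesis
      unfolding abs_mult B_def using M1 MR qC p inb(1) unit_\<nu>[OF qC(3)] by (intro mult_mono) auto
  qed
  have km: "(\<lambda>q. indicator c.patch q * (\<mu> q * ker \<alpha> (\<nu> q) q p)) \<in> borel_measurable borel" for p
  proof -
    have [measurable]: "?C \<in> sets borel" using c.open_cyl by simp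
    show ?thesis unfolding eq[symmetric] by measurable
  qed
  have near: "integrable area (\<lambda>q. indicator ?C q * integrand p q)"
      "\<bar>(\<integral>q. indicator ?C q * integrand p q \<partial>area) + sgn (?h p) * (\<mu> N / 2)\<bar> \<le> 3 * e / 4 + \<bar>\<kappa>\<bar> * (16 * \<bar>?h p\<bar> / \<delta>)"
    if p: "p \<in> ?C" "c.proj p \<in> square (\<delta> / 2)" for p
  proof -
    have d14: "\<delta> \<le> 1/4" "\<delta> < \<rho>1" using \<delta> \<rho>0 by auto
    have A0: "4 * A \<ge> 0" using A by simp
    note ne = c.near_estimate[OF p A0 less_imp_le[OF \<epsilon>(1)] \<epsilon>(2) \<delta>(1) d14(1) A(2,3) less_imp_le[OF e1] K1(2) _ _ km]
    show "integrable area (\<lambda>q. indicator ?C q * integrand p q)"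
      unfolding eq by (rule ne(1)) (erule Gest[OF _ p(1)], erule Rest[OF _ p(1)])
    have b1: "\<bar>(\<integral>q. indicator c.patch q * (\<mu> q * ker \<alpha> (\<nu> q) q p) \<partial>area) + sgn (?h p) * (2 * pi * \<kappa>)\<bar> \<le>
        2 * K1 * (16 / l\<^sup>2 * (2 * \<delta>) powr l) + (8 * e1 + 40 * \<epsilon> * \<bar>\<kappa>\<bar>) * (2 * pi) + \<bar>\<kappa>\<bar> * (16 * \<bar>?h p\<bar> / \<delta>)"
      unfolding K1_def by (rule ne(2)) (erule Gest[OF _ p(1)], erule Rest[OF _ p(1)])
    have b2: "2 * K1 * (16 / l\<^sup>2 * (2 * \<delta>) powr l) + (8 * e1 + 40 * \<epsilon> * \<bar>\<kappa>\<bar>) * (2 * pi) \<le> 3 * e / 4"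
      using T\<delta>[OF \<delta>(1) d14(2)] K2 by linarith
    \<comment> \<open>The strength 1/(4 pi) times the Poisson mass 2 pi makes the jump half of the
      density on either side.\<close>
    have b3: "2 * pi * \<kappa> = \<mu> N / 2" by (simp add: \<kappa>_def)
    show "\<bar>(\<integral>q. indicator ?C q * integrand p q \<partial>area) + sgn (?h p) * (\<mu> N / 2)\<bar> \<le> 3 * e / 4 + \<bar>\<kappa>\<bar> * (16 * \<bar>?h p\<bar> / \<delta>)"
      unfolding eq using b1[unfolded b3] b2 by linarith
  qed
  have hN: "?h N = 0" using c.patch_estimates(3)[OF Npatch Npatch] by simp
  have N2: "c.proj N \<in> square (\<delta> / 2)" using \<delta> by (simp add: square_def zero_prod_def)
  have "\<forall>\<^sub>F p in nhds N. p \<in> ?C" using NC c.open_cyl by (rule eventually_nhds_in_open[rotated])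
  moreover have "\<forall>\<^sub>F p in nhds N. c.proj p \<in> square (\<delta> / 2)"
  proof -
    have "open (c.proj -` square (\<delta> / 2))" by (rule open_vimage[OF c.open_square c.continuous_on_proj])
    then have "\<forall>\<^sub>F p in nhds N. p \<in> c.proj -` square (\<delta> / 2)" using N2 by (intro eventually_nhds_in_open) auto
    then show ?thesis by simp
  qed
  moreover have "\<forall>\<^sub>F p in nhds N. \<bar>\<kappa>\<bar> * (16 * \<bar>?h p\<bar> / \<delta>) < e / 4"
  proof -
    have "isCont f (c.proj N)"
      using c.graph c.open_square[of \<delta>] NC unfolding c.local_graph_def
      by (metis (no_types, lifting) c.cyl_def continuous_on_eq_continuous_at mem_Collect_eq)
    moreover have "isCont c.proj N" "isCont c.height N"
      using c.continuous_on_proj[of UNIV] c.continuous_on_height[of UNIV]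
      by (simp_all add: continuous_on_eq_continuous_at)
    ultimately have "isCont (\<lambda>p. f (c.proj p)) N" "isCont c.height N"
      using isCont_o2[of N c.proj f] by blast+
    then have "isCont ?h N" by (rule continuous_diff)
    moreover have "isCont (\<lambda>p. \<bar>\<kappa>\<bar> * (16 * \<bar>g p\<bar> / \<delta>)) N" if "isCont g N" for g
      using that \<delta> by (intro continuous_intros) auto
    ultimately have "isCont (\<lambda>p. \<bar>\<kappa>\<bar> * (16 * \<bar>?h p\<bar> / \<delta>)) N" by blast
    then have "((\<lambda>p. \<bar>\<kappa>\<bar> * (16 * \<bar>?h p\<bar> / \<delta>)) \<longlongrightarrow> \<bar>\<kappa>\<bar> * (16 * \<bar>?h N\<bar> / \<delta>)) (nhds N)"
      using tendsto_at_iff_tendsto_nhds[of "\<lambda>p. \<bar>\<kappa>\<bar> * (16 * \<bar>?h p\<bar> / \<delta>)" N] unfolding isCont_def by blast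
    then show ?thesis using e hN by (intro order_tendstoD(2)[where y = "\<bar>\<kappa>\<bar> * (16 * \<bar>?h N\<bar> / \<delta>)"]) simp_all
  qed
  ultimately have "\<forall>\<^sub>F p in nhds N. p \<in> ?C \<and> c.proj p \<in> square (\<delta> / 2) \<and> \<bar>\<kappa>\<bar> * (16 * \<bar>?h p\<bar> / \<delta>) < e / 4"
    by eventually_elim auto
  then obtain \<rho> where \<rho>: "\<rho> > 0" "\<And>p. p \<in> ball N \<rho> \<Longrightarrow> p \<in> ?C \<and> c.proj p \<in> square (\<delta> / 2) \<and> \<bar>\<kappa>\<bar> * (16 * \<bar>?h p\<bar> / \<delta>) < e / 4"
    unfolding eventually_nhds_metric by (auto simp: dist_commute)
  show ?thesis
  proof (rule that[of ?C \<rho>])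
    \<comment> \<open>At N the height difference is 0, so the sign term disappears.\<close>
    show "\<bar>\<integral>q. indicator ?C q * integrand N q \<partial>area\<bar> < e"
      using near(2)[OF NC N2] e unfolding hN by simp
    fix p assume p: "p \<in> ball N \<rho>"
    have b: "\<bar>(\<integral>q. indicator ?C q * integrand p q \<partial>area) + sgn (?h p) * (\<mu> N / 2)\<bar> < e"
      using near(2)[of p] \<rho>(2)[OF p] by linarith
    show "integrable area (\<lambda>q. indicator ?C q * integrand p q)" using near(1)[of p] \<rho>(2)[OF p] by blast
    show "\<bar>(\<integral>q. indicator ?C q * integrand p q \<partial>area) + \<mu> N / 2\<bar> < e" if "p \<in> D"
    proof -
      have "?h p > 0" using c.graph that \<rho>(2)[OF p] unfolding c.local_graph_def by auto
      then show ?thesis using b by simp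
    qed
    show "\<bar>(\<integral>q. indicator ?C q * integrand p q \<partial>area) - \<mu> N / 2\<bar> < e" if "p \<notin> closure D"
    proof -
      have "?h p < 0" using c.graph that \<rho>(2)[OF p] unfolding c.local_graph_def by auto
      then show ?thesis using b by simp
    qed
  qed (use c.open_cyl NC Cpos \<rho>(1) in auto)
qed

lemma integrand_split:
  assumes "integrable area (\<lambda>q. indicator C q * integrand p q)" "integrable area (\<lambda>q. indicator (- C) q * integrand p q)"
  shows "integrable area (integrand p)"
    and "W p = (\<integral>q. indicator C q * integrand p q \<partial>area) + (\<integral>q. indicator (- C) q * integrand p q \<partial>area)"
proof -
  have eq: "integrand p = (\<lambda>q. indicator C q * integrand p q + indicator (- C) q * integrand p q)"
    by (auto simp: fun_eq_iff indicator_def)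
  show "integrable area (integrand p)" by (subst eq) (intro Bochner_Integration.integrable_add assms)
  show "W p = (\<integral>q. indicator C q * integrand p q \<partial>area) + (\<integral>q. indicator (- C) q * integrand p q \<partial>area)"
    unfolding W_def by (subst eq) (rule Bochner_Integration.integral_add[OF assms])
qed

text \<open>Three errors of e/3: the local part at p against the jump, the local part at N, and the
  variation of the far part. As the local part at N is small, the far part at N may be replaced by W
  N. The neighbourhood C depends on e, so the splitting is redone for every e.\<close>

lemma potential_limits:
  assumes N: "N \<in> \<Gamma>"
  shows "integrable area (integrand N)"
    and "(W \<longlongrightarrow> - (1/2) * \<mu> N + W N) (at N within D)"
    and "(W \<longlongrightarrow> 1/2 * \<mu> N + W N) (at N within - closure D)"
proof -
  have main: "integrable area (integrand N) \<and> (\<exists>r>0. \<forall>p\<in>ball N r. (p \<in> D \<longrightarrow> \<bar>W p - (- (1/2) * \<mu> N + W N)\<bar> < e) \<and>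
      (p \<notin> closure D \<longrightarrow> \<bar>W p - (1/2 * \<mu> N + W N)\<bar> < e))" if e: "e > 0" for e
  proof -
    have e3: "e / 3 > 0" using e by simp
    obtain C \<rho> where C: "open C" "N \<in> C" "C \<subseteq> {q. q $ 1 > 0}" and \<rho>: "\<rho> > 0"
      and int: "\<And>p. p \<in> ball N \<rho> \<Longrightarrow> integrable area (\<lambda>q. indicator C q * integrand p q)"
      and near: "\<bar>\<integral>q. indicator C q * integrand N q \<partial>area\<bar> < e / 3"
        "\<And>p. p \<in> ball N \<rho> \<Longrightarrow> p \<in> D \<Longrightarrow> \<bar>(\<integral>q. indicator C q * integrand p q \<partial>area) + \<mu> N / 2\<bar> < e / 3"
        "\<And>p. p \<in> ball N \<rho> \<Longrightarrow> p \<notin> closure D \<Longrightarrow> \<bar>(\<integral>q. indicator C q * integrand p q \<partial>area) - \<mu> N / 2\<bar> < e / 3"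
      by (rule local_estimate[OF N e3]) blast
    define F where "F p = (\<integral>q. indicator (- C) q * integrand p q \<partial>area)" for p
    have "isCont F N" unfolding F_def by (rule far_continuous(1)[OF N C])
    then obtain r1 where r1: "r1 > 0" "\<And>p. dist p N < r1 \<Longrightarrow> dist (F p) (F N) < e / 3"
      unfolding continuous_at_eps_delta using e3 by blast
    obtain r2 where r2: "r2 > 0" "\<And>p. p \<in> ball N r2 \<Longrightarrow> integrable area (\<lambda>q. indicator (- C) q * integrand p q)"
      using far_continuous(2)[OF N C] by blast
    have Np: "N \<in> ball N \<rho>" "N \<in> ball N r2" using \<rho> r2 by auto
    note sN = integrand_split[OF int[OF Np(1)] r2(2)[OF Np(2)], folded F_def]
    have "(p \<in> D \<longrightarrow> \<bar>W p - (- (1/2) * \<mu> N + W N)\<bar> < e) \<and> (p \<notin> closure D \<longrightarrow> \<bar>W p - (1/2 * \<mu> N + W N)\<bar> < e)"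
      if p: "p \<in> ball N (min \<rho> (min r1 r2))" for p
    proof -
      have pp: "p \<in> ball N \<rho>" "p \<in> ball N r2" "dist p N < r1" using p by (auto simp: dist_commute)
      have s: "W p = (\<integral>q. indicator C q * integrand p q \<partial>area) + F p"
        unfolding F_def by (rule integrand_split(2)[OF int[OF pp(1)] r2(2)[OF pp(2)]])
      have f: "\<bar>F p - F N\<bar> < e / 3" using r1(2)[OF pp(3)] by (simp add: dist_real_def)
      show ?thesis using near(1) near(2,3)[OF pp(1)] f unfolding s sN(2) by argo
    qed
    then show ?thesis using sN(1) \<rho> r1(1) r2(1) by (intro conjI exI[of _ "min \<rho> (min r1 r2)"]) auto
  qed
  show "integrable area (integrand N)" using main[OF zero_less_one] by blast
  show "(W \<longlongrightarrow> - (1/2) * \<mu> N + W N) (at N within D)"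
  proof (rule tendstoI)
    fix e :: real assume "e > 0"
    then obtain r where "r > 0" "\<And>p. p \<in> ball N r \<Longrightarrow> p \<in> D \<Longrightarrow> \<bar>W p - (- (1/2) * \<mu> N + W N)\<bar> < e" using main by blast
    then show "\<forall>\<^sub>F p in at N within D. dist (W p) (- (1/2) * \<mu> N + W N) < e"
      unfolding eventually_at dist_real_def by (intro exI[of _ r]) (auto simp: dist_commute)
  qed
  show "(W \<longlongrightarrow> 1/2 * \<mu> N + W N) (at N within - closure D)"
  proof (rule tendstoI)
    fix e :: real assume "e > 0"
    then obtain r where "r > 0" "\<And>p. p \<in> ball N r \<Longrightarrow> p \<notin> closure D \<Longrightarrow> \<bar>W p - (1/2 * \<mu> N + W N)\<bar> < e" using main by blast
    then show "\<forall>\<^sub>F p in at N within - closure D. dist (W p) (1/2 * \<mu> N + W N) < e"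
      unfolding eventually_at dist_real_def by (intro exI[of _ r]) (auto simp: dist_commute)
  qed
qed

end

section \<open>From the geometric setting to the theorem\<close>

lemma layer_of_admissible_domain:
  assumes \<alpha>: "0 < 2 * \<alpha>" "2 * \<alpha> < 1"
    and adm: "admissible_domain D X \<Gamma> \<nu> P s1 s2 t1 t2 t0"
    and \<mu>: "continuous_on (closure \<Gamma>) \<mu>"
  obtains A l d where "layer P s1 s2 t1 t2 \<Gamma> D \<nu> \<mu> \<alpha> A l d"
proof -
  have lyap: "lyapunov_surface \<Gamma> \<nu>" and \<Gamma>_pos: "\<Gamma> \<subseteq> {p. p$1 > 0}"
    and D: "open D" "frontier D = closure X \<union> closure \<Gamma>"
    and X: "openin (top_of_set {p. p$1 = 0}) X"
    and out: "\<forall>N\<in>\<Gamma>. outward_at D N (\<nu> N)" and st: "s1 < s2" "t1 < t2"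
    and P: "P ` ({s1..s2} \<times> {t1..t2}) = closure \<Gamma>" "C1_parametrization P s1 s2 t1 t2"
    and bd: "\<forall>s\<in>{s1..s2}. P (s, t0) $ 1 = 0" "closure \<Gamma> - \<Gamma> = (\<lambda>s. P (s, t0)) ` {s1..s2}"
    using adm unfolding admissible_domain_def by - (elim conjE, assumption)+
  obtain d where d: "d > 0" "\<And>N p q c. N \<in> \<Gamma> \<Longrightarrow> p \<in> \<Gamma> \<inter> ball N d \<Longrightarrow> q \<in> \<Gamma> \<inter> ball N d \<Longrightarrow> q = p + c *\<^sub>R \<nu> N \<Longrightarrow> q = p"
    using lyap unfolding lyapunov_surface_def by blast
  obtain A l where A: "A > 0" "0 < l" "l \<le> 1" "\<And>M N. M \<in> \<Gamma> \<Longrightarrow> N \<in> \<Gamma> \<Longrightarrow> arccos (\<nu> M \<bullet> \<nu> N) \<le> A * dist M N powr l"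
    using lyap unfolding lyapunov_surface_def by blast
  have normal: "unit_normal_at \<Gamma> M (\<nu> M)" if "M \<in> \<Gamma>" for M
    using lyap that unfolding lyapunov_surface_def by blast
  have X0: "p $ 1 = 0" if "p \<in> closure X" for p
  proof -
    have "closed {p::real^3. p $ 1 = 0}" by (intro closed_Collect_eq continuous_intros)
    moreover have "X \<subseteq> {p. p $ 1 = 0}" using openin_imp_subset[OF X] .
    ultimately show ?thesis using that closure_minimal by blast
  qed
  have \<Gamma>_bd: "q $ 1 = 0" if "q \<in> closure \<Gamma>" "q \<notin> \<Gamma>" for q
  proof -
    have "q \<in> (\<lambda>s. P (s, t0)) ` {s1..s2}" unfolding bd(2)[symmetric] using that by (rule DiffI)
    then obtain s where "s \<in> {s1..s2}" "q = P (s, t0)" by (rule imageE)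
    then show ?thesis using bd(1) by simp
  qed
  have par: "parametrized P s1 s2 t1 t2" using st P by unfold_locales
  have R: "parametrized.R s1 s2 t1 t2 = {s1..s2} \<times> {t1..t2}"
    by (rule parametrized.R_def[OF par])
  have "layer P s1 s2 t1 t2 \<Gamma> D \<nu> \<mu> \<alpha> A l d"
  proof (rule layer.intro[OF par], rule layer_axioms.intro)
    show "P ` parametrized.R s1 s2 t1 t2 = closure \<Gamma>" unfolding R by (rule P(1))
    show "norm (\<nu> M - \<nu> M') \<le> A * dist M M' powr l" if "M \<in> \<Gamma>" "M' \<in> \<Gamma>" for M M'
      using norm_diff_le_arccos[of "\<nu> M" "\<nu> M'"] normal[OF that(1)] normal[OF that(2)] A(4)[OF that]
      by (auto simp: unit_normal_at_def)
    show "p \<in> \<Gamma>" if "p \<in> frontier D" "p $ 1 > 0" for p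
    proof -
      \<comment> \<open>The closure of X and the part of \<open>closure \<Gamma>\<close> outside
        \<Gamma> both lie in the plane x = 0.\<close>
      have "p \<in> closure X \<or> p \<in> closure \<Gamma>" using that(1) D(2) by blast
      then show ?thesis using X0[of p] \<Gamma>_bd[of p] that(2) by auto
    qed
    show "\<Gamma> \<subseteq> frontier D" using D(2) closure_subset[of \<Gamma>] by auto
    show "q = p" if "N \<in> \<Gamma>" "p \<in> \<Gamma>" "p \<in> ball N d" "q \<in> \<Gamma>" "q \<in> ball N d" "q = p + c *\<^sub>R \<nu> N" for N p q c
      using d(2)[of N p q c] that by blast
    show "q $ 1 = 0" if "q \<in> closure \<Gamma>" "q \<notin> \<Gamma>" for q by (rule \<Gamma>_bd[OF that])
    show "unit_normal_at \<Gamma> M (\<nu> M)" if "M \<in> \<Gamma>" for M by (rule normal[OF that])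
    show "outward_at D N (\<nu> N)" if "N \<in> \<Gamma>" for N using out that by blast
    show "q $ 1 > 0" if "q \<in> \<Gamma>" for q using \<Gamma>_pos that by blast
  qed (fact \<alpha> d(1) A(1,2,3) D(1) \<mu>)+
  then show ?thesis by (rule that)
qed

theorem theorem1:
  fixes \<alpha> s1 s2 t1 t2 t0 :: real
    and D X \<Gamma> :: "(real^3) set"
    and \<nu> :: "real^3 \<Rightarrow> real^3"
    and P :: "real \<times> real \<Rightarrow> real^3"
    and \<mu> :: "real^3 \<Rightarrow> real"
  assumes "0 < 2 * \<alpha>" and "2 * \<alpha> < 1"
    and "admissible_domain D X \<Gamma> \<nu> P s1 s2 t1 t2 t0"
    and "continuous_on (closure \<Gamma>) \<mu>"
  shows "(\<forall>p. p$1 > 0 \<and> p \<notin> \<Gamma> \<longrightarrow>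
            surface_integrable P s1 s2 t1 t2
              (\<lambda>u. \<mu> (P u) * conormal_deriv \<alpha> (\<nu> (P u)) (\<lambda>q. q1 \<alpha> q p) (P u))) \<and>
         (\<forall>s\<in>{s1..s2}. \<forall>t\<in>{t1..t2}. P (s, t) \<in> \<Gamma> \<longrightarrow>
            surface_integrable P s1 s2 t1 t2
              (\<lambda>u. \<mu> (P u) * kernel_K1 \<alpha> \<nu> P (s, t) u) \<and>
            (double_layer \<alpha> \<nu> P s1 s2 t1 t2 \<mu> \<longlongrightarrow>
               - (1/2) * \<mu> (P (s, t)) +
               surface_integral P s1 s2 t1 t2 (\<lambda>u. \<mu> (P u) * kernel_K1 \<alpha> \<nu> P (s, t) u))
              (at (P (s, t)) within D) \<and>
            (double_layer \<alpha> \<nu> P s1 s2 t1 t2 \<mu> \<longlongrightarrow>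
               1/2 * \<mu> (P (s, t)) +
               surface_integral P s1 s2 t1 t2 (\<lambda>u. \<mu> (P u) * kernel_K1 \<alpha> \<nu> P (s, t) u))
              (at (P (s, t)) within - closure D))"
proof -
  obtain A l d where "layer P s1 s2 t1 t2 \<Gamma> D \<nu> \<mu> \<alpha> A l d"
    using layer_of_admissible_domain[OF assms] by blast
  then interpret layer P s1 s2 t1 t2 \<Gamma> D \<nu> \<mu> \<alpha> A l d .
  have dl: "double_layer \<alpha> \<nu> P s1 s2 t1 t2 \<mu> p = W p" if "p $ 1 > 0" for p
    unfolding double_layer_def by (rule surface_integral_integrand(2)[OF that])
  \<comment> \<open>\<open>double_layer\<close> and W are identified only for x > 0, but this
    half-space is a neighbourhood of every point of \<Gamma>.\<close>
  have lim: "(double_layer \<alpha> \<nu> P s1 s2 t1 t2 \<mu> \<longlongrightarrow> L) (at N within S)"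
    if "(W \<longlongrightarrow> L) (at N within S)" "N $ 1 > 0" for N S L
  proof (rule Lim_transform_eventually[OF that(1)])
    have "open {p::real^3. p $ 1 > 0}" by (intro open_Collect_less continuous_intros)
    then have "\<forall>\<^sub>F p in at N within S. p \<in> {p. p $ 1 > 0}"
      using that(2) by (intro topological_tendstoD[OF tendsto_ident_at]) auto
    then show "\<forall>\<^sub>F p in at N within S. W p = double_layer \<alpha> \<nu> P s1 s2 t1 t2 \<mu> p"
      by eventually_elim (simp add: dl)
  qed
  show ?thesis
  proof (intro conjI allI ballI impI)
    fix p :: "real^3" assume "p $ 1 > 0 \<and> p \<notin> \<Gamma>"
    then show "surface_integrable P s1 s2 t1 t2
        (\<lambda>u. \<mu> (P u) * conormal_deriv \<alpha> (\<nu> (P u)) (\<lambda>q. q1 \<alpha> q p) (P u))"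
      using surface_integral_integrand(1)[of p] integrable_integrand_off_surface[of p] by blast
  next
    fix s t assume N: "P (s, t) \<in> \<Gamma>"
    note pos = \<Gamma>_pos[OF N]
    show "surface_integrable P s1 s2 t1 t2 (\<lambda>u. \<mu> (P u) * kernel_K1 \<alpha> \<nu> P (s, t) u)"
      unfolding kernel_K1_def using surface_integral_integrand(1)[OF pos] potential_limits(1)[OF N] by blast
    show "(double_layer \<alpha> \<nu> P s1 s2 t1 t2 \<mu> \<longlongrightarrow> - (1/2) * \<mu> (P (s, t)) +
        surface_integral P s1 s2 t1 t2 (\<lambda>u. \<mu> (P u) * kernel_K1 \<alpha> \<nu> P (s, t) u)) (at (P (s, t)) within D)"
      unfolding kernel_K1_def surface_integral_integrand(2)[OF pos] by (rule lim[OF potential_limits(2)[OF N] pos])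
    show "(double_layer \<alpha> \<nu> P s1 s2 t1 t2 \<mu> \<longlongrightarrow> 1/2 * \<mu> (P (s, t)) +
        surface_integral P s1 s2 t1 t2 (\<lambda>u. \<mu> (P u) * kernel_K1 \<alpha> \<nu> P (s, t) u)) (at (P (s, t)) within - closure D)"
      unfolding kernel_K1_def surface_integral_integrand(2)[OF pos] by (rule lim[OF potential_limits(3)[OF N] pos])
  qed
qed

end
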